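(* Let $f_0$ be a singularity (in any number of variables) that is stably equivalent to $f_0^{(0,b)}(x,y)=x^4+y^6+bx^2y^4$ for some $b\in\mathbb{C}$. Then $\lambda(f_0)=1$.
   Context: A germ $f_0:(\mathbb{C}^n,0)\to(\mathbb{C},0)$ of a holomorphic function is an (isolated) singularity if it has an isolated critical point at $0$, i.e. some holomorphic representative on an open neighbourhood $U$ of $0$ satisfies $f_0(0)=0$, $\nabla f_0(0)=0$ and $\nabla f_0(z)\neq 0$ for $z\in U\setminus\{0\}$. Let $\mathcal{O}^n$ be the ring of germs at $0$ of holomorphic functions on $\mathbb{C}^n$. The Milnor number of a germ $g$ is $\mu(g)=\dim_{\mathbb{C}}\mathcal{O}^n/(\nabla g)$, where $(\nabla g)$ is the ideal generated by $\partial g/\partial z_1,\dots,\partial g/\partial z_n$ (so $\mu(g)=0$ if $\nabla g(0)\neq 0$). A deformation of a singularity $f_0$ is the germ of a holomorphic function $f=f(s,z):(\mathbb{C}\times\mathbb{C}^n,0)\to(\mathbb{C},0)$ such that: (1) $f(0,z)=f_0(z)$; (2) $f(s,0)=0$; (3) for each sufficiently small $|s|$, $\nabla_z f(s,z)\neq 0$ for $z\neq 0$ in a small neighbourhood of $0\in\mathbb{C}^n$. Write $f_s(z)=f(s,z)$; germs $f_s$ with $\nabla f_s(0)\ne 0$ are allowed. By upper semicontinuity, $\mu(f_s)$ is constant for all sufficiently small $s\neq 0$ and is at most $\mu(f_0)$. The jump of the deformation is $\lambda((f_s)):=\mu(f_0)-\mu(f_s)$ for small $s\neq0$. The jump of the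 Milnor number of $f_0$, denoted $\lambda(f_0)$, is the smallest nonzero value among the jumps of all deformations of $f_0$. Two germs $f:(\mathbb{C}^n,0)\to(\mathbb{C},0)$ and $g:(\mathbb{C}^m,0)\to(\mathbb{C},0)$ are stably equivalent if there exist $p\geq\max(m,n)$ and a biholomorphism $\Phi:(\mathbb{C}^p,0)\to(\mathbb{C}^p,0)$ with $\widetilde f\circ\Phi=\widetilde g$, where $\widetilde f=f(z_1,\dots,z_n)+z_{n+1}^2+\dots+z_p^2$ and $\widetilde g=g(w_1,\dots,w_m)+w_{m+1}^2+\dots+w_p^2$. *)

theory Defs
  imports
    "HOL-Analysis.Analysis"
    "HOL-Library.Extended_Nat"
    "HOL-Algebra.QuotRing"
    "HOL-Algebra.Embedded_Algebras"
begin

section \<open>Holomorphic germs at the origin of affine n-space\<close>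

text \<open>
  The number of variables has to be an ordinary natural number, since stable equivalence compares
  germs in different dimensions. So affine n-space is the set of sequences that vanish from index
  \<open>n\<close> on; the product topology of \<^typ>\<open>nat \<Rightarrow> complex\<close> induces the Euclidean topology on it.
  Coordinates are numbered from 0.
\<close>

definition cspace :: "nat \<Rightarrow> (nat \<Rightarrow> complex) set" where
  "cspace n = {z. \<forall>i\<ge>n. z i = 0}"

definition origin :: "nat \<Rightarrow> complex" where
  "origin = (\<lambda>_. 0)"

definition open_in_cspace :: "nat \<Rightarrow> (nat \<Rightarrow> complex) set \<Rightarrow> bool" where
  "open_in_cspace n U \<longleftrightarrow> openin (top_of_set (cspace n)) U"

text \<open>Unlike \<open>at origin within cspace n\<close>, this filter does not leave out the origin.\<close>

definition near_origin :: "nat \<Rightarrow> (nat \<Rightarrow> complex) filter" where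
  "near_origin n = inf (nhds origin) (principal (cspace n))"

text \<open>
  Holomorphic functions of several variables: continuous, and holomorphic in each variable
  separately (by Osgood's lemma, equivalently, given locally by power series). The set \<open>U\<close> is meant to be open in \<open>cspace n\<close>.
\<close>

definition holo_on :: "nat \<Rightarrow> ((nat \<Rightarrow> complex) \<Rightarrow> complex) \<Rightarrow> (nat \<Rightarrow> complex) set \<Rightarrow> bool" where
  "holo_on n f U \<longleftrightarrow> continuous_on U f \<and>
     (\<forall>z\<in>U. \<forall>i<n. (\<lambda>w. f (z(i := w))) field_differentiable (at (z i)))"

text \<open>
  A germ is given by a representative defined on the whole type, whose values away from a
  neighbourhood of the origin in \<open>cspace n\<close> are irrelevant.
\<close>

definition holo_germ :: "nat \<Rightarrow> ((nat \<Rightarrow> complex) \<Rightarrow> complex) \<Rightarrow> bool" where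
  "holo_germ n f \<longleftrightarrow> (\<exists>U. open_in_cspace n U \<and> origin \<in> U \<and> holo_on n f U)"

definition partial_deriv ::
  "nat \<Rightarrow> ((nat \<Rightarrow> complex) \<Rightarrow> complex) \<Rightarrow> (nat \<Rightarrow> complex) \<Rightarrow> complex" where
  "partial_deriv i f z = deriv (\<lambda>w. f (z(i := w))) (z i)"

definition grad_zero :: "nat \<Rightarrow> ((nat \<Rightarrow> complex) \<Rightarrow> complex) \<Rightarrow> (nat \<Rightarrow> complex) \<Rightarrow> bool" where
  "grad_zero n f z \<longleftrightarrow> (\<forall>i<n. partial_deriv i f z = 0)"

definition isolated_singularity :: "nat \<Rightarrow> ((nat \<Rightarrow> complex) \<Rightarrow> complex) \<Rightarrow> bool" where
  "isolated_singularity n f \<longleftrightarrow>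
     (\<exists>U. open_in_cspace n U \<and> origin \<in> U \<and> holo_on n f U \<and>
        f origin = 0 \<and> grad_zero n f origin \<and> (\<forall>z\<in>U - {origin}. \<not> grad_zero n f z))"


section \<open>The Milnor number\<close>

definition holo_ring :: "nat \<Rightarrow> ((nat \<Rightarrow> complex) \<Rightarrow> complex) ring" where
  "holo_ring n =
     \<lparr>carrier = {f. holo_germ n f},
      mult = (\<lambda>f g z. f z * g z), one = (\<lambda>_. 1),
      zero = (\<lambda>_. 0), add = (\<lambda>f g z. f z + g z)\<rparr>"

definition null_germs :: "nat \<Rightarrow> ((nat \<Rightarrow> complex) \<Rightarrow> complex) set" where
  "null_germs n = {f. holo_germ n f \<and> (\<forall>\<^sub>F z in near_origin n. f z = 0)}"

text \<open>Two representatives are identified precisely if they agree on a neighbourhood of the origin.\<close>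

definition germ_ring :: "nat \<Rightarrow> ((nat \<Rightarrow> complex) \<Rightarrow> complex) set ring" where
  "germ_ring n = holo_ring n Quot null_germs n"

definition germ :: "nat \<Rightarrow> ((nat \<Rightarrow> complex) \<Rightarrow> complex) \<Rightarrow> ((nat \<Rightarrow> complex) \<Rightarrow> complex) set" where
  "germ n f = null_germs n +>\<^bsub>holo_ring n\<^esub> f"

definition gradient_ideal ::
  "nat \<Rightarrow> ((nat \<Rightarrow> complex) \<Rightarrow> complex) \<Rightarrow> ((nat \<Rightarrow> complex) \<Rightarrow> complex) set set" where
  "gradient_ideal n g = Idl\<^bsub>germ_ring n\<^esub> ((\<lambda>i. germ n (partial_deriv i g)) ` {..<n})"

definition milnor_algebra ::
  "nat \<Rightarrow> ((nat \<Rightarrow> complex) \<Rightarrow> complex) \<Rightarrow> ((nat \<Rightarrow> complex) \<Rightarrow> complex) set set ring" where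
  "milnor_algebra n g = germ_ring n Quot gradient_ideal n g"

definition milnor_constants ::
  "nat \<Rightarrow> ((nat \<Rightarrow> complex) \<Rightarrow> complex) \<Rightarrow> ((nat \<Rightarrow> complex) \<Rightarrow> complex) set set set" where
  "milnor_constants n g = range (\<lambda>c. gradient_ideal n g +>\<^bsub>germ_ring n\<^esub> germ n (\<lambda>_. c))"

text \<open>
  The complex dimension is the dimension over the image of the constants. The set below has at most
  one element; it is empty, and the Milnor number \<open>\<infinity>\<close>, if the dimension is infinite.
\<close>

definition milnor_number :: "nat \<Rightarrow> ((nat \<Rightarrow> complex) \<Rightarrow> complex) \<Rightarrow> enat" where
  "milnor_number n g =
     Inf {enat d | d. ring.dimension (milnor_algebra n g) d
                        (milnor_constants n g) (carrier (milnor_algebra n g))}"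


section \<open>Deformations and the jump of the Milnor number\<close>

text \<open>
  Joint holomorphy in \<open>(s, z)\<close> is holomorphy in \<open>n + 1\<close> variables, the parameter \<open>s\<close> being
  variable 0. In the last condition the neighbourhood in the \<open>z\<close>-space may depend on \<open>s\<close>.
\<close>

definition deformation ::
  "nat \<Rightarrow> ((nat \<Rightarrow> complex) \<Rightarrow> complex) \<Rightarrow> (complex \<Rightarrow> (nat \<Rightarrow> complex) \<Rightarrow> complex) \<Rightarrow> bool" where
  "deformation n f0 f \<longleftrightarrow>
     holo_germ (Suc n) (\<lambda>w. f (w 0) (\<lambda>i. w (Suc i))) \<and>
     (\<forall>\<^sub>F z in near_origin n. f 0 z = f0 z) \<and>
     (\<forall>\<^sub>F s in nhds 0. f s origin = 0) \<and>
     (\<forall>\<^sub>F s in nhds 0. \<forall>\<^sub>F z in at origin within cspace n. \<not> grad_zero n (f s) z)"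

text \<open>
  The jump of a deformation is \<open>\<mu>(f0) - \<mu>(f s)\<close> for small nonzero \<open>s\<close>; stating it additively avoids
  truncated subtraction. It is a natural number because the Milnor number is upper semicontinuous.
\<close>

definition has_jump ::
  "nat \<Rightarrow> ((nat \<Rightarrow> complex) \<Rightarrow> complex) \<Rightarrow> (complex \<Rightarrow> (nat \<Rightarrow> complex) \<Rightarrow> complex) \<Rightarrow> nat \<Rightarrow> bool"
where
  "has_jump n f0 f d \<longleftrightarrow> (\<forall>\<^sub>F s in at 0. milnor_number n f0 = milnor_number n (f s) + enat d)"

text \<open>The infimum in \<^typ>\<open>enat\<close> is the least element, or \<open>\<infinity>\<close> if there is no nonzero jump.\<close>

definition jump_of_milnor_number :: "nat \<Rightarrow> ((nat \<Rightarrow> complex) \<Rightarrow> complex) \<Rightarrow> enat" where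
  "jump_of_milnor_number n f0 =
     Inf {enat d | d. d \<noteq> 0 \<and> (\<exists>f. deformation n f0 f \<and> has_jump n f0 f d)}"


section \<open>Stable equivalence\<close>

definition stabilization ::
  "nat \<Rightarrow> nat \<Rightarrow> ((nat \<Rightarrow> complex) \<Rightarrow> complex) \<Rightarrow> (nat \<Rightarrow> complex) \<Rightarrow> complex" where
  "stabilization n p f z = f (\<lambda>i. if i < n then z i else 0) + (\<Sum>i=n..<p. (z i)\<^sup>2)"

definition biholo_germ :: "nat \<Rightarrow> ((nat \<Rightarrow> complex) \<Rightarrow> (nat \<Rightarrow> complex)) \<Rightarrow> bool" where
  "biholo_germ p \<Phi> \<longleftrightarrow>
     (\<exists>U V. open_in_cspace p U \<and> open_in_cspace p V \<and> origin \<in> U \<and> \<Phi> origin = origin \<and>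
        bij_betw \<Phi> U V \<and>
        (\<forall>i<p. holo_on p (\<lambda>z. \<Phi> z i) U) \<and>
        (\<forall>i<p. holo_on p (\<lambda>w. inv_into U \<Phi> w i) V))"

definition stably_equivalent ::
  "nat \<Rightarrow> ((nat \<Rightarrow> complex) \<Rightarrow> complex) \<Rightarrow> nat \<Rightarrow> ((nat \<Rightarrow> complex) \<Rightarrow> complex) \<Rightarrow> bool" where
  "stably_equivalent n f m g \<longleftrightarrow>
     (\<exists>p \<Phi>. p \<ge> max m n \<and> biholo_germ p \<Phi> \<and>
        (\<forall>\<^sub>F z in near_origin p. stabilization n p f (\<Phi> z) = stabilization m p g z))"

end

(*
  Since f0 = x^4 + y^6 + b x^2 y^4 is a function k(x, y^2), one may replace y^2 by y^2 + s x. For s \<noteq> 0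
  the function k(x, y^2 + s x) is of type E_14 with Milnor number 14, while f0 has Milnor number 15.
  Both numbers come from dim O/(a, c b) = dim O/(a, b) + dim O/(a, c) with c a coordinate, which
  reduces everything to ideals generated by powers of coordinates.

  To move this deformation to a stably equivalent germ in n variables, stabilize it to p variables,
  transport it by the biholomorphism, and then eliminate the variables n, ..., p - 1 one at a time:
  the last variable w is replaced by the holomorphic solution w(s, z) of dG/dw = 0. This does not
  change the Milnor algebra, and since w(0, z) = 0 it recovers f0 at s = 0. No uniqueness in the
  splitting lemma is needed.
*)
theory Submission
  imports Defs "HOL-Complex_Analysis.Complex_Analysis"
begin

section \<open>Parametric Cauchy integrals and divided differences\<close>


text \<open>Only nonzero jumps compete in \<open>jump_of_milnor_number\<close>, so a single
  deformation of jump 1 decides the value. The numbers 15 and 14 have a common origin. Put k(x, u) =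
  x^4 + u^3 + b x^2 u^2, of Milnor number 6. Lifting k to the double cover branched along a smooth
  curve C gives the Milnor number 2 * 6 + (m - 1), where m is the order of k on C. For s = 0 the
  curve is u = 0 and m = 4; for nonzero s it is u = s x and m = 3. Tilting the branch curve
  therefore costs exactly one. What shapes the analysis is that holomorphy means continuity together
  with holomorphy in each variable. All local tools are drawn from one object, the divided
  difference as a Cauchy integral: holomorphic partial derivatives, the chain rule, division by a
  coordinate and the implicit function theorem. The algebra stays with representatives and explicit
  bases of quotients; the Milnor number as a ring-theoretic dimension is reached only through
  \<open>milnor_number_eq\<close>.\<close>

lemma continuous_on_contour_integral_param:
  fixes K :: "'a::topological_space \<Rightarrow> complex \<Rightarrow> complex"
  assumes r: "0 \<le> r" and cont: "continuous_on (U \<times> sphere c r) (\<lambda>(x, u). K x u)"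
  shows "continuous_on U (\<lambda>x. contour_integral (circlepath c r) (K x))"
proof -
  have sub: "(\<lambda>(x, t). (x, circlepath c r t)) ` (U \<times> cbox 0 1) \<subseteq> U \<times> sphere c r"
    using r path_image_circlepath_nonneg[OF r, of c] by (auto simp: path_image_def)
  have c1: "continuous_on (U \<times> cbox 0 1) (\<lambda>(x, t). (x, circlepath c r t))"
    unfolding split_beta circlepath by (intro continuous_intros)
  have "continuous_on (U \<times> cbox 0 1)
      (\<lambda>(x, t). K x (circlepath c r t) * vector_derivative (circlepath c r) (at t))"
    using continuous_on_compose2[OF cont c1 sub]
    unfolding split_beta vector_derivative_circlepath
    by (intro continuous_intros) (simp add: split_beta)
  from integral_continuous_on_param[OF this] show ?thesis
    by (simp add: contour_integral_integral)
qed

text \<open>Cauchy's formula turns the derivative into an integral over the boundary circle, whose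
  kernel is jointly continuous because \<open>w\<close> stays off the circle. Continuity of
  \<open>F\<close> is therefore asked for up to the closed ball.\<close>

lemma continuous_on_deriv_param:
  fixes F :: "'a::topological_space \<Rightarrow> complex \<Rightarrow> complex"
  assumes cont: "continuous_on (S \<times> cball c r) (\<lambda>(x, w). F x w)"
    and holo: "\<And>x. x \<in> S \<Longrightarrow> F x holomorphic_on ball c r"
  shows "continuous_on (S \<times> ball c r) (\<lambda>(x, w). deriv (F x) w)"
proof (cases "r > 0")
  case True
  have eq: "deriv (F x) w = 1 / (2 * of_real pi * \<i>) * contour_integral (circlepath c r) (\<lambda>u. F x u / (u - w)\<^sup>2)"
    if "x \<in> S" "w \<in> ball c r" for x w
  proof (rule DERIV_imp_deriv, rule Cauchy_derivative_integral_circlepath(2))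
    show "continuous_on (cball c r) (F x)"
      using that
      by (intro continuous_on_compose2[OF cont, of _ "\<lambda>w. (x, w)", unfolded split_beta fst_conv snd_conv])
        (auto intro!: continuous_intros)
  qed (use holo that in auto)
  have "continuous_on ((S \<times> ball c r) \<times> sphere c r) (\<lambda>p. F (fst (fst p)) (snd p))"
    by (rule continuous_on_compose2[OF cont, of _ "\<lambda>p. (fst (fst p), snd p)", unfolded split_beta fst_conv snd_conv])
      (auto intro!: continuous_intros)
  then have "continuous_on ((S \<times> ball c r) \<times> sphere c r) (\<lambda>(p, u). F (fst p) u / (u - snd p)\<^sup>2)"
    unfolding split_beta by (intro continuous_intros) auto
  from continuous_on_contour_integral_param[OF _ this] True
  have "continuous_on (S \<times> ball c r) (\<lambda>p. 1 / (2 * of_real pi * \<i>) * contour_integral (circlepath c r) (\<lambda>u. F (fst p) u / (u - snd p)\<^sup>2))"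
    by (intro continuous_intros) auto
  then show ?thesis
    by (rule continuous_on_eq) (auto simp: eq)
qed (simp add: ball_empty)

text \<open>Differentiation under the integral sign wants the derivative of the kernel to be jointly
  continuous in \<open>w\<close> and the point of the circle.
  \<open>continuous_on_deriv_param\<close>, with the circle as parameter space, supplies this from
  joint continuity of \<open>K\<close> and holomorphy in \<open>w\<close>.\<close>

lemma holomorphic_on_contour_integral_param:
  fixes K :: "complex \<Rightarrow> complex \<Rightarrow> complex"
  assumes r: "0 \<le> r" and V: "open V"
    and cont: "continuous_on (V \<times> sphere c r) (\<lambda>(w, u). K w u)"
    and holo: "\<And>u. u \<in> sphere c r \<Longrightarrow> (\<lambda>w. K w u) holomorphic_on V"
  shows "(\<lambda>w. contour_integral (circlepath c r) (K w)) holomorphic_on V"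
proof -
  have "(\<lambda>w. contour_integral (circlepath c r) (K w)) field_differentiable (at w0)" if w0: "w0 \<in> V" for w0
  proof -
    obtain e where e: "e > 0" "cball w0 e \<subseteq> V"
      using V w0 open_contains_cball by blast
    have circ: "circlepath c r t \<in> sphere c r" if "t \<in> cbox 0 1" for t
      using that r path_image_circlepath_nonneg[OF r, of c] by (auto simp: path_image_def)
    have c1: "continuous_on (sphere c r \<times> cball w0 e) (\<lambda>(u, w). K w u)"
      unfolding split_beta
      by (rule continuous_on_compose2[OF cont, of _ "\<lambda>p. (snd p, fst p)", unfolded split_beta fst_conv snd_conv])
        (use e in \<open>auto intro!: continuous_intros\<close>)
    have "continuous_on (sphere c r \<times> ball w0 e) (\<lambda>(u, w). deriv (\<lambda>w. K w u) w)"
    proof (rule continuous_on_deriv_param[OF c1])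
      fix u assume "u \<in> sphere c r"
      from holo[OF this] show "(\<lambda>w. K w u) holomorphic_on ball w0 e"
        by (rule holomorphic_on_subset) (use e in auto)
    qed
    then have d: "continuous_on (ball w0 e \<times> cbox 0 1) (\<lambda>p. deriv (\<lambda>w. K w (circlepath c r (snd p))) (fst p))"
      using continuous_on_compose2[of "sphere c r \<times> ball w0 e" "\<lambda>(u, w). deriv (\<lambda>w. K w u) w" "ball w0 e \<times> cbox 0 1"
        "\<lambda>p. (circlepath c r (snd p), fst p)"] circ
      by (force simp: split_beta circlepath intro!: continuous_intros)
    have k: "continuous_on (cbox 0 1) (\<lambda>t. K w (circlepath c r t))" if "w \<in> V" for w
      by (rule continuous_on_compose2[OF cont, of _ "\<lambda>t. (w, circlepath c r t)", unfolded split_beta fst_conv snd_conv])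
        (use that circ in \<open>auto simp: circlepath intro!: continuous_intros\<close>)
    let ?f = "\<lambda>w t. K w (circlepath c r t) * vector_derivative (circlepath c r) (at t)"
    let ?f' = "\<lambda>w t. deriv (\<lambda>w. K w (circlepath c r t)) w * vector_derivative (circlepath c r) (at t)"
    have "((\<lambda>w. integral (cbox 0 1) (?f w)) has_field_derivative integral (cbox 0 1) (?f' w0)) (at w0 within ball w0 e)"
    proof (rule leibniz_rule_field_derivative)
      fix w t assume w: "w \<in> ball w0 e" and t: "t \<in> cbox (0::real) 1"
      have "(\<lambda>w. K w (circlepath c r t)) field_differentiable (at w)"
        using holo[OF circ[OF t]] e w V
        by (metis ball_subset_cball holomorphic_on_imp_differentiable_at subset_iff)
      then have "((\<lambda>w. K w (circlepath c r t)) has_field_derivative deriv (\<lambda>w. K w (circlepath c r t)) w) (at w within ball w0 e)"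
        by (meson DERIV_deriv_iff_field_differentiable has_field_derivative_at_within)
      then show "((\<lambda>w. ?f w t) has_field_derivative ?f' w t) (at w within ball w0 e)"
        by (intro DERIV_cmult_right)
    next
      fix w assume "w \<in> ball w0 e"
      then have "w \<in> V" using e by auto
      then show "?f w integrable_on cbox 0 1"
        unfolding vector_derivative_circlepath
        by (intro integrable_continuous continuous_intros k)
    next
      show "continuous_on (ball w0 e \<times> cbox 0 1) (\<lambda>(w, t). ?f' w t)"
        unfolding split_beta vector_derivative_circlepath by (intro continuous_intros d)
    qed (use e in auto)
    then have "((\<lambda>w. contour_integral (circlepath c r) (K w)) has_field_derivative integral (cbox 0 1) (?f' w0)) (at w0 within ball w0 e)"
      by (simp add: contour_integral_integral)
    then show ?thesis
      using e at_within_open[of w0 "ball w0 e"] by (auto simp: field_differentiable_def)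
  qed
  then show ?thesis
    by (simp add: holomorphic_on_def field_differentiable_at_within)
qed

section \<open>Polydiscs as a neighbourhood base of the origin\<close>

definition polydisc :: "nat \<Rightarrow> real \<Rightarrow> (nat \<Rightarrow> complex) set" where
  "polydisc n r = {z \<in> cspace n. \<forall>i<n. norm (z i) < r}"

lemma polydisc_mono: "r \<le> r' \<Longrightarrow> polydisc n r \<subseteq> polydisc n r'"
  by (force simp: polydisc_def)

lemma origin_in_polydisc [simp]: "origin \<in> polydisc n r \<longleftrightarrow> n = 0 \<or> r > 0"
  by (auto simp: polydisc_def origin_def cspace_def)

lemma polydisc_upd: "z \<in> polydisc n r \<Longrightarrow> i < n \<Longrightarrow> norm w < r \<Longrightarrow> z(i := w) \<in> polydisc n r"
  by (auto simp: polydisc_def cspace_def)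

lemma origin_apply [simp]: "origin i = 0"
  by (simp add: origin_def)

lemma continuous_on_coord: "continuous_on S (\<lambda>z::nat \<Rightarrow> complex. z i)"
  by (rule continuous_on_product_then_coordinatewise) (rule continuous_on_id)

lemma continuous_on_fun_upd:
  fixes f :: "'a::topological_space \<Rightarrow> nat \<Rightarrow> complex"
  assumes "continuous_on S f" "continuous_on S g"
  shows "continuous_on S (\<lambda>x. (f x)(i := g x))"
proof (rule continuous_on_coordinatewise_then_product)
  fix j show "continuous_on S (\<lambda>x. ((f x)(i := g x)) j)"
    using assms continuous_on_product_then_coordinatewise[OF assms(1), of j] by (cases "j = i") auto
qed

lemma openin_polydisc: "open_in_cspace n (polydisc n r)"
proof -
  have "open (\<Inter>i\<in>{..<n}. {z::nat \<Rightarrow> complex. norm (z i) < r})"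
    by (intro open_INT ballI open_Collect_less continuous_intros continuous_on_coord) auto
  moreover have "polydisc n r = cspace n \<inter> (\<Inter>i\<in>{..<n}. {z. norm (z i) < r})"
    by (auto simp: polydisc_def)
  ultimately show ?thesis
    by (simp add: open_in_cspace_def openin_open_Int)
qed

lemma polydisc_subset_open:
  assumes "open T" "origin \<in> T"
  obtains r where "r > 0" "polydisc n r \<subseteq> T"
proof -
  obtain X where X: "origin \<in> (\<Pi>\<^sub>E i\<in>UNIV. X i)" "\<And>i. open (X i)" "(\<Pi>\<^sub>E i\<in>UNIV. X i) \<subseteq> T"
    using product_topology_open_contains_basis[of "\<lambda>_. euclidean" UNIV T origin] assms
    by (auto simp: open_fun_def)
  have "\<forall>i. \<exists>e>0. ball 0 e \<subseteq> X i"
    using X(1,2) by (metis PiE_mem UNIV_I open_contains_ball origin_apply)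
  then obtain e where e: "\<And>i. e i > 0" "\<And>i. ball 0 (e i) \<subseteq> X i" by metis
  \<comment> \<open>Only the first \<open>n\<close> coordinates constrain the radius, since the
    others vanish on the polydisc; the extra 1 keeps the minimum meaningful for
    \<open>n = 0\<close>.\<close>
  let ?r = "Min (insert 1 (e ` {..<n}))"
  have "polydisc n ?r \<subseteq> T"
  proof
    fix z assume z: "z \<in> polydisc n ?r"
    have "z i \<in> X i" for i
    proof (cases "i < n")
      case True
      then have "norm (z i) < e i" using z by (auto simp: polydisc_def)
      then show ?thesis using e(2)[of i] by auto
    next
      case False
      then have "z i = 0" using z by (auto simp: polydisc_def cspace_def)
      then show ?thesis using e[of i] by auto
    qed
    then show "z \<in> T" using X(3) by (auto simp: PiE_def)
  qed
  moreover have "?r > 0" using e by auto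
  ultimately show ?thesis using that by blast
qed

lemma polydisc_subset_openin:
  assumes "open_in_cspace n U" "origin \<in> U"
  obtains r where "r > 0" "polydisc n r \<subseteq> U"
proof -
  obtain T where T: "open T" "U = cspace n \<inter> T"
    using assms by (auto simp: open_in_cspace_def openin_open)
  obtain r where r: "r > 0" "polydisc n r \<subseteq> T"
    using polydisc_subset_open[of T n] T assms(2) by auto
  then show ?thesis using that[of r] T by (auto simp: polydisc_def)
qed

text \<open>Reduces every statement near the origin to a radius. Polydiscs are stable under
  replacing one coordinate by any number below the radius, so slices in single variables stay
  inside.\<close>

lemma eventually_near_origin:
  "eventually P (near_origin n) \<longleftrightarrow> (\<exists>r>0. \<forall>z\<in>polydisc n r. P z)"
proof
  assume "eventually P (near_origin n)"
  then obtain T where T: "open T" "origin \<in> T" "\<And>z. z \<in> T \<Longrightarrow> z \<in> cspace n \<Longrightarrow> P z"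
    by (auto simp: near_origin_def eventually_inf_principal eventually_nhds)
  obtain r where "r > 0" "polydisc n r \<subseteq> T"
    using polydisc_subset_open[OF T(1,2)] .
  then show "\<exists>r>0. \<forall>z\<in>polydisc n r. P z"
    using T(3) by (intro exI[of _ r]) (auto simp: polydisc_def)
next
  assume "\<exists>r>0. \<forall>z\<in>polydisc n r. P z"
  then obtain r where r: "r > 0" "\<And>z. z \<in> polydisc n r \<Longrightarrow> P z" by auto
  obtain T where T: "open T" "polydisc n r = cspace n \<inter> T"
    using openin_polydisc[of n r] by (auto simp: open_in_cspace_def openin_open)
  have "origin \<in> T" using T(2) r(1) origin_in_polydisc[of n r] by blast
  then show "eventually P (near_origin n)"
    unfolding near_origin_def eventually_inf_principal eventually_nhds
    using T r by (intro exI[of _ T]) auto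
qed

lemma eventually_near_originD: "eventually P (near_origin n) \<Longrightarrow> P origin"
  by (auto simp: eventually_near_origin)

lemma holo_on_subset: "holo_on n f U \<Longrightarrow> V \<subseteq> U \<Longrightarrow> holo_on n f V"
  by (auto simp: holo_on_def intro: continuous_on_subset)

lemma holo_germ_polydisc: "holo_germ n f \<longleftrightarrow> (\<exists>r>0. holo_on n f (polydisc n r))"
proof
  assume "holo_germ n f"
  then obtain U where U: "open_in_cspace n U" "origin \<in> U" "holo_on n f U"
    by (auto simp: holo_germ_def)
  then show "\<exists>r>0. holo_on n f (polydisc n r)"
    using polydisc_subset_openin holo_on_subset by metis
next
  assume "\<exists>r>0. holo_on n f (polydisc n r)"
  then show "holo_germ n f"
    unfolding holo_germ_def using openin_polydisc origin_in_polydisc by blast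
qed

lemma holo_on_const [simp]: "holo_on n (\<lambda>_. c) U"
  by (auto simp: holo_on_def)

lemma holo_on_coord [simp]: "holo_on n (\<lambda>z. z i) U"
proof -
  have "(\<lambda>w. (z(j := w)) i) field_differentiable (at (z j))" for z :: "nat \<Rightarrow> complex" and j
    by (cases "i = j") auto
  then show ?thesis by (simp add: holo_on_def continuous_on_coord)
qed

lemma holo_on_add: "holo_on n f U \<Longrightarrow> holo_on n g U \<Longrightarrow> holo_on n (\<lambda>z. f z + g z) U"
  by (auto simp: holo_on_def intro!: continuous_intros field_differentiable_add)

lemma holo_on_diff: "holo_on n f U \<Longrightarrow> holo_on n g U \<Longrightarrow> holo_on n (\<lambda>z. f z - g z) U"
  by (auto simp: holo_on_def intro!: continuous_intros field_differentiable_diff)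

lemma holo_on_mult: "holo_on n f U \<Longrightarrow> holo_on n g U \<Longrightarrow> holo_on n (\<lambda>z. f z * g z) U"
  by (auto simp: holo_on_def intro!: continuous_intros field_differentiable_mult)

lemma holo_on_divide:
  "holo_on n f U \<Longrightarrow> holo_on n g U \<Longrightarrow> (\<And>z. z \<in> U \<Longrightarrow> g z \<noteq> 0) \<Longrightarrow> holo_on n (\<lambda>z. f z / g z) U"
  by (auto simp: holo_on_def intro!: continuous_intros field_differentiable_divide)

lemma holo_on_slice:
  assumes "holo_on n f (polydisc n r)" "z \<in> polydisc n r" "i < n"
  shows "(\<lambda>w. f (z(i := w))) holomorphic_on ball 0 r"
proof -
  have "(\<lambda>w. f (z(i := w))) field_differentiable (at w)" if "w \<in> ball 0 r" for w
  proof -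
    have "z(i := w) \<in> polydisc n r" using that assms polydisc_upd by auto
    with assms have "(\<lambda>v. f (z(i := w, i := v))) field_differentiable (at ((z(i := w)) i))"
      unfolding holo_on_def by blast
    then show ?thesis by (simp only: fun_upd_upd fun_upd_same)
  qed
  then show ?thesis by (simp add: holomorphic_on_def field_differentiable_at_within)
qed

lemma holo_onI_slice:
  assumes "continuous_on (polydisc n r) f"
    and "\<And>z i. z \<in> polydisc n r \<Longrightarrow> i < n \<Longrightarrow> (\<lambda>w. f (z(i := w))) holomorphic_on ball 0 r"
  shows "holo_on n f (polydisc n r)"
  unfolding holo_on_def
proof (intro conjI ballI allI impI)
  fix z i assume z: "z \<in> polydisc n r" "i < n"
  then have "z i \<in> ball 0 r" by (auto simp: polydisc_def)
  with assms(2)[OF z] show "(\<lambda>w. f (z(i := w))) field_differentiable (at (z i))"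
    using holomorphic_on_imp_differentiable_at by blast
qed (use assms in auto)

lemma continuous_on_slice_pair:
  assumes "holo_on n f (polydisc n r)" "i < n" "continuous_on S g" "continuous_on S h"
    "g ` S \<subseteq> polydisc n r" "h ` S \<subseteq> ball 0 r"
  shows "continuous_on S (\<lambda>x. f ((g x)(i := h x)))"
proof (rule continuous_on_compose2[of "polydisc n r" f])
  show "continuous_on (polydisc n r) f" using assms by (auto simp: holo_on_def)
  show "continuous_on S (\<lambda>x. (g x)(i := h x))" by (intro continuous_on_fun_upd assms)
  show "(\<lambda>x. (g x)(i := h x)) ` S \<subseteq> polydisc n r"
    using assms polydisc_upd by (force simp: image_subset_iff)
qed

lemma holo_on_contour_integral:
  assumes \<rho>: "0 \<le> \<rho>" 
    and cont: "continuous_on (polydisc n r \<times> sphere c \<rho>) (\<lambda>(z, u). K z u)"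
    and holo: "\<And>u. u \<in> sphere c \<rho> \<Longrightarrow> holo_on n (\<lambda>z. K z u) (polydisc n r)"
  shows "holo_on n (\<lambda>z. contour_integral (circlepath c \<rho>) (K z)) (polydisc n r)"
proof (rule holo_onI_slice)
  show "continuous_on (polydisc n r) (\<lambda>z. contour_integral (circlepath c \<rho>) (K z))"
    by (rule continuous_on_contour_integral_param[OF \<rho> cont])
next
  fix z i assume z: "z \<in> polydisc n r" and i: "i < n"
  show "(\<lambda>w. contour_integral (circlepath c \<rho>) (K (z(i := w)))) holomorphic_on ball 0 r"
  proof (rule holomorphic_on_contour_integral_param[OF \<rho>])
    show "continuous_on (ball 0 r \<times> sphere c \<rho>) (\<lambda>(w, u). K (z(i := w)) u)"
      unfolding split_beta
      by (rule continuous_on_compose2[OF cont, of _ "\<lambda>p. (z(i := fst p), snd p)", unfolded split_beta fst_conv snd_conv])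
        (use z i polydisc_upd in \<open>auto intro!: continuous_on_Pair continuous_on_fun_upd continuous_on_const
          continuous_on_fst continuous_on_snd continuous_on_id simp del: fun_upd_apply\<close>)
  next
    fix u assume "u \<in> sphere c \<rho>"
    from holo_on_slice[OF holo[OF this] z i]
    show "(\<lambda>w. K (z(i := w)) u) holomorphic_on ball 0 r" .
  qed auto
qed

text \<open>As a contour integral, the divided difference in the \<open>i\<close>-th variable between \<open>a\<close> and \<open>b\<close>
  is visibly holomorphic in everything, including across \<open>a = b\<close>.\<close>

definition divdiff :: "real \<Rightarrow> nat \<Rightarrow> ((nat \<Rightarrow> complex) \<Rightarrow> complex) \<Rightarrow> (nat \<Rightarrow> complex) \<Rightarrow> complex \<Rightarrow> complex \<Rightarrow> complex" where
  "divdiff \<rho> i f z a b =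
     1 / (2 * of_real pi * \<i>) * contour_integral (circlepath 0 \<rho>) (\<lambda>u. f (z(i := u)) / ((u - a) * (u - b)))"

context
  fixes n :: nat and r \<rho> :: real and f :: "(nat \<Rightarrow> complex) \<Rightarrow> complex" and i :: nat
  assumes f: "holo_on n f (polydisc n r)" and \<rho>: "0 < \<rho>" "\<rho> < r" and i: "i < n"
begin

lemma slice_cball:
  assumes "z \<in> polydisc n r"
  shows "continuous_on (cball 0 \<rho>) (\<lambda>w. f (z(i := w)))" "(\<lambda>w. f (z(i := w))) holomorphic_on ball 0 \<rho>"
proof -
  have "(\<lambda>w. f (z(i := w))) holomorphic_on cball 0 \<rho>"
    by (rule holomorphic_on_subset[OF holo_on_slice[OF f assms i]]) (use \<rho> in auto)
  then show "continuous_on (cball 0 \<rho>) (\<lambda>w. f (z(i := w)))" "(\<lambda>w. f (z(i := w))) holomorphic_on ball 0 \<rho>"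
    by (auto intro: holomorphic_on_imp_continuous_on holomorphic_on_subset)
qed

text \<open>On the diagonal the kernel is that of Cauchy's formula for the first derivative.\<close>

lemma divdiff_same:
  assumes z: "z \<in> polydisc n r" and a: "norm a < \<rho>"
  shows "divdiff \<rho> i f z a a = partial_deriv i f (z(i := a))"
  unfolding divdiff_def partial_deriv_def
  using DERIV_imp_deriv[OF Cauchy_derivative_integral_circlepath(2)[OF slice_cball[OF z], of a]] a
  by (simp add: power2_eq_square)

text \<open>Partial fractions: 1/((u - a)(u - b)) = (1/(u - a) - 1/(u - b)) / (a - b), so Cauchy's
  formula at \<open>a\<close> and at \<open>b\<close> gives the claim.\<close>

lemma divdiff_mult:
  assumes z: "z \<in> polydisc n r" and ab: "norm a < \<rho>" "norm b < \<rho>"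
  shows "f (z(i := a)) - f (z(i := b)) = (a - b) * divdiff \<rho> i f z a b"
proof (cases "a = b")
  case False
  let ?f = "\<lambda>w. f (z(i := w))"
  have I: "((\<lambda>u. ?f u / (u - w)) has_contour_integral (2 * of_real pi * \<i> * ?f w)) (circlepath 0 \<rho>)"
    if "norm w < \<rho>" for w
    using Cauchy_integral_circlepath[OF slice_cball[OF z]] that by simp
  have "((\<lambda>u. (?f u / (u - a) - ?f u / (u - b)) / (a - b)) has_contour_integral
      (2 * of_real pi * \<i> * ?f a - 2 * of_real pi * \<i> * ?f b) / (a - b)) (circlepath 0 \<rho>)"
    by (intro has_contour_integral_div has_contour_integral_diff I ab)
  then have "((\<lambda>u. ?f u / ((u - a) * (u - b))) has_contour_integral
      (2 * of_real pi * \<i> * ?f a - 2 * of_real pi * \<i> * ?f b) / (a - b)) (circlepath 0 \<rho>)"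
  proof (rule has_contour_integral_eq)
    fix u assume "u \<in> path_image (circlepath 0 \<rho>)"
    then have "norm u = \<rho>" using \<rho> by simp
    then have "u \<noteq> a" "u \<noteq> b" using ab by auto
    then show "(?f u / (u - a) - ?f u / (u - b)) / (a - b) = ?f u / ((u - a) * (u - b))"
      using False by (simp add: divide_simps) (simp add: algebra_simps)
  qed
  from contour_integral_unique[OF this] show ?thesis
    using False by (simp add: divdiff_def divide_simps) (simp add: algebra_simps)
qed auto

text \<open>The parameter ranges over an arbitrary topological space: it will be a triple of a point
  and both endpoints, a pair, or a number in a disc.\<close>

lemma continuous_on_divdiff:
  assumes "continuous_on S g" "continuous_on S \<alpha>" "continuous_on S \<beta>"
    "g ` S \<subseteq> polydisc n r" "\<alpha> ` S \<subseteq> ball 0 \<rho>" "\<beta> ` S \<subseteq> ball 0 \<rho>"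
  shows "continuous_on S (\<lambda>x. divdiff \<rho> i f (g x) (\<alpha> x) (\<beta> x))"
proof -
  have c: "continuous_on (S \<times> sphere 0 \<rho>) (\<lambda>p. h (fst p))" if "continuous_on S h" for h :: "_ \<Rightarrow> 'b::topological_space"
    by (rule continuous_on_compose2[OF that]) (auto intro: continuous_intros)
  have "continuous_on (S \<times> sphere 0 \<rho>) (\<lambda>(x, u). f ((g x)(i := u)) / ((u - \<alpha> x) * (u - \<beta> x)))"
    unfolding split_beta
  proof (intro continuous_intros continuous_on_slice_pair[OF f i] c assms)
    show "\<forall>x\<in>S \<times> sphere 0 \<rho>. (snd x - \<alpha> (fst x)) * (snd x - \<beta> (fst x)) \<noteq> 0"
      using assms(5,6) by force
  qed (use assms continuous_on_product_then_coordinatewise[OF assms(1)] \<rho> in auto)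
  from continuous_on_contour_integral_param[OF _ this] \<rho> show ?thesis
    unfolding divdiff_def by (intro continuous_intros) auto
qed

text \<open>The radius \<open>r'\<close> may be smaller than \<open>r\<close> because the endpoint
  functions stay inside the circle of radius \<open>\<rho>\<close> only near the origin.\<close>

lemma holo_on_divdiff:
  assumes \<alpha>: "holo_on n \<alpha> (polydisc n r')" and \<beta>: "holo_on n \<beta> (polydisc n r')" and r': "r' \<le> r"
    and "\<alpha> ` polydisc n r' \<subseteq> ball 0 \<rho>" "\<beta> ` polydisc n r' \<subseteq> ball 0 \<rho>"
  shows "holo_on n (\<lambda>z. divdiff \<rho> i f z (\<alpha> z) (\<beta> z)) (polydisc n r')"
  unfolding divdiff_def
proof (intro holo_on_mult holo_on_const holo_on_contour_integral)
  let ?S = "polydisc n r' \<times> sphere (0::complex) \<rho>"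
  have P: "polydisc n r' \<subseteq> polydisc n r" using r' by (rule polydisc_mono)
  have c: "continuous_on ?S (\<lambda>p. h (fst p))" if "continuous_on (polydisc n r') h" for h :: "_ \<Rightarrow> 'b::topological_space"
    by (rule continuous_on_compose2[OF that]) (auto intro: continuous_intros)
  show "continuous_on ?S (\<lambda>(z, u). f (z(i := u)) / ((u - \<alpha> z) * (u - \<beta> z)))"
    unfolding split_beta
  proof (intro continuous_intros continuous_on_slice_pair[OF f i] c)
    show "\<forall>x\<in>?S. (snd x - \<alpha> (fst x)) * (snd x - \<beta> (fst x)) \<noteq> 0"
      using assms(4,5) by force
  qed (use \<alpha> \<beta> \<rho> P in \<open>auto simp: holo_on_def\<close>)
next
  fix u :: complex assume u: "u \<in> sphere 0 \<rho>"
  show "holo_on n (\<lambda>z. f (z(i := u)) / ((u - \<alpha> z) * (u - \<beta> z))) (polydisc n r')"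
  proof (intro holo_on_divide holo_on_mult holo_on_diff holo_on_const \<alpha> \<beta>)
    show "holo_on n (\<lambda>z. f (z(i := u))) (polydisc n r')"
      unfolding holo_on_def
    proof (intro conjI ballI allI impI)
      show "continuous_on (polydisc n r') (\<lambda>z. f (z(i := u)))"
        by (rule continuous_on_slice_pair[OF f i]) (use u \<rho> polydisc_mono[OF r'] in \<open>auto intro: continuous_intros\<close>)
    next
      fix z j assume z: "z \<in> polydisc n r'" and j: "j < n"
      show "(\<lambda>w. f (z(j := w, i := u))) field_differentiable (at (z j))"
      \<comment> \<open>For \<open>i = j\<close> the value \<open>u\<close> overwrites
        \<open>w\<close>, and the slice is constant.\<close>
      proof (cases "i = j")
        case False
        have "z(i := u) \<in> polydisc n r"
          using polydisc_upd[OF _ i, of z r u] z u \<rho> polydisc_mono[OF r', of n] by auto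
        then have "(\<lambda>w. f (z(i := u, j := w))) field_differentiable (at ((z(i := u)) j))"
          using f j unfolding holo_on_def by blast
        then show ?thesis using False by (simp add: fun_upd_twist[OF False])
      qed auto
    qed
  next
    fix z assume "z \<in> polydisc n r'"
    then have "norm (\<alpha> z) < \<rho>" "norm (\<beta> z) < \<rho>" using assms(4,5) by auto
    then show "(u - \<alpha> z) * (u - \<beta> z) \<noteq> 0" using u by auto
  qed
qed (use \<rho> in auto)

end

section \<open>Germs, composition and the chain rule\<close>


lemma holo_germ_const [simp]: "holo_germ n (\<lambda>_. c)"
  by (auto simp: holo_germ_polydisc intro: exI[of _ 1])

lemma holo_germ_coord [simp]: "holo_germ n (\<lambda>z. z i)"
  by (auto simp: holo_germ_polydisc intro: exI[of _ 1])

lemma polydisc_min: "polydisc n (min r r') \<subseteq> polydisc n r" "polydisc n (min r r') \<subseteq> polydisc n r'"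
  by (auto intro: polydisc_mono[THEN subsetD, rotated])

lemma holo_germ2E:
  assumes "holo_germ n f" "holo_germ n g"
  obtains r where "r > 0" "holo_on n f (polydisc n r)" "holo_on n g (polydisc n r)"
proof -
  obtain r1 r2 where r: "r1 > 0" "holo_on n f (polydisc n r1)" "r2 > 0" "holo_on n g (polydisc n r2)"
    using assms by (auto simp: holo_germ_polydisc)
  show ?thesis
    by (rule that[of "min r1 r2"])
      (use r polydisc_min holo_on_subset in \<open>auto\<close>)
qed

lemma holo_germ_add: "holo_germ n f \<Longrightarrow> holo_germ n g \<Longrightarrow> holo_germ n (\<lambda>z. f z + g z)"
  by (erule (1) holo_germ2E) (auto simp: holo_germ_polydisc intro: holo_on_add)

lemma holo_germ_diff: "holo_germ n f \<Longrightarrow> holo_germ n g \<Longrightarrow> holo_germ n (\<lambda>z. f z - g z)"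
  by (erule (1) holo_germ2E) (auto simp: holo_germ_polydisc intro: holo_on_diff)

lemma holo_germ_mult: "holo_germ n f \<Longrightarrow> holo_germ n g \<Longrightarrow> holo_germ n (\<lambda>z. f z * g z)"
  by (erule (1) holo_germ2E) (auto simp: holo_germ_polydisc intro: holo_on_mult)

lemma holo_germ_uminus: "holo_germ n f \<Longrightarrow> holo_germ n (\<lambda>z. - f z)"
  using holo_germ_mult[OF holo_germ_const[of n "-1"]] by simp

lemma holo_germ_power: "holo_germ n f \<Longrightarrow> holo_germ n (\<lambda>z. f z ^ k)"
  by (induction k) (auto intro: holo_germ_mult)

lemma holo_germ_sum: "(\<And>i. i \<in> I \<Longrightarrow> holo_germ n (f i)) \<Longrightarrow> holo_germ n (\<lambda>z. \<Sum>i\<in>I. f i z)"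
  by (induction I rule: infinite_finite_induct) (auto intro: holo_germ_add)

lemma holo_germ_tendsto:
  assumes "holo_germ n f"
  shows "(f \<longlongrightarrow> f origin) (near_origin n)"
proof -
  obtain U where U: "open_in_cspace n U" "origin \<in> U" "continuous_on U f"
    using assms by (auto simp: holo_germ_def holo_on_def)
  obtain T where T: "open T" "U = cspace n \<inter> T"
    using U by (auto simp: open_in_cspace_def openin_open)
  show ?thesis
  proof (rule topological_tendstoI)
    fix S assume S: "open S" "f origin \<in> S"
    obtain A where A: "open A" "A \<inter> U = f -` S \<inter> U"
      using U(3) S(1) unfolding continuous_on_open_invariant by blast
    have "origin \<in> A" using A S U by auto
    moreover have "f z \<in> S" if "z \<in> A \<inter> T" "z \<in> cspace n" for z
      using that A T by auto
    ultimately show "eventually (\<lambda>z. f z \<in> S) (near_origin n)"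
      unfolding near_origin_def eventually_inf_principal eventually_nhds
      using A T U by (intro exI[of _ "A \<inter> T"]) auto
  qed
qed

lemma holo_germ_eventually_norm_less:
  assumes "holo_germ n f" "norm (f origin) < e"
  shows "\<forall>\<^sub>F z in near_origin n. norm (f z) < e"
  using holo_germ_tendsto[OF assms(1)] assms(2) by (metis order_tendstoD(2) tendsto_norm)

lemma holo_germ_eventually_nonzero:
  assumes "holo_germ n f" "f origin \<noteq> 0"
  shows "\<forall>\<^sub>F z in near_origin n. f z \<noteq> 0"
  using holo_germ_tendsto[OF assms(1)] assms(2) by (rule tendsto_imp_eventually_ne)

lemma polydisc_eventually: "r > 0 \<Longrightarrow> \<forall>\<^sub>F z in near_origin n. z \<in> polydisc n r"
  by (auto simp: eventually_near_origin)

lemma holo_germ_divide: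
  assumes "holo_germ n f" "holo_germ n g" "g origin \<noteq> 0"
  shows "holo_germ n (\<lambda>z. f z / g z)"
proof -
  obtain r where r: "r > 0" "holo_on n f (polydisc n r)" "holo_on n g (polydisc n r)"
    using holo_germ2E[OF assms(1,2)] .
  obtain r' where r': "r' > 0" "\<forall>z\<in>polydisc n r'. g z \<noteq> 0"
    using holo_germ_eventually_nonzero[OF assms(2,3)] by (auto simp: eventually_near_origin)
  have s: "polydisc n (min r r') \<subseteq> polydisc n r" "polydisc n (min r r') \<subseteq> polydisc n r'"
    by (rule polydisc_min)+
  show ?thesis unfolding holo_germ_polydisc
    by (intro exI[of _ "min r r'"] conjI holo_on_divide)
      (use r r' s in \<open>auto intro: holo_on_subset\<close>)
qed

lemma holo_germ_cong:
  assumes f: "holo_germ n f" and eq: "\<forall>\<^sub>F z in near_origin n. f z = g z"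
  shows "holo_germ n g"
proof -
  obtain r where r: "r > 0" "holo_on n f (polydisc n r)"
    using f by (auto simp: holo_germ_polydisc)
  obtain r' where r': "r' > 0" "\<forall>z\<in>polydisc n r'. f z = g z"
    using eq by (auto simp: eventually_near_origin)
  let ?r = "min r r'"
  have s: "polydisc n ?r \<subseteq> polydisc n r" "polydisc n ?r \<subseteq> polydisc n r'"
    by (rule polydisc_min)+
  have h: "holo_on n f (polydisc n ?r)" using r s holo_on_subset by blast
  have "holo_on n g (polydisc n ?r)"
  proof (rule holo_onI_slice)
    show "continuous_on (polydisc n ?r) g"
      by (rule continuous_on_eq[of _ f]) (use h r' s in \<open>auto simp: holo_on_def\<close>)
  next
    fix z i assume z: "z \<in> polydisc n ?r" "i < n"
    show "(\<lambda>w. g (z(i := w))) holomorphic_on ball 0 ?r"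
      by (rule holomorphic_transform[OF holo_on_slice[OF h z]])
        (use r' s polydisc_upd[OF z] in auto)
  qed
  then show ?thesis using r r' by (auto simp: holo_germ_polydisc intro: exI[of _ ?r])
qed

lemma partial_deriv_has_field_derivative:
  assumes "holo_on n f (polydisc n r)" "z \<in> polydisc n r" "i < n"
  shows "((\<lambda>w. f (z(i := w))) has_field_derivative partial_deriv i f z) (at (z i))"
  using assms unfolding partial_deriv_def holo_on_def
  by (auto simp: DERIV_deriv_iff_field_differentiable)

text \<open>The partial derivative is the divided difference on the diagonal, hence a Cauchy
  integral. Halving the radius keeps the diagonal points inside the circle of integration.\<close>

lemma holo_germ_partial_deriv:
  assumes f: "holo_germ n f" and i: "i < n"
  shows "holo_germ n (partial_deriv i f)"
proof -
  obtain r where r: "r > 0" "holo_on n f (polydisc n r)"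
    using f by (auto simp: holo_germ_polydisc)
  have "holo_on n (\<lambda>z. divdiff (r/2) i f z (z i) (z i)) (polydisc n (r/2))"
    by (rule holo_on_divdiff[OF r(2)]) (use r i in \<open>auto simp: polydisc_def\<close>)
  then have "holo_germ n (\<lambda>z. divdiff (r/2) i f z (z i) (z i))"
    using r by (auto simp: holo_germ_polydisc intro: exI[of _ "r/2"])
  moreover have "\<forall>\<^sub>F z in near_origin n. divdiff (r/2) i f z (z i) (z i) = partial_deriv i f z"
    unfolding eventually_near_origin
    using r i polydisc_mono[of "r/2" r n]
    by (intro exI[of _ "r/2"] conjI ballI, simp)
      (subst divdiff_same[OF r(2) _ _ i], auto simp: polydisc_def)
  ultimately show ?thesis by (rule holo_germ_cong)
qed

lemma partial_deriv_cong_ev: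
  assumes eq: "\<forall>\<^sub>F z in near_origin n. f z = g z" and i: "i < n"
  shows "\<forall>\<^sub>F z in near_origin n. partial_deriv i f z = partial_deriv i g z"
proof -
  obtain r where r: "r > 0" "\<forall>z\<in>polydisc n r. f z = g z"
    using eq by (auto simp: eventually_near_origin)
  have "partial_deriv i f z = partial_deriv i g z" if z: "z \<in> polydisc n r" for z
    unfolding partial_deriv_def
  proof (rule deriv_cong_ev)
    have "z i \<in> ball 0 r" using z i by (auto simp: polydisc_def)
    then have "\<forall>\<^sub>F w in nhds (z i). w \<in> ball 0 r"
      by (intro eventually_nhds_in_open) auto
    then show "\<forall>\<^sub>F w in nhds (z i). f (z(i := w)) = g (z(i := w))"
      by eventually_elim (use r polydisc_upd[OF z i] in auto)
  qed auto
  then show ?thesis using r by (auto simp: eventually_near_origin)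
qed

lemma tendsto_coordinatewise:
  fixes g :: "'a \<Rightarrow> 'i \<Rightarrow> 'b::topological_space"
  assumes "\<And>j. ((\<lambda>w. g w j) \<longlongrightarrow> l j) F"
  shows "(g \<longlongrightarrow> l) F"
  using assms limitin_componentwise[of "\<lambda>_. euclidean" UNIV g l F]
  by (auto simp: euclidean_product_topology extensional_def)

text \<open>A curve is moved one coordinate at a time; joint regularity of \<open>f\<close> enters only through the
  continuity of the divided differences.\<close>

lemma has_field_derivative_comp_curve:
  assumes f: "holo_on m f (polydisc m r)"
    and \<gamma>: "\<And>j. j < m \<Longrightarrow> ((\<lambda>w. \<gamma> w j) has_field_derivative \<gamma>' j) (at w0)"
    and in_cspace: "\<And>w. \<gamma> w \<in> cspace m" and w0: "\<gamma> w0 \<in> polydisc m r"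
  shows "((\<lambda>w. f (\<gamma> w)) has_field_derivative (\<Sum>j<m. partial_deriv j f (\<gamma> w0) * \<gamma>' j)) (at w0)"
proof -
  define \<eta> where "\<eta> k w = (\<lambda>j. if j < k then \<gamma> w j else \<gamma> w0 j)" for k w
  have \<eta>_w0: "\<eta> k w0 = \<gamma> w0" for k by (auto simp: \<eta>_def)
  have cs: "\<eta> k w \<in> cspace m" for k w
    using in_cspace[of w] in_cspace[of w0] by (auto simp: \<eta>_def cspace_def)
  \<comment> \<open>A circle that encloses all coordinates of \<open>\<gamma> w0\<close> and still
    has radius below \<open>r\<close>. For \<open>m = 0\<close> there is nothing to enclose, and
    positivity is claimed only for \<open>m > 0\<close>.\<close>
  obtain \<rho> where \<rho>: "\<rho> < r" "\<forall>j<m. norm (\<gamma> w0 j) < \<rho>" "m > 0 \<Longrightarrow> 0 < \<rho>"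
  proof (cases "m = 0")
    case True then show ?thesis using that[of "r - 1"] by auto
  next
    case False
    let ?M = "Max ((\<lambda>j. norm (\<gamma> w0 j)) ` {..<m})"
    have "?M < r" using w0 False by (subst Max_less_iff) (auto simp: polydisc_def)
    then obtain \<rho> where "?M < \<rho>" "\<rho> < r" using dense by blast
    moreover have "norm (\<gamma> w0 j) \<le> ?M" if "j < m" for j using that by (intro Max_ge) auto
    ultimately show ?thesis using that[of \<rho>] False norm_ge_zero
      by (metis bot_nat_0.not_eq_extremum order_le_less_trans)
  qed
  have ct: "isCont (\<lambda>w. \<gamma> w j) w0" if "j < m" for j
    using \<gamma>[OF that] by (rule DERIV_isCont)
  have near: "\<forall>\<^sub>F w in nhds w0. \<forall>j<m. norm (\<gamma> w j) < \<rho>"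
  proof -
    have "\<forall>\<^sub>F w in nhds w0. norm (\<gamma> w j) < \<rho>" if "j < m" for j
    proof -
      have "((\<lambda>w. norm (\<gamma> w j)) \<longlongrightarrow> norm (\<gamma> w0 j)) (nhds w0)"
        using ct[OF that] tendsto_at_iff_tendsto_nhds[of "\<lambda>w. \<gamma> w j" w0]
        by (intro tendsto_norm) (simp add: isCont_def)
      then show ?thesis using \<rho>(2) that by (auto dest: order_tendstoD)
    qed
    then have "\<forall>\<^sub>F w in nhds w0. \<forall>j\<in>{..<m}. norm (\<gamma> w j) < \<rho>"
      by (intro eventually_ball_finite) auto
    then show ?thesis by (simp add: Ball_def)
  qed
  have step: "((\<lambda>w. f (\<eta> k w)) has_field_derivative (\<Sum>j<k. partial_deriv j f (\<gamma> w0) * \<gamma>' j)) (at w0)"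
    if "k \<le> m" for k
    using that
  proof (induction k)
    case 0
    then show ?case by (simp add: \<eta>_def)
  next
    case (Suc k)
    then have k: "k < m" by simp
    then have \<rho>0: "0 < \<rho>" using \<rho>(3) by simp
    let ?Q = "\<lambda>w. divdiff \<rho> k f (\<eta> k w) (\<gamma> w k) (\<gamma> w0 k)"
    have \<eta>r: "\<forall>\<^sub>F w in nhds w0. \<eta> k w \<in> polydisc m r"
      using near by eventually_elim (use \<rho> cs in \<open>auto simp: polydisc_def \<eta>_def\<close>)
    have expand: "\<forall>\<^sub>F w in nhds w0. f (\<eta> (Suc k) w) = f (\<eta> k w) + (\<gamma> w k - \<gamma> w0 k) * ?Q w"
      using near \<eta>r
    proof eventually_elim
      fix w assume a: "\<forall>j<m. norm (\<gamma> w j) < \<rho>" "\<eta> k w \<in> polydisc m r"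
      have "(\<eta> k w)(k := \<gamma> w k) = \<eta> (Suc k) w" "(\<eta> k w)(k := \<gamma> w0 k) = \<eta> k w"
        by (auto simp: \<eta>_def less_Suc_eq)
      then show "f (\<eta> (Suc k) w) = f (\<eta> k w) + (\<gamma> w k - \<gamma> w0 k) * ?Q w"
        using divdiff_mult[OF f \<rho>0 \<rho>(1) k a(2), of "\<gamma> w k" "\<gamma> w0 k"] a(1) \<rho>(2) k
        by (simp add: algebra_simps)
    qed
    have "isCont ?Q w0"
    proof -
      let ?D = "polydisc m r \<times> ball 0 \<rho>"
      have cD: "continuous_on ?D (\<lambda>p. divdiff \<rho> k f (fst p) (snd p) (\<gamma> w0 k))"
        by (rule continuous_on_divdiff[OF f \<rho>0 \<rho>(1) k])
          (use \<rho> k in \<open>auto intro!: continuous_on_fst continuous_on_snd continuous_on_id continuous_on_const\<close>)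
      have lim: "((\<lambda>w. (\<eta> k w, \<gamma> w k)) \<longlongrightarrow> (\<eta> k w0, \<gamma> w0 k)) (at w0)"
      proof (intro tendsto_Pair)
        have "((\<lambda>w. \<eta> k w j) \<longlongrightarrow> \<eta> k w0 j) (at w0)" for j
          using ct[of j] k by (cases "j < k") (auto simp: \<eta>_def isCont_def)
        then show "((\<lambda>w. \<eta> k w) \<longlongrightarrow> \<eta> k w0) (at w0)"
          by (rule tendsto_coordinatewise)
      qed (use ct[OF k] in \<open>simp add: isCont_def\<close>)
      have ev: "\<forall>\<^sub>F w in at w0. (\<eta> k w, \<gamma> w k) \<in> ?D"
        using eventually_conj[OF near \<eta>r] unfolding eventually_nhds_conv_at
        using k by (auto elim: eventually_mono)
      show ?thesis
        using continuous_on_tendsto_compose[OF cD lim _ ev] w0 \<rho> k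
        by (simp add: isCont_def \<eta>_w0)
    qed
    then have Q: "(?Q \<longlongrightarrow> partial_deriv k f (\<gamma> w0)) (at w0)"
      using divdiff_same[OF f \<rho>0 \<rho>(1) k w0, of "\<gamma> w0 k"] \<rho>(2) k
      by (simp add: isCont_def \<eta>_w0)
    \<comment> \<open>The first factor vanishes at \<open>w0\<close>, so for the derivative of the
      product it is enough that \<open>?Q\<close> has a limit there.\<close>
    have "((\<lambda>w. (\<gamma> w k - \<gamma> w0 k) * ?Q w) has_field_derivative \<gamma>' k * partial_deriv k f (\<gamma> w0)) (at w0)"
      unfolding has_field_derivative_iff
    proof -
      have "((\<lambda>w. (\<gamma> w k - \<gamma> w0 k) / (w - w0) * ?Q w) \<longlongrightarrow> \<gamma>' k * partial_deriv k f (\<gamma> w0)) (at w0)"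
        using \<gamma>[OF k] Q by (intro tendsto_mult) (simp_all add: has_field_derivative_iff)
      then show "((\<lambda>w. ((\<gamma> w k - \<gamma> w0 k) * ?Q w - (\<gamma> w0 k - \<gamma> w0 k) * ?Q w0) / (w - w0)) \<longlongrightarrow> \<gamma>' k * partial_deriv k f (\<gamma> w0)) (at w0)"
        by simp
    qed
    from DERIV_add[OF Suc.IH this]
    have "((\<lambda>w. f (\<eta> k w) + (\<gamma> w k - \<gamma> w0 k) * ?Q w) has_field_derivative (\<Sum>j<Suc k. partial_deriv j f (\<gamma> w0) * \<gamma>' j)) (at w0)"
      using k by (simp add: mult.commute)
    then show ?case
      by (subst DERIV_cong_ev[OF refl expand refl])
  qed
  have "\<eta> m = \<gamma>"
    using in_cspace by (auto simp: \<eta>_def cspace_def fun_eq_iff)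
  then show ?thesis using step[of m] by simp
qed

text \<open>A map between the spaces is given by its component functions; padding with zeros puts
  its values into \<open>cspace m\<close>, where a germ in \<open>m\<close> variables is
  meaningful.\<close>

definition tuple :: "nat \<Rightarrow> (nat \<Rightarrow> 'a \<Rightarrow> complex) \<Rightarrow> 'a \<Rightarrow> nat \<Rightarrow> complex" where
  "tuple m \<phi> z = (\<lambda>i. if i < m then \<phi> i z else 0)"

lemma tuple_in_cspace [simp]: "tuple m \<phi> z \<in> cspace m"
  by (auto simp: tuple_def cspace_def)

definition map_germ :: "nat \<Rightarrow> nat \<Rightarrow> (nat \<Rightarrow> (nat \<Rightarrow> complex) \<Rightarrow> complex) \<Rightarrow> bool" where
  "map_germ n m \<phi> \<longleftrightarrow> (\<forall>j<m. holo_germ n (\<phi> j) \<and> \<phi> j origin = 0)"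

lemma tuple_origin: "map_germ n m \<phi> \<Longrightarrow> tuple m \<phi> origin = origin"
  by (auto simp: tuple_def map_germ_def origin_def)

lemma eventually_tuple:
  assumes \<phi>: "map_germ n m \<phi>" and P: "eventually P (near_origin m)"
  shows "\<forall>\<^sub>F z in near_origin n. P (tuple m \<phi> z)"
proof -
  obtain r where r: "r > 0" "\<forall>z\<in>polydisc m r. P z"
    using P by (auto simp: eventually_near_origin)
  have "\<forall>\<^sub>F z in near_origin n. norm (\<phi> j z) < r" if "j < m" for j
    using \<phi> that r by (intro holo_germ_eventually_norm_less) (auto simp: map_germ_def)
  then have "\<forall>\<^sub>F z in near_origin n. \<forall>j\<in>{..<m}. norm (\<phi> j z) < r"
    by (intro eventually_ball_finite) auto
  then show ?thesis
  proof eventually_elim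
    fix z assume "\<forall>j\<in>{..<m}. norm (\<phi> j z) < r"
    then have "tuple m \<phi> z \<in> polydisc m r" by (auto simp: polydisc_def) (auto simp: tuple_def)
    then show "P (tuple m \<phi> z)" using r by auto
  qed
qed

text \<open>Both claims come from one derivative: along a coordinate line the composite is
  \<open>f\<close> on a curve, and \<open>has_field_derivative_comp_curve\<close> yields holomorphy
  in that variable together with the chain rule.\<close>

lemma
  assumes f: "holo_germ m f" and \<phi>: "map_germ n m \<phi>"
  shows holo_germ_comp: "holo_germ n (\<lambda>z. f (tuple m \<phi> z))"
    and partial_deriv_comp: "\<forall>\<^sub>F z in near_origin n. \<forall>i<n. partial_deriv i (\<lambda>z. f (tuple m \<phi> z)) z =
      (\<Sum>j<m. partial_deriv j f (tuple m \<phi> z) * partial_deriv i (\<phi> j) z)"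
proof -
  obtain r where r: "r > 0" "holo_on m f (polydisc m r)"
    using f by (auto simp: holo_germ_polydisc)
  obtain r1 where r1: "r1 > 0" "\<forall>z\<in>polydisc n r1. tuple m \<phi> z \<in> polydisc m r"
    using eventually_tuple[OF \<phi> polydisc_eventually[OF r(1)]] by (auto simp: eventually_near_origin)
  have "\<forall>j\<in>{..<m}. \<exists>r>0. holo_on n (\<phi> j) (polydisc n r)"
    using \<phi> by (auto simp: map_germ_def holo_germ_polydisc)
  then obtain R where R: "\<And>j. j < m \<Longrightarrow> R j > 0" "\<And>j. j < m \<Longrightarrow> holo_on n (\<phi> j) (polydisc n (R j))"
    by (metis lessThan_iff)
  define r2 where "r2 = Min (insert r1 (R ` {..<m}))"
  have r2: "r2 > 0" "r2 \<le> r1" using r1 R by (auto simp: r2_def)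
  have h: "holo_on n (\<phi> j) (polydisc n r2)" if "j < m" for j
    by (rule holo_on_subset[OF R(2)[OF that]]) (use that in \<open>auto intro!: polydisc_mono Min_le simp: r2_def\<close>)
  have T: "tuple m \<phi> z \<in> polydisc m r" if "z \<in> polydisc n r2" for z
    using r1 r2 polydisc_mono that by blast
  have d: "((\<lambda>w. f (tuple m \<phi> (z(i := w)))) has_field_derivative
      (\<Sum>j<m. partial_deriv j f (tuple m \<phi> z) * partial_deriv i (\<phi> j) z)) (at (z i))"
    if z: "z \<in> polydisc n r2" and i: "i < n" for z i
  proof -
    have "((\<lambda>w. tuple m \<phi> (z(i := w)) j) has_field_derivative partial_deriv i (\<phi> j) z) (at (z i))" if "j < m" for j
      using partial_deriv_has_field_derivative[OF h[OF that] z i] that by (simp add: tuple_def)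
    note d = this
    show ?thesis
      using has_field_derivative_comp_curve[OF r(2), where \<gamma> = "\<lambda>w. tuple m \<phi> (z(i := w))", OF d] T[OF z]
      by simp
  qed
  have "continuous_on (polydisc n r2) (\<lambda>z. tuple m \<phi> z)"
  proof (rule continuous_on_coordinatewise_then_product)
    fix j show "continuous_on (polydisc n r2) (\<lambda>z. tuple m \<phi> z j)"
      using h[of j] by (cases "j < m") (auto simp: tuple_def holo_on_def)
  qed
  then have "continuous_on (polydisc n r2) (\<lambda>z. f (tuple m \<phi> z))"
    by (rule continuous_on_compose2[of "polydisc m r" f, rotated]) (use r T in \<open>auto simp: holo_on_def\<close>)
  then have "holo_on n (\<lambda>z. f (tuple m \<phi> z)) (polydisc n r2)"
    unfolding holo_on_def field_differentiable_def using d by blast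
  then show "holo_germ n (\<lambda>z. f (tuple m \<phi> z))"
    using r2 by (auto simp: holo_germ_polydisc)
  show "\<forall>\<^sub>F z in near_origin n. \<forall>i<n. partial_deriv i (\<lambda>z. f (tuple m \<phi> z)) z =
      (\<Sum>j<m. partial_deriv j f (tuple m \<phi> z) * partial_deriv i (\<phi> j) z)"
    unfolding eventually_near_origin partial_deriv_def[of _ "\<lambda>z. f (tuple m \<phi> z)"]
    using r2 d by (intro exI[of _ r2] conjI ballI allI impI DERIV_imp_deriv) auto
qed

text \<open>Hadamard's lemma between two moving endpoints. With endpoints \<open>z i\<close> and 0
  it divides by a coordinate; with \<open>z m\<close> and an implicit function it divides by the
  equation of a graph.\<close>

lemma holo_germ_diff_quotient:
  assumes f: "holo_germ n f" and i: "i < n"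
    and \<alpha>: "holo_germ n \<alpha>" "\<alpha> origin = 0" and \<beta>: "holo_germ n \<beta>" "\<beta> origin = 0"
  obtains Q where "holo_germ n Q" "Q origin = partial_deriv i f origin"
    "\<forall>\<^sub>F z in near_origin n. f (z(i := \<alpha> z)) - f (z(i := \<beta> z)) = (\<alpha> z - \<beta> z) * Q z"
proof -
  obtain r where r: "r > 0" "holo_on n f (polydisc n r)"
    using f by (auto simp: holo_germ_polydisc)
  obtain r1 where r1: "r1 > 0" "holo_on n \<alpha> (polydisc n r1)" "holo_on n \<beta> (polydisc n r1)"
    using holo_germ2E[OF \<alpha>(1) \<beta>(1)] .
  have "\<forall>\<^sub>F z in near_origin n. norm (\<alpha> z) < r/2 \<and> norm (\<beta> z) < r/2"
    using \<alpha> \<beta> r by (intro eventually_conj holo_germ_eventually_norm_less) auto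
  then obtain r2 where r2: "r2 > 0" "\<forall>z\<in>polydisc n r2. norm (\<alpha> z) < r/2 \<and> norm (\<beta> z) < r/2"
    by (auto simp: eventually_near_origin)
  define r3 where "r3 = min r (min r1 r2)"
  have r3: "r3 > 0" "r3 \<le> r" "r3 \<le> r1" "r3 \<le> r2" using r r1 r2 by (auto simp: r3_def)
  have s: "polydisc n r3 \<subseteq> polydisc n r" "polydisc n r3 \<subseteq> polydisc n r1" "polydisc n r3 \<subseteq> polydisc n r2"
    by (intro polydisc_mono r3)+
  have b: "norm (\<alpha> z) < r/2" "norm (\<beta> z) < r/2" if "z \<in> polydisc n r3" for z
    using that s r2 by auto
  have \<rho>: "0 < r/2" "r/2 < r" using r by auto
  show ?thesis
  proof
    have "holo_on n (\<lambda>z. divdiff (r/2) i f z (\<alpha> z) (\<beta> z)) (polydisc n r3)"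
      by (rule holo_on_divdiff[OF r(2) \<rho> i]) (use r1 r3 s b in \<open>auto intro: holo_on_subset\<close>)
    then show "holo_germ n (\<lambda>z. divdiff (r/2) i f z (\<alpha> z) (\<beta> z))"
      using r3 by (auto simp: holo_germ_polydisc)
    have "origin(i := 0) = origin" by auto
    then show "divdiff (r/2) i f origin (\<alpha> origin) (\<beta> origin) = partial_deriv i f origin"
      using divdiff_same[OF r(2) \<rho> i, of origin 0] r \<alpha> \<beta> by simp
    show "\<forall>\<^sub>F z in near_origin n. f (z(i := \<alpha> z)) - f (z(i := \<beta> z)) = (\<alpha> z - \<beta> z) * divdiff (r/2) i f z (\<alpha> z) (\<beta> z)"
      unfolding eventually_near_origin
      by (intro exI[of _ r3] conjI ballI divdiff_mult[OF r(2) \<rho> i]) (use r3 s b in auto)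
  qed
qed

section \<open>The implicit function theorem\<close>


abbreviation trunc :: "nat \<Rightarrow> (nat \<Rightarrow> complex) \<Rightarrow> nat \<Rightarrow> complex" where
  "trunc m z \<equiv> tuple m (\<lambda>i z. z i) z"

lemma map_germ_trunc: "map_germ n m (\<lambda>i z. z i)"
  by (simp add: map_germ_def)

lemma upd_eq_trunc: "z \<in> cspace (Suc m) \<Longrightarrow> z(m := 0) = trunc m z"
  by (auto simp: tuple_def cspace_def fun_eq_iff)

lemma trunc_ident: "z \<in> cspace m \<Longrightarrow> trunc m z = z"
  by (auto simp: tuple_def cspace_def fun_eq_iff)

lemma eventually_in_cspace: "\<forall>\<^sub>F z in near_origin n. z \<in> cspace n"
  by (auto simp: near_origin_def eventually_inf_principal)

lemma polydisc_Suc: "z \<in> polydisc m r \<Longrightarrow> norm w < r \<Longrightarrow> z(m := w) \<in> polydisc (Suc m) r"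
  by (auto simp: polydisc_def cspace_def less_Suc_eq)

text \<open>The conclusion is a factorization with a unit \<open>E\<close>, because later arguments
  divide by the equation of the graph and do not merely solve it. Everything rests on one bound:
  near the origin the divided difference of \<open>h\<close> in the last variable is larger than
  \<open>\<kappa>\<close> in norm, so values of \<open>h\<close> over the same base point separate
  at least \<open>\<kappa>\<close> times as fast as the last coordinates.\<close>

lemma implicit_function:
  assumes h: "holo_germ (Suc m) h" and h0: "h origin = 0" and dh: "partial_deriv m h origin \<noteq> 0"
  obtains \<omega> E where "holo_germ m \<omega>" "\<omega> origin = 0" "holo_germ (Suc m) E" "E origin \<noteq> 0"
    "\<forall>\<^sub>F z in near_origin (Suc m). h z = (z m - \<omega> (trunc m z)) * E z"
proof -
  obtain r where r: "r > 0" "holo_on (Suc m) h (polydisc (Suc m) r)"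
    using h by (auto simp: holo_germ_polydisc)
  define \<kappa> where "\<kappa> = norm (partial_deriv m h origin) / 2"
  have \<kappa>: "\<kappa> > 0" using dh by (simp add: \<kappa>_def)
  have \<rho>: "0 < r/2" "r/2 < r" using r by auto
  let ?Q = "divdiff (r/2) m h"
  let ?D = "polydisc (Suc m) r \<times> ball (0::complex) (r/2) \<times> ball (0::complex) (r/2)"
  have cQ: "continuous_on ?D (\<lambda>p. norm (?Q (fst p) (fst (snd p)) (snd (snd p))))"
    by (intro continuous_on_norm continuous_on_divdiff[OF r(2) \<rho>]) (auto intro!: continuous_on_fst continuous_on_snd continuous_on_id)
  have Q0: "?Q origin 0 0 = partial_deriv m h origin"
  proof -
    have "origin(m := 0) = origin" by auto
    then show ?thesis using divdiff_same[OF r(2) \<rho>, of m origin 0] r by simp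
  qed
  obtain A where A: "open A" "A \<inter> ?D = (\<lambda>p. norm (?Q (fst p) (fst (snd p)) (snd (snd p)))) -` {\<kappa><..} \<inter> ?D"
    using continuous_on_open_invariant[THEN iffD1, OF cQ, rule_format, OF open_greaterThan[of \<kappa>]] by auto
  have "(origin, 0, 0) \<in> A"
  proof -
    have "(origin, 0, 0) \<in> (\<lambda>p. norm (?Q (fst p) (fst (snd p)) (snd (snd p)))) -` {\<kappa><..} \<inter> ?D"
      using Q0 \<kappa> r by (simp add: \<kappa>_def)
    then show ?thesis using A by blast
  qed
  from A(1) this obtain A1 A2 where A12: "open A1" "open A2" "(origin, 0, 0) \<in> A1 \<times> A2" "A1 \<times> A2 \<subseteq> A"
    by (rule open_prod_elim)
  then have o12: "origin \<in> A1" "(0, 0) \<in> A2" by auto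
  from A12(2) o12(2) obtain B C where BC: "open B" "open C" "(0, 0) \<in> B \<times> C" "B \<times> C \<subseteq> A2"
    by (rule open_prod_elim)
  then have oBC: "0 \<in> B" "0 \<in> C" by auto
  obtain d1 where d1: "d1 > 0" "polydisc (Suc m) d1 \<subseteq> A1"
    using polydisc_subset_open[OF A12(1) o12(1)] .
  obtain d2 where d2: "d2 > 0" "ball 0 d2 \<subseteq> B" using BC(1) oBC(1) open_contains_ball by blast
  obtain d3 where d3: "d3 > 0" "ball 0 d3 \<subseteq> C" using BC(2) oBC(2) open_contains_ball by blast
  define \<delta> where "\<delta> = Min {d1, d2, d3, r/2}"
  have \<delta>: "\<delta> > 0" "\<delta> \<le> d1" "\<delta> \<le> d2" "\<delta> \<le> d3" "\<delta> \<le> r/2"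
    using d1 d2 d3 r by (auto simp: \<delta>_def)
  have lower: "norm (?Q z a b) > \<kappa>" if "z \<in> polydisc (Suc m) \<delta>" "norm a < \<delta>" "norm b < \<delta>" for z a b
  proof -
    have "z \<in> A1" using that d1 \<delta> polydisc_mono[of \<delta> d1 "Suc m"] by blast
    moreover have "a \<in> B" using that d2 \<delta> by auto
    moreover have "b \<in> C" using that d3 \<delta> by auto
    ultimately have "(z, a, b) \<in> A" using A12 BC by auto
    moreover have "(z, a, b) \<in> ?D" using that \<delta> polydisc_mono[of \<delta> r "Suc m"] r by auto
    ultimately have "(z, a, b) \<in> A \<inter> ?D" by blast
    then show ?thesis unfolding A(2) by simp
  qed
  \<comment> \<open>Zeros are sought in the disc of radius \<open>\<sigma>\<close>. On its boundary
    the norm of \<open>h\<close> is at least \<open>\<sigma> * \<kappa>\<close> minus the norm at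
    the centre. A centre value below \<open>\<sigma> * \<kappa> / 2\<close> thus makes the boundary
    values larger than the central one, which forces a zero inside by the minimum modulus
    principle.\<close>
  define \<sigma> where "\<sigma> = \<delta> / 2"
  have \<sigma>: "0 < \<sigma>" "\<sigma> < \<delta>" using \<delta> by (auto simp: \<sigma>_def)
  have "\<forall>\<^sub>F z in near_origin (Suc m). norm (h z) < \<sigma> * \<kappa> / 2"
    by (rule holo_germ_eventually_norm_less[OF h]) (use h0 \<kappa> \<sigma> in auto)
  then obtain r1 where r1: "r1 > 0" "\<forall>z\<in>polydisc (Suc m) r1. norm (h z) < \<sigma> * \<kappa> / 2"
    by (auto simp: eventually_near_origin)
  define R where "R = min r1 \<delta>"
  have R: "R > 0" "R \<le> r1" "R \<le> \<delta>" using r1 \<delta> by (auto simp: R_def)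
  have up: "z \<in> polydisc (Suc m) R" "z \<in> polydisc (Suc m) \<delta>" "z \<in> polydisc (Suc m) r" if "z \<in> polydisc m R" for z
  proof -
    have "z m = 0" using that by (auto simp: polydisc_def cspace_def)
    then have "z(m := 0) = z" by auto
    then show "z \<in> polydisc (Suc m) R" using polydisc_Suc[OF that, of 0] R by auto
    then show "z \<in> polydisc (Suc m) \<delta>" "z \<in> polydisc (Suc m) r"
      using polydisc_mono[of R \<delta> "Suc m"] polydisc_mono[of R r "Suc m"] R \<delta> r by auto
  qed
  have dd: "h (z(m := a)) - h (z(m := b)) = (a - b) * ?Q z a b"
    if "z \<in> polydisc m R" "norm a < \<delta>" "norm b < \<delta>" for z a b
    by (rule divdiff_mult[OF r(2) \<rho>]) (use that up \<delta> in auto)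
  have "\<exists>w. norm w < \<sigma> \<and> h (z(m := w)) = 0" if z: "z \<in> polydisc m R" for z
  proof -
    have hz: "(\<lambda>w. h (z(m := w))) holomorphic_on ball 0 r"
      by (rule holo_on_slice[OF r(2)]) (use up[OF z] in auto)
    have "z(m := 0) \<in> polydisc (Suc m) r1"
      using polydisc_Suc[OF z, of 0] R polydisc_mono[of R r1 "Suc m"] by auto
    then have small: "norm (h (z(m := 0))) < \<sigma> * \<kappa> / 2" using r1 by auto
    obtain w where "w \<in> ball 0 \<sigma>" "h (z(m := w)) = 0"
    proof (rule holomorphic_contract_to_zero[of 0 \<sigma> "\<lambda>w. h (z(m := w))"])
      show "continuous_on (cball 0 \<sigma>) (\<lambda>w. h (z(m := w)))"
        by (rule holomorphic_on_imp_continuous_on, rule holomorphic_on_subset[OF hz]) (use \<sigma> \<delta> r in auto)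
      show "(\<lambda>w. h (z(m := w))) holomorphic_on ball 0 \<sigma>"
        by (rule holomorphic_on_subset[OF hz]) (use \<sigma> \<delta> r in auto)
      fix u :: complex assume "norm (0 - u) = \<sigma>"
      then have u: "norm u = \<sigma>" by simp
      have "\<sigma> * \<kappa> \<le> norm u * norm (?Q z u 0)"
        using lower[OF up(2)[OF z], of u 0] u \<sigma> \<delta> by simp
      also have "\<dots> = norm (h (z(m := u)) - h (z(m := 0)))"
        using dd[OF z, of u 0] u \<sigma> \<delta> by (simp add: norm_mult)
      also have "\<dots> \<le> norm (h (z(m := u))) + norm (h (z(m := 0)))"
        by (rule norm_triangle_ineq4)
      finally show "norm (h (z(m := 0))) < norm (h (z(m := u)))" using small by simp
    qed (use \<sigma> in auto)
    then show ?thesis by auto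
  qed
  then obtain \<omega> where \<omega>: "\<And>z. z \<in> polydisc m R \<Longrightarrow> norm (\<omega> z) < \<sigma>"
    "\<And>z. z \<in> polydisc m R \<Longrightarrow> h (z(m := \<omega> z)) = 0" by metis
  have \<omega>\<delta>: "norm (\<omega> z) < \<delta>" if "z \<in> polydisc m R" for z using \<omega>(1)[OF that] \<sigma> by simp
  have \<omega>r: "norm (\<omega> z) < r/2" if "z \<in> polydisc m R" for z using \<omega>\<delta>[OF that] \<delta> by simp
  \<comment> \<open>Since \<open>h\<close> vanishes at \<open>z(m := \<omega> z)\<close>, comparing
    \<open>\<omega> z\<close> with \<open>\<omega> y\<close> over the same base point
    \<open>z\<close> expresses the increment of \<open>\<omega>\<close> through \<open>h\<close>.
    Continuity and derivatives of \<open>\<omega>\<close> are read off from this identity.\<close>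
  have diff: "(\<omega> z - \<omega> y) * ?Q z (\<omega> z) (\<omega> y) = - h (z(m := \<omega> y))"
    if "z \<in> polydisc m R" "y \<in> polydisc m R" for z y
    using dd[OF that(1) \<omega>\<delta>[OF that(1)] \<omega>\<delta>[OF that(2)]] \<omega>(2)[OF that(1)] by simp
  have Qnz: "?Q z (\<omega> z) (\<omega> y) \<noteq> 0" if "z \<in> polydisc m R" "y \<in> polydisc m R" for z y
    using lower[OF up(2)[OF that(1)] \<omega>\<delta>[OF that(1)] \<omega>\<delta>[OF that(2)]] \<kappa> by auto
  have \<omega>0: "\<omega> origin = 0"
  proof -
    have o: "origin \<in> polydisc m R" using R by simp
    have "origin(m := 0) = origin" by auto
    then have "\<omega> origin * ?Q origin (\<omega> origin) 0 = 0"
      using dd[OF o \<omega>\<delta>[OF o], of 0] \<omega>(2)[OF o] h0 \<delta> by simp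
    moreover have "?Q origin (\<omega> origin) 0 \<noteq> 0"
      using lower[OF up(2)[OF o] \<omega>\<delta>[OF o], of 0] \<delta> \<kappa> by auto
    ultimately show ?thesis by simp
  qed
  have cont: "continuous_on (polydisc m R) \<omega>"
    unfolding continuous_on_def
  proof
    fix y assume y: "y \<in> polydisc m R"
    have "continuous_on (polydisc m R) (\<lambda>z. h (z(m := \<omega> y)))"
      by (rule continuous_on_slice_pair[OF r(2)]) (use up \<omega>\<delta>[OF y] \<delta> in \<open>auto intro: continuous_intros\<close>)
    then have lim: "((\<lambda>z. h (z(m := \<omega> y))) \<longlongrightarrow> 0) (at y within polydisc m R)"
      using y \<omega>(2)[OF y] by (auto simp: continuous_on_def)
    have "((\<lambda>z. \<omega> z - \<omega> y) \<longlongrightarrow> 0) (at y within polydisc m R)"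
    proof (rule Lim_null_comparison)
      have "norm (\<omega> z - \<omega> y) \<le> norm (h (z(m := \<omega> y))) / \<kappa>" if z: "z \<in> polydisc m R" for z
      proof -
        have "norm (\<omega> z - \<omega> y) * \<kappa> \<le> norm (\<omega> z - \<omega> y) * norm (?Q z (\<omega> z) (\<omega> y))"
          using lower[OF up(2)[OF z] \<omega>\<delta>[OF z] \<omega>\<delta>[OF y]] by (intro mult_left_mono) auto
        also have "\<dots> = norm (h (z(m := \<omega> y)))"
          using diff[OF z y] by (metis norm_minus_cancel norm_mult)
        finally show ?thesis using \<kappa> by (simp add: field_simps)
      qed
      then show "\<forall>\<^sub>F z in at y within polydisc m R. norm (\<omega> z - \<omega> y) \<le> norm (h (z(m := \<omega> y))) / \<kappa>"
        by (auto simp: eventually_at_filter)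
      show "((\<lambda>z. norm (h (z(m := \<omega> y))) / \<kappa>) \<longlongrightarrow> 0) (at y within polydisc m R)"
        using tendsto_divide[OF tendsto_norm[OF lim] tendsto_const[of \<kappa>]] \<kappa> by simp
    qed
    then show "(\<omega> \<longlongrightarrow> \<omega> y) (at y within polydisc m R)"
      by (simp add: LIM_zero_iff)
  qed
  have "holo_on m \<omega> (polydisc m R)"
    unfolding holo_on_def
  proof (intro conjI ballI allI impI cont)
    fix z i assume z: "z \<in> polydisc m R" and i: "i < m"
    have zi: "z i \<in> ball 0 R" using z i by (auto simp: polydisc_def)
    have inP: "z(i := w) \<in> polydisc m R" if "w \<in> ball 0 R" for w
      using polydisc_upd[OF z i] that by auto
    let ?N = "\<lambda>w. h (z(m := \<omega> z, i := w))"
    let ?q = "\<lambda>w. ?Q (z(i := w)) (\<omega> (z(i := w))) (\<omega> z)"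
    have c\<omega>: "continuous_on (ball 0 R) (\<lambda>w. \<omega> (z(i := w)))"
      by (rule continuous_on_compose2[OF cont])
        (use inP in \<open>auto intro!: continuous_on_fun_upd continuous_on_const continuous_on_id simp del: fun_upd_apply\<close>)
    have cz: "continuous_on (ball 0 R) (\<lambda>w. z(i := w))"
      by (intro continuous_on_fun_upd continuous_on_const continuous_on_id)
    have "continuous_on (ball 0 R) ?q"
      by (rule continuous_on_divdiff[OF r(2) \<rho> _ cz c\<omega>])
        (use inP up \<omega>r \<omega>r[OF z] in \<open>auto simp del: fun_upd_apply\<close>)
    then have lq: "?q \<midarrow>z i\<rightarrow> ?q (z i)"
      using zi continuous_on_interior[of "ball 0 R" ?q "z i"] by (simp only: interior_ball isCont_def)
    have "z(m := \<omega> z) \<in> polydisc (Suc m) r"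
      using polydisc_upd[OF up(3)[OF z], of m "\<omega> z"] \<omega>\<delta>[OF z] \<delta> r by auto
    from partial_deriv_has_field_derivative[OF r(2) this, of i] i
    have N: "((\<lambda>w. (?N w - ?N (z i)) / (w - z i)) \<longlongrightarrow> partial_deriv i h (z(m := \<omega> z))) (at (z i))"
      by (simp add: has_field_derivative_iff)
    have N0: "?N (z i) = 0" using \<omega>(2)[OF z] i by (simp add: fun_upd_twist)
    \<comment> \<open>Implicit differentiation: the difference quotient of \<open>\<omega>\<close>
      is minus that of \<open>h\<close> with the last coordinate frozen at
      \<open>\<omega> z\<close>, divided by \<open>?q\<close>.\<close>
    have ev: "\<forall>\<^sub>F w in at (z i). - ((?N w - ?N (z i)) / (w - z i)) / ?q w = (\<omega> (z(i := w)) - \<omega> z) / (w - z i)"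
    proof -
      have "\<forall>\<^sub>F w in at (z i). w \<in> ball 0 R"
        using zi by (intro eventually_at_in_open') auto
      then show ?thesis
      proof eventually_elim
        fix w :: complex assume w: "w \<in> ball 0 R"
        have "(\<omega> (z(i := w)) - \<omega> z) * ?q w = - ?N w"
          using diff[OF inP[OF w] z] i by (simp add: fun_upd_twist)
        then have "\<omega> (z(i := w)) - \<omega> z = - ?N w / ?q w"
          using Qnz[OF inP[OF w] z] by (simp add: divide_simps)
        then show "- ((?N w - ?N (z i)) / (w - z i)) / ?q w = (\<omega> (z(i := w)) - \<omega> z) / (w - z i)"
          using N0 by simp
      qed
    qed
    have "?q (z i) \<noteq> 0" using Qnz[OF z z] by simp
    from tendsto_divide[OF tendsto_minus[OF N] lq this]
    have "((\<lambda>w. (\<omega> (z(i := w)) - \<omega> z) / (w - z i)) \<longlongrightarrow> - partial_deriv i h (z(m := \<omega> z)) / ?q (z i)) (at (z i))"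
      by (rule Lim_transform_eventually) (rule ev)
    then show "(\<lambda>w. \<omega> (z(i := w))) field_differentiable (at (z i))"
      unfolding field_differentiable_def has_field_derivative_iff by auto
  qed
  then have g\<omega>: "holo_germ m \<omega>" using R by (auto simp: holo_germ_polydisc)
  have \<beta>: "holo_germ (Suc m) (\<lambda>z. \<omega> (trunc m z))"
    by (rule holo_germ_comp[OF g\<omega> map_germ_trunc])
  have \<beta>0: "\<omega> (trunc m origin) = 0"
    using \<omega>0 tuple_origin[OF map_germ_trunc, of m] by simp
  \<comment> \<open>The second endpoint is a zero of \<open>h\<close>, so the divided difference
    from it to \<open>z m\<close> is the cofactor of \<open>h\<close>.\<close>
  obtain E where E: "holo_germ (Suc m) E" "E origin = partial_deriv m h origin"
    "\<forall>\<^sub>F z in near_origin (Suc m). h (z(m := z m)) - h (z(m := \<omega> (trunc m z))) = (z m - \<omega> (trunc m z)) * E z"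
    by (rule holo_germ_diff_quotient[OF h, of m "\<lambda>z. z m" "\<lambda>z. \<omega> (trunc m z)"]) (use \<beta> \<beta>0 in auto)
  have "\<forall>\<^sub>F z in near_origin (Suc m). trunc m z \<in> polydisc m R"
    by (rule eventually_tuple[OF map_germ_trunc polydisc_eventually]) (use R in auto)
  with E(3) have "\<forall>\<^sub>F z in near_origin (Suc m). h z = (z m - \<omega> (trunc m z)) * E z"
    using eventually_in_cspace
  proof eventually_elim
    fix z assume a: "h (z(m := z m)) - h (z(m := \<omega> (trunc m z))) = (z m - \<omega> (trunc m z)) * E z"
      "trunc m z \<in> polydisc m R" "z \<in> cspace (Suc m)"
    have "z(m := \<omega> (trunc m z)) = (trunc m z)(m := \<omega> (trunc m z))"
      using upd_eq_trunc[OF a(3)] by (metis fun_upd_upd)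
    then show "h z = (z m - \<omega> (trunc m z)) * E z"
      using \<omega>(2)[OF a(2)] a(1) by simp
  qed
  then show ?thesis using that[OF g\<omega> \<omega>0 E(1) _] E(2) dh by simp
qed

section \<open>Families as germs with the parameter in variable 0\<close>

definition uncurry_param :: "(complex \<Rightarrow> (nat \<Rightarrow> complex) \<Rightarrow> 'a) \<Rightarrow> (nat \<Rightarrow> complex) \<Rightarrow> 'a" where
  "uncurry_param f w = f (w 0) (\<lambda>i. w (Suc i))"

lemma uncurry_param_case_nat [simp]: "uncurry_param f (case_nat s z) = f s z"
  by (simp add: uncurry_param_def)

lemma case_nat_polydisc: "case_nat s z \<in> polydisc (Suc n) r \<longleftrightarrow> norm s < r \<and> z \<in> polydisc n r"
  by (auto simp: polydisc_def cspace_def less_Suc_eq_0_disj all_conj_distrib split: nat.splits)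

lemma case_nat_upd: "(case_nat s z)(Suc i := w) = case_nat s (z(i := w))"
  by (auto simp: fun_eq_iff split: nat.splits)

text \<open>A polydisc in \<open>n + 1\<close> variables is a disc times a polydisc, so one radius
  in \<open>z\<close> serves all small \<open>s\<close>.\<close>

lemma eventually_slice:
  assumes "\<forall>\<^sub>F w in near_origin (Suc n). P w"
  shows "\<forall>\<^sub>F s in nhds 0. \<forall>\<^sub>F z in near_origin n. P (case_nat s z)"
proof -
  obtain r where r: "r > 0" "\<forall>w\<in>polydisc (Suc n) r. P w"
    using assms by (auto simp: eventually_near_origin)
  have "\<forall>\<^sub>F s in nhds (0::complex). s \<in> ball 0 r"
    using r by (intro eventually_nhds_in_open) auto
  then show ?thesis
    by eventually_elim (use r in \<open>auto simp: eventually_near_origin case_nat_polydisc intro!: exI[of _ r]\<close>)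
qed

lemma holo_germ_slice:
  assumes "holo_germ (Suc n) F"
  shows "\<forall>\<^sub>F s in nhds 0. holo_germ n (\<lambda>z. F (case_nat s z))"
proof -
  obtain r where r: "r > 0" "holo_on (Suc n) F (polydisc (Suc n) r)"
    using assms by (auto simp: holo_germ_polydisc)
  have "\<forall>\<^sub>F s in nhds (0::complex). s \<in> ball 0 r"
    using r by (intro eventually_nhds_in_open) auto
  then show ?thesis
  proof eventually_elim
    fix s :: complex assume s: "s \<in> ball 0 r"
    have "holo_on n (\<lambda>z. F (case_nat s z)) (polydisc n r)"
      unfolding holo_on_def
    proof (intro conjI ballI allI impI)
      have "continuous_on (polydisc n r) (\<lambda>z. case_nat s z)"
      proof (rule continuous_on_coordinatewise_then_product)
        fix j show "continuous_on (polydisc n r) (\<lambda>z. case_nat s z j)"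
          by (cases j) (auto intro: continuous_on_coord)
      qed
      then show "continuous_on (polydisc n r) (\<lambda>z. F (case_nat s z))"
        by (rule continuous_on_compose2[of "polydisc (Suc n) r" F, rotated])
          (use r s in \<open>auto simp: holo_on_def case_nat_polydisc\<close>)
    next
      fix z i assume "z \<in> polydisc n r" "i < n"
      then have "case_nat s z \<in> polydisc (Suc n) r" "Suc i < Suc n" using s by (auto simp: case_nat_polydisc)
      with r(2) have "(\<lambda>w. F ((case_nat s z)(Suc i := w))) field_differentiable (at (case_nat s z (Suc i)))"
        unfolding holo_on_def by blast
      then show "(\<lambda>w. F (case_nat s (z(i := w)))) field_differentiable (at (z i))"
        by (simp add: case_nat_upd)
    qed
    then show "holo_germ n (\<lambda>z. F (case_nat s z))" using r by (auto simp: holo_germ_polydisc)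
  qed
qed

lemma partial_deriv_slice:
  "partial_deriv (Suc i) F (case_nat s z) = partial_deriv i (\<lambda>z. F (case_nat s z)) z"
  by (simp add: partial_deriv_def case_nat_upd)

section \<open>Ideals of germs and the dimension of their quotients\<close>


text \<open>Ideals are kept as sets of representatives. Containing every function that vanishes near
  the origin makes membership a property of germs.\<close>

definition germ_ideal :: "nat \<Rightarrow> ((nat \<Rightarrow> complex) \<Rightarrow> complex) set \<Rightarrow> bool" where
  "germ_ideal n J \<longleftrightarrow> (\<forall>h\<in>J. holo_germ n h) \<and> (\<forall>h. (\<forall>\<^sub>F z in near_origin n. h z = 0) \<longrightarrow> h \<in> J) \<and>
     (\<forall>h\<in>J. \<forall>k\<in>J. (\<lambda>z. h z + k z) \<in> J) \<and> (\<forall>a. holo_germ n a \<longrightarrow> (\<forall>h\<in>J. (\<lambda>z. a z * h z) \<in> J))"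

lemma germ_idealD:
  assumes "germ_ideal n J"
  shows "h \<in> J \<Longrightarrow> holo_germ n h" "(\<forall>\<^sub>F z in near_origin n. h z = 0) \<Longrightarrow> h \<in> J"
    "h \<in> J \<Longrightarrow> k \<in> J \<Longrightarrow> (\<lambda>z. h z + k z) \<in> J" "holo_germ n a \<Longrightarrow> h \<in> J \<Longrightarrow> (\<lambda>z. a z * h z) \<in> J"
  using assms by (auto simp: germ_ideal_def)

lemma germ_ideal_cong:
  assumes J: "germ_ideal n J" and h: "h \<in> J" and eq: "\<forall>\<^sub>F z in near_origin n. h z = k z"
  shows "k \<in> J"
proof -
  have "(\<lambda>z. k z - h z) \<in> J"
    by (rule germ_idealD(2)[OF J]) (use eq in eventually_elim, simp)
  from germ_idealD(3)[OF J h this] show ?thesis by simp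
qed

lemma germ_ideal_diff:
  assumes J: "germ_ideal n J" and "h \<in> J" "k \<in> J"
  shows "(\<lambda>z. h z - k z) \<in> J"
  using germ_idealD(3)[OF J assms(2) germ_idealD(4)[OF J holo_germ_const[of n "-1"] assms(3)]] by simp

lemma germ_ideal_sum:
  assumes J: "germ_ideal n J" and "\<And>i. i \<in> I \<Longrightarrow> h i \<in> J"
  shows "(\<lambda>z. \<Sum>i\<in>I. h i z) \<in> J"
  using assms(2)
  by (induction I rule: infinite_finite_induct) (auto intro: germ_idealD[OF J])

text \<open>A complex basis of O/J, phrased without cosets. Coefficients are sequences of which only
  the first \<open>d\<close> entries count.\<close>

definition qbasis :: "nat \<Rightarrow> ((nat \<Rightarrow> complex) \<Rightarrow> complex) set \<Rightarrow> nat \<Rightarrow> (nat \<Rightarrow> (nat \<Rightarrow> complex) \<Rightarrow> complex) \<Rightarrow> bool" where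
  "qbasis n J d e \<longleftrightarrow> (\<forall>i<d. holo_germ n (e i)) \<and>
     (\<forall>h. holo_germ n h \<longrightarrow> (\<exists>c::nat \<Rightarrow> complex. (\<lambda>z. h z - (\<Sum>i<d. c i * e i z)) \<in> J)) \<and>
     (\<forall>c::nat \<Rightarrow> complex. (\<lambda>z. \<Sum>i<d. c i * e i z) \<in> J \<longrightarrow> (\<forall>i<d. c i = 0))"

definition qdim :: "nat \<Rightarrow> ((nat \<Rightarrow> complex) \<Rightarrow> complex) set \<Rightarrow> nat \<Rightarrow> bool" where
  "qdim n J d \<longleftrightarrow> (\<exists>e. qbasis n J d e)"

lemma qbasisD:
  assumes "qbasis n J d e"
  shows "i < d \<Longrightarrow> holo_germ n (e i)"
    "holo_germ n h \<Longrightarrow> \<exists>c::nat \<Rightarrow> complex. (\<lambda>z. h z - (\<Sum>i<d. c i * e i z)) \<in> J"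
    "(\<lambda>z. \<Sum>i<d. c i * e i z) \<in> J \<Longrightarrow> \<forall>i<d. c i = (0::complex)"
  using assms by (simp_all add: qbasis_def)

lemma qdimI:
  assumes "\<And>i. i < d \<Longrightarrow> holo_germ n (e i)"
    "\<And>h. holo_germ n h \<Longrightarrow> \<exists>c::nat \<Rightarrow> complex. (\<lambda>z. h z - (\<Sum>i<d. c i * e i z)) \<in> J"
    "\<And>c::nat \<Rightarrow> complex. (\<lambda>z. \<Sum>i<d. c i * e i z) \<in> J \<Longrightarrow> \<forall>i<d. c i = 0"
  shows "qdim n J d"
  unfolding qdim_def qbasis_def using assms by (intro exI[of _ e]) simp

text \<open>The hypotheses say that pulling back along \<open>\<phi>\<close> induces an isomorphism
  of O/J onto O/J': \<open>iff\<close> makes it well defined and injective, \<open>surj\<close>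
  surjective. Bases are carried across in both directions.\<close>

lemma qdim_transfer:
  assumes J: "germ_ideal n J" and J': "germ_ideal m J'"
    and pull: "\<And>h. holo_germ n h \<Longrightarrow> holo_germ m (\<lambda>z. h (\<phi> z))"
    and surj: "\<And>k. holo_germ m k \<Longrightarrow> \<exists>h. holo_germ n h \<and> (\<forall>\<^sub>F z in near_origin m. h (\<phi> z) = k z)"
    and iff: "\<And>h. holo_germ n h \<Longrightarrow> (\<lambda>z. h (\<phi> z)) \<in> J' \<longleftrightarrow> h \<in> J"
  shows "qdim n J d \<longleftrightarrow> qdim m J' d"
proof
  assume "qdim n J d"
  then obtain e where "qbasis n J d e" unfolding qdim_def ..
  note e = qbasisD[OF this]
  have g: "holo_germ n (\<lambda>z. \<Sum>i<d. c i * e i z)" for c :: "nat \<Rightarrow> complex"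
    by (intro holo_germ_sum holo_germ_mult) (auto intro: e(1))
  have span: "\<exists>c::nat \<Rightarrow> complex. (\<lambda>z. k z - (\<Sum>i<d. c i * e i (\<phi> z))) \<in> J'" if k: "holo_germ m k" for k
  proof -
    from surj[OF k] obtain h where h: "holo_germ n h" "\<forall>\<^sub>F z in near_origin m. h (\<phi> z) = k z" by (elim exE conjE)
    obtain c :: "nat \<Rightarrow> complex" where "(\<lambda>z. h z - (\<Sum>i<d. c i * e i z)) \<in> J" using e(2)[OF h(1)] ..
    then have "(\<lambda>z. h (\<phi> z) - (\<Sum>i<d. c i * e i (\<phi> z))) \<in> J'"
      using iff[OF holo_germ_diff[OF h(1) g], of c] by (rule iffD2[rotated])
    then have "(\<lambda>z. k z - (\<Sum>i<d. c i * e i (\<phi> z))) \<in> J'"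
      by (rule germ_ideal_cong[OF J']) (use h(2) in eventually_elim, simp)
    then show ?thesis by blast
  qed
  have indep: "\<forall>i<d. c i = 0" if "(\<lambda>z. \<Sum>i<d. c i * e i (\<phi> z)) \<in> J'" for c :: "nat \<Rightarrow> complex"
    by (rule e(3)) (use iff[OF g] that in blast)
  show "qdim m J' d"
    by (rule qdimI[of _ _ "\<lambda>i z. e i (\<phi> z)"]) (rule pull, rule e(1), assumption, rule span, assumption, rule indep, assumption)
next
  assume "qdim m J' d"
  then obtain e where "qbasis m J' d e" unfolding qdim_def ..
  note e = qbasisD[OF this]
  have "\<forall>i. \<exists>h. i < d \<longrightarrow> holo_germ n h \<and> (\<forall>\<^sub>F z in near_origin m. h (\<phi> z) = e i z)"
    using e(1) surj by blast
  then obtain E where E: "\<And>i. i < d \<Longrightarrow> holo_germ n (E i)"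
    "\<And>i. i < d \<Longrightarrow> \<forall>\<^sub>F z in near_origin m. E i (\<phi> z) = e i z" by metis
  have g: "holo_germ n (\<lambda>z. \<Sum>i<d. c i * E i z)" for c :: "nat \<Rightarrow> complex"
    by (intro holo_germ_sum holo_germ_mult) (auto simp: E)
  have ev: "\<forall>\<^sub>F z in near_origin m. (\<Sum>i<d. c i * e i z) = (\<Sum>i<d. c i * E i (\<phi> z))" for c :: "nat \<Rightarrow> complex"
  proof -
    have "\<forall>\<^sub>F z in near_origin m. \<forall>i\<in>{..<d}. E i (\<phi> z) = e i z"
      by (intro eventually_ball_finite) (auto simp: E)
    then show ?thesis by eventually_elim auto
  qed
  have span: "\<exists>c::nat \<Rightarrow> complex. (\<lambda>z. h z - (\<Sum>i<d. c i * E i z)) \<in> J" if h: "holo_germ n h" for h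
  proof -
    obtain c :: "nat \<Rightarrow> complex" where "(\<lambda>z. h (\<phi> z) - (\<Sum>i<d. c i * e i z)) \<in> J'"
      using e(2)[OF pull[OF h]] ..
    then have "(\<lambda>z. h (\<phi> z) - (\<Sum>i<d. c i * E i (\<phi> z))) \<in> J'"
      by (rule germ_ideal_cong[OF J']) (use ev[of c] in eventually_elim, simp)
    then have "(\<lambda>z. h z - (\<Sum>i<d. c i * E i z)) \<in> J"
      using iff[OF holo_germ_diff[OF h g], of c] by (rule iffD1[rotated])
    then show ?thesis by blast
  qed
  have indep: "\<forall>i<d. c i = 0" if "(\<lambda>z. \<Sum>i<d. c i * E i z) \<in> J" for c :: "nat \<Rightarrow> complex"
  proof (rule e(3))
    have "(\<lambda>z. \<Sum>i<d. c i * E i (\<phi> z)) \<in> J'" using iff[OF g] that by blast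
    then show "(\<lambda>z. \<Sum>i<d. c i * e i z) \<in> J'"
      by (rule germ_ideal_cong[OF J']) (use ev[of c] in eventually_elim, simp)
  qed
  show "qdim n J d"
    by (rule qdimI[of _ _ E]) (rule E(1), assumption, rule span, assumption, rule indep, assumption)
qed

text \<open>On representatives this is the preimage of \<open>gradient_ideal\<close>; explicit
  coefficients avoid generated ideals until the Milnor number itself is computed.\<close>

definition jac_ideal :: "nat \<Rightarrow> ((nat \<Rightarrow> complex) \<Rightarrow> complex) \<Rightarrow> ((nat \<Rightarrow> complex) \<Rightarrow> complex) set" where
  "jac_ideal n g = {h. holo_germ n h \<and> (\<exists>a. (\<forall>i<n. holo_germ n (a i)) \<and>
     (\<forall>\<^sub>F z in near_origin n. h z = (\<Sum>i<n. a i z * partial_deriv i g z)))}"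

lemma jac_idealI:
  "holo_germ n h \<Longrightarrow> (\<And>i. i < n \<Longrightarrow> holo_germ n (a i)) \<Longrightarrow>
    (\<forall>\<^sub>F z in near_origin n. h z = (\<Sum>i<n. a i z * partial_deriv i g z)) \<Longrightarrow> h \<in> jac_ideal n g"
  unfolding jac_ideal_def by blast

lemma germ_ideal_jac_ideal: "germ_ideal n (jac_ideal n g)"
  unfolding germ_ideal_def
proof (intro conjI ballI allI impI)
  fix h :: "(nat \<Rightarrow> complex) \<Rightarrow> complex" assume h: "\<forall>\<^sub>F z in near_origin n. h z = 0"
  then have "\<forall>\<^sub>F z in near_origin n. 0 = h z" by eventually_elim simp
  then have "holo_germ n h" using holo_germ_cong[of n "\<lambda>_. 0" h] by simp
  then show "h \<in> jac_ideal n g"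
    by (rule jac_idealI[of _ _ "\<lambda>_ _. 0"]) (use h in auto)
next
  fix h k assume "h \<in> jac_ideal n g" "k \<in> jac_ideal n g"
  then obtain a b where *: "holo_germ n h" "holo_germ n k" "\<And>i. i < n \<Longrightarrow> holo_germ n (a i)" "\<And>i. i < n \<Longrightarrow> holo_germ n (b i)"
    "\<forall>\<^sub>F z in near_origin n. h z = (\<Sum>i<n. a i z * partial_deriv i g z)"
    "\<forall>\<^sub>F z in near_origin n. k z = (\<Sum>i<n. b i z * partial_deriv i g z)"
    unfolding jac_ideal_def by blast
  show "(\<lambda>z. h z + k z) \<in> jac_ideal n g"
    by (rule jac_idealI[of _ _ "\<lambda>i z. a i z + b i z"])
      (use *(1-4) in \<open>auto intro: holo_germ_add\<close>, use *(5,6) in eventually_elim, simp add: algebra_simps sum.distrib)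
next
  fix a h assume a: "holo_germ n a" and "h \<in> jac_ideal n g"
  then obtain b where *: "holo_germ n h" "\<And>i. i < n \<Longrightarrow> holo_germ n (b i)"
    "\<forall>\<^sub>F z in near_origin n. h z = (\<Sum>i<n. b i z * partial_deriv i g z)"
    unfolding jac_ideal_def by blast
  show "(\<lambda>z. a z * h z) \<in> jac_ideal n g"
    by (rule jac_idealI[of _ _ "\<lambda>i z. a z * b i z"])
      (use a *(1-2) in \<open>auto intro: holo_germ_mult\<close>, use *(3) in eventually_elim, simp add: algebra_simps sum_distrib_left)
qed (auto simp: jac_ideal_def)

lemma eventually_partial_deriv_cong:
  assumes "\<forall>\<^sub>F z in near_origin n. f z = g z"
  shows "\<forall>\<^sub>F z in near_origin n. \<forall>i<n. partial_deriv i f z = partial_deriv i g z"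
proof -
  have "\<forall>\<^sub>F z in near_origin n. \<forall>i\<in>{..<n}. partial_deriv i f z = partial_deriv i g z"
    by (intro eventually_ball_finite ballI partial_deriv_cong_ev[OF assms]) auto
  then show ?thesis by (simp add: Ball_def)
qed

lemma jac_ideal_cong:
  assumes eq: "\<forall>\<^sub>F z in near_origin n. f z = g z"
  shows "jac_ideal n f = jac_ideal n g"
proof -
  have sub: "jac_ideal n f \<subseteq> jac_ideal n g" if "\<forall>\<^sub>F z in near_origin n. f z = g z" for f g
  proof
    fix h assume "h \<in> jac_ideal n f"
    then obtain b where *: "holo_germ n h" "\<And>i. i < n \<Longrightarrow> holo_germ n (b i)"
      "\<forall>\<^sub>F z in near_origin n. h z = (\<Sum>i<n. b i z * partial_deriv i f z)"
      unfolding jac_ideal_def by blast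
    show "h \<in> jac_ideal n g"
      by (rule jac_idealI[OF *(1,2)], assumption, use *(3) eventually_partial_deriv_cong[OF that] in eventually_elim, simp)
  qed
  have "\<forall>\<^sub>F z in near_origin n. g z = f z" using eq by eventually_elim simp
  with sub[OF eq] sub[OF this] show ?thesis by blast
qed

lemma partial_deriv_coord: "partial_deriv i (\<lambda>z. z j) z = (if i = j then 1 else 0)"
  by (auto simp: partial_deriv_def)

lemma surj_trunc_tuple:
  assumes "map_germ k (Suc k) \<phi>" "\<And>j z. j < k \<Longrightarrow> \<phi> j z = z j" "holo_germ k h"
  shows "\<exists>H. holo_germ (Suc k) H \<and> (\<forall>\<^sub>F z in near_origin k. H (tuple (Suc k) \<phi> z) = h z)"
proof (intro exI conjI)
  show "holo_germ (Suc k) (\<lambda>z. h (trunc k z))"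
    by (rule holo_germ_comp[OF assms(3) map_germ_trunc])
  show "\<forall>\<^sub>F z in near_origin k. h (trunc k (tuple (Suc k) \<phi> z)) = h z"
    using eventually_in_cspace
  proof eventually_elim
    fix z assume "z \<in> cspace k"
    then have "trunc k (tuple (Suc k) \<phi> z) = z"
      using assms(2) by (auto simp: tuple_def cspace_def fun_eq_iff)
    then show "h (trunc k (tuple (Suc k) \<phi> z)) = h z" by simp
  qed
qed

text \<open>Restriction to the zero set of the last partial derivative, which is the graph of \<open>\<omega>\<close>, does
  not change the Milnor algebra.\<close>

context
  fixes k :: nat and G E \<omega> :: "(nat \<Rightarrow> complex) \<Rightarrow> complex" and \<phi> F
  assumes G: "holo_germ (Suc k) G" and \<omega>: "holo_germ k \<omega>" "\<omega> origin = 0"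
    and E: "holo_germ (Suc k) E" "E origin \<noteq> 0"
    and dG: "\<forall>\<^sub>F z in near_origin (Suc k). partial_deriv k G z = (z k - \<omega> (trunc k z)) * E z"
  defines "\<phi> \<equiv> \<lambda>j z. if j < k then z j else \<omega> z"
    and "F \<equiv> \<lambda>z. G (tuple (Suc k) \<phi> z)"
begin

lemma map_germ_graph: "map_germ k (Suc k) \<phi>"
  using \<omega> by (auto simp: map_germ_def \<phi>_def)

lemma trunc_graph: "z \<in> cspace k \<Longrightarrow> trunc k (tuple (Suc k) \<phi> z) = z"
  by (auto simp: tuple_def cspace_def fun_eq_iff \<phi>_def)

text \<open>In the chain rule the derivative of \<open>\<omega>\<close> is multiplied by
  \<open>partial_deriv k G\<close>, which vanishes on the graph.\<close>

lemma partial_deriv_graph: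
  "\<forall>\<^sub>F z in near_origin k. partial_deriv k G (tuple (Suc k) \<phi> z) = 0 \<and>
     (\<forall>i<k. partial_deriv i F z = partial_deriv i G (tuple (Suc k) \<phi> z))"
  using eventually_tuple[OF map_germ_graph dG] partial_deriv_comp[OF G map_germ_graph] eventually_in_cspace
proof eventually_elim
  fix z assume a: "partial_deriv k G (tuple (Suc k) \<phi> z) =
      (tuple (Suc k) \<phi> z k - \<omega> (trunc k (tuple (Suc k) \<phi> z))) * E (tuple (Suc k) \<phi> z)"
    and b: "\<forall>i<k. partial_deriv i (\<lambda>z. G (tuple (Suc k) \<phi> z)) z =
      (\<Sum>j<Suc k. partial_deriv j G (tuple (Suc k) \<phi> z) * partial_deriv i (\<phi> j) z)"
    and z: "z \<in> cspace k"
  have "tuple (Suc k) \<phi> z k = \<omega> z" by (simp add: tuple_def \<phi>_def)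
  with a have 0: "partial_deriv k G (tuple (Suc k) \<phi> z) = 0" by (simp add: trunc_graph[OF z])
  have "partial_deriv i F z = partial_deriv i G (tuple (Suc k) \<phi> z)" if i: "i < k" for i
  proof -
    have "partial_deriv i F z = (\<Sum>j<k. partial_deriv j G (tuple (Suc k) \<phi> z) * partial_deriv i (\<phi> j) z)"
      using b i 0 by (simp add: F_def)
    also have "\<dots> = (\<Sum>j<k. if j = i then partial_deriv j G (tuple (Suc k) \<phi> z) else 0)"
      by (intro sum.cong) (auto simp: \<phi>_def partial_deriv_coord)
    finally show ?thesis using i by simp
  qed
  with 0 show "partial_deriv k G (tuple (Suc k) \<phi> z) = 0 \<and>
     (\<forall>i<k. partial_deriv i F z = partial_deriv i G (tuple (Suc k) \<phi> z))" by blast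
qed

text \<open>Restriction to the graph gives one direction by \<open>partial_deriv_graph\<close>. For
  the other, the coefficients are extended to be constant in the last variable. The error
  \<open>e\<close> then vanishes on the graph, hence is a multiple of its equation, and that
  equation is \<open>partial_deriv k G\<close> up to the unit \<open>E\<close>.\<close>

lemma jac_ideal_graph:
  assumes h: "holo_germ (Suc k) h"
  shows "(\<lambda>z. h (tuple (Suc k) \<phi> z)) \<in> jac_ideal k F \<longleftrightarrow> h \<in> jac_ideal (Suc k) G"
proof
  assume "h \<in> jac_ideal (Suc k) G"
  then obtain a where a: "\<And>i. i < Suc k \<Longrightarrow> holo_germ (Suc k) (a i)"
    "\<forall>\<^sub>F z in near_origin (Suc k). h z = (\<Sum>i<Suc k. a i z * partial_deriv i G z)"
    unfolding jac_ideal_def by blast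
  show "(\<lambda>z. h (tuple (Suc k) \<phi> z)) \<in> jac_ideal k F"
  proof (rule jac_idealI[of _ _ "\<lambda>i z. a i (tuple (Suc k) \<phi> z)"])
    show "holo_germ k (\<lambda>z. h (tuple (Suc k) \<phi> z))" by (rule holo_germ_comp[OF h map_germ_graph])
    show "holo_germ k (\<lambda>z. a i (tuple (Suc k) \<phi> z))" if "i < k" for i
      by (rule holo_germ_comp[OF a(1) map_germ_graph]) (use that in simp)
    show "\<forall>\<^sub>F z in near_origin k. h (tuple (Suc k) \<phi> z) = (\<Sum>i<k. a i (tuple (Suc k) \<phi> z) * partial_deriv i F z)"
      using eventually_tuple[OF map_germ_graph a(2)] partial_deriv_graph
      by eventually_elim simp
  qed
next
  assume "(\<lambda>z. h (tuple (Suc k) \<phi> z)) \<in> jac_ideal k F"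
  then obtain a where a: "\<And>i. i < k \<Longrightarrow> holo_germ k (a i)"
    "\<forall>\<^sub>F z in near_origin k. h (tuple (Suc k) \<phi> z) = (\<Sum>i<k. a i z * partial_deriv i F z)"
    unfolding jac_ideal_def by blast
  define e where "e z = h z - (\<Sum>i<k. a i (trunc k z) * partial_deriv i G z)" for z
  have at: "holo_germ (Suc k) (\<lambda>z. a i (trunc k z))" if "i < k" for i
    by (rule holo_germ_comp[OF a(1)[OF that] map_germ_trunc])
  have e: "holo_germ (Suc k) e"
    unfolding e_def using h at G
    by (intro holo_germ_diff holo_germ_sum holo_germ_mult holo_germ_partial_deriv) auto
  have e0: "\<forall>\<^sub>F z in near_origin k. e (tuple (Suc k) \<phi> z) = 0"
    using a(2) partial_deriv_graph eventually_in_cspace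
    by eventually_elim (simp add: e_def trunc_graph)
  obtain Q where Q: "holo_germ (Suc k) Q"
    "\<forall>\<^sub>F z in near_origin (Suc k). e (z(k := z k)) - e (z(k := \<omega> (trunc k z))) = (z k - \<omega> (trunc k z)) * Q z"
    by (rule holo_germ_diff_quotient[OF e, of k "\<lambda>z. z k" "\<lambda>z. \<omega> (trunc k z)"])
      (use \<omega> holo_germ_comp[OF \<omega>(1) map_germ_trunc] tuple_origin[OF map_germ_trunc, of k] in auto)
  show "h \<in> jac_ideal (Suc k) G"
  proof (rule jac_idealI[OF h, of "\<lambda>i z. if i < k then a i (trunc k z) else Q z / E z"])
    show "holo_germ (Suc k) (\<lambda>z. if i < k then a i (trunc k z) else Q z / E z)" if "i < Suc k" for i
      using at Q E by (cases "i < k") (auto intro: holo_germ_divide)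
    show "\<forall>\<^sub>F z in near_origin (Suc k). h z =
        (\<Sum>i<Suc k. (if i < k then a i (trunc k z) else Q z / E z) * partial_deriv i G z)"
      using Q(2) dG holo_germ_eventually_nonzero[OF E] eventually_tuple[OF map_germ_trunc e0] eventually_in_cspace
    proof eventually_elim
      fix z assume q: "e (z(k := z k)) - e (z(k := \<omega> (trunc k z))) = (z k - \<omega> (trunc k z)) * Q z"
        and d: "partial_deriv k G z = (z k - \<omega> (trunc k z)) * E z" and nz: "E z \<noteq> 0"
        and e0: "e (tuple (Suc k) \<phi> (trunc k z)) = 0" and z: "z \<in> cspace (Suc k)"
      have "z(k := \<omega> (trunc k z)) = tuple (Suc k) \<phi> (trunc k z)"
        using z by (auto simp: fun_eq_iff tuple_def \<phi>_def cspace_def)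
      then have "e z = (z k - \<omega> (trunc k z)) * Q z" using q e0 by simp
      then have "h z = (\<Sum>i<k. a i (trunc k z) * partial_deriv i G z) + (z k - \<omega> (trunc k z)) * Q z"
        by (simp add: e_def algebra_simps)
      then show "h z = (\<Sum>i<Suc k. (if i < k then a i (trunc k z) else Q z / E z) * partial_deriv i G z)"
        using d nz by simp
    qed
  qed
qed

lemma qdim_graph: "qdim (Suc k) (jac_ideal (Suc k) G) d \<longleftrightarrow> qdim k (jac_ideal k F) d"
proof (rule qdim_transfer[where \<phi> = "tuple (Suc k) \<phi>"])
  fix h assume h: "holo_germ k h"
  show "\<exists>H. holo_germ (Suc k) H \<and> (\<forall>\<^sub>F z in near_origin k. H (tuple (Suc k) \<phi> z) = h z)"
    by (rule surj_trunc_tuple[OF map_germ_graph _ h]) (simp add: \<phi>_def)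
qed (rule germ_ideal_jac_ideal holo_germ_comp[OF _ map_germ_graph] jac_ideal_graph, assumption?)+

end

section \<open>Invariance under biholomorphic coordinate changes\<close>

context
  fixes p :: nat and \<phi> \<psi>
  assumes \<phi>: "map_germ p p \<phi>" and \<psi>: "map_germ p p \<psi>"
    and \<psi>\<phi>: "\<forall>\<^sub>F z in near_origin p. tuple p \<psi> (tuple p \<phi> z) = z"
    and \<phi>\<psi>: "\<forall>\<^sub>F z in near_origin p. tuple p \<phi> (tuple p \<psi> z) = z"
begin

text \<open>Near the origin \<open>g\<close> is \<open>?G\<close> composed with
  \<open>\<phi>\<close>, so the chain rule writes the partial derivatives of \<open>g\<close>
  through those of the transported function. The reverse inclusion is the same lemma with the two
  maps exchanged.\<close>

lemma jac_ideal_comp: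
  assumes g: "holo_germ p g" and h: "h \<in> jac_ideal p g"
  shows "(\<lambda>z. h (tuple p \<psi> z)) \<in> jac_ideal p (\<lambda>z. g (tuple p \<psi> z))"
proof -
  let ?G = "\<lambda>z. g (tuple p \<psi> z)"
  obtain a where a: "holo_germ p h" "\<And>i. i < p \<Longrightarrow> holo_germ p (a i)"
    "\<forall>\<^sub>F z in near_origin p. h z = (\<Sum>i<p. a i z * partial_deriv i g z)"
    using h unfolding jac_ideal_def by blast
  have G: "holo_germ p ?G" by (rule holo_germ_comp[OF g \<psi>])
  have eq: "\<forall>\<^sub>F z in near_origin p. ?G (tuple p \<phi> z) = g z"
    using \<psi>\<phi> by eventually_elim simp
  have d: "\<forall>\<^sub>F z in near_origin p. \<forall>i<p. partial_deriv i g z = (\<Sum>j<p. partial_deriv j ?G (tuple p \<phi> z) * partial_deriv i (\<phi> j) z)"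
    using partial_deriv_comp[OF G \<phi>] eventually_partial_deriv_cong[OF eq] by eventually_elim simp
  show ?thesis
  proof (rule jac_idealI[of _ _ "\<lambda>j z. \<Sum>i<p. a i (tuple p \<psi> z) * partial_deriv i (\<phi> j) (tuple p \<psi> z)"])
    show "holo_germ p (\<lambda>z. h (tuple p \<psi> z))" by (rule holo_germ_comp[OF a(1) \<psi>])
    show "holo_germ p (\<lambda>z. \<Sum>i<p. a i (tuple p \<psi> z) * partial_deriv i (\<phi> j) (tuple p \<psi> z))" if "j < p" for j
      using a(2) \<phi> that
      by (intro holo_germ_sum holo_germ_mult holo_germ_comp[OF _ \<psi>] holo_germ_partial_deriv) (auto simp: map_germ_def)
    show "\<forall>\<^sub>F z in near_origin p. h (tuple p \<psi> z) =
        (\<Sum>j<p. (\<Sum>i<p. a i (tuple p \<psi> z) * partial_deriv i (\<phi> j) (tuple p \<psi> z)) * partial_deriv j ?G z)"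
      using eventually_tuple[OF \<psi> a(3)] eventually_tuple[OF \<psi> d] \<phi>\<psi>
    proof eventually_elim
      fix z let ?w = "tuple p \<psi> z"
      assume "h ?w = (\<Sum>i<p. a i ?w * partial_deriv i g ?w)"
        and d: "\<forall>i<p. partial_deriv i g ?w = (\<Sum>j<p. partial_deriv j ?G (tuple p \<phi> ?w) * partial_deriv i (\<phi> j) ?w)"
        and "tuple p \<phi> ?w = z"
      then have "h ?w = (\<Sum>i<p. a i ?w * (\<Sum>j<p. partial_deriv j ?G z * partial_deriv i (\<phi> j) ?w))"
        by simp
      also have "\<dots> = (\<Sum>i<p. \<Sum>j<p. a i ?w * partial_deriv i (\<phi> j) ?w * partial_deriv j ?G z)"
        by (simp add: sum_distrib_left algebra_simps)
      also have "\<dots> = (\<Sum>j<p. (\<Sum>i<p. a i ?w * partial_deriv i (\<phi> j) ?w) * partial_deriv j ?G z)"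
        by (subst sum.swap) (simp add: sum_distrib_right)
      finally show "h ?w = (\<Sum>j<p. (\<Sum>i<p. a i ?w * partial_deriv i (\<phi> j) ?w) * partial_deriv j ?G z)" .
    qed
  qed
qed

end

lemma qdim_biholo:
  assumes \<phi>: "map_germ p p \<phi>" and \<psi>: "map_germ p p \<psi>"
    and \<psi>\<phi>: "\<forall>\<^sub>F z in near_origin p. tuple p \<psi> (tuple p \<phi> z) = z"
    and \<phi>\<psi>: "\<forall>\<^sub>F z in near_origin p. tuple p \<phi> (tuple p \<psi> z) = z"
    and g: "holo_germ p g"
  shows "qdim p (jac_ideal p g) d \<longleftrightarrow> qdim p (jac_ideal p (\<lambda>z. g (tuple p \<psi> z))) d"
proof (rule qdim_transfer[where \<phi> = "tuple p \<psi>"])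
  fix k assume k: "holo_germ p k"
  show "\<exists>h. holo_germ p h \<and> (\<forall>\<^sub>F z in near_origin p. h (tuple p \<psi> z) = k z)"
    by (rule exI[of _ "\<lambda>z. k (tuple p \<phi> z)"])
      (use holo_germ_comp[OF k \<phi>] in simp, use \<phi>\<psi> in eventually_elim, simp)
next
  fix h assume h: "holo_germ p h"
  show "(\<lambda>z. h (tuple p \<psi> z)) \<in> jac_ideal p (\<lambda>z. g (tuple p \<psi> z)) \<longleftrightarrow> h \<in> jac_ideal p g"
  proof
    assume "h \<in> jac_ideal p g"
    then show "(\<lambda>z. h (tuple p \<psi> z)) \<in> jac_ideal p (\<lambda>z. g (tuple p \<psi> z))"
      by (rule jac_ideal_comp[OF \<phi> \<psi> \<psi>\<phi> \<phi>\<psi> g])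
  next
    assume "(\<lambda>z. h (tuple p \<psi> z)) \<in> jac_ideal p (\<lambda>z. g (tuple p \<psi> z))"
    from jac_ideal_comp[OF \<psi> \<phi> \<phi>\<psi> \<psi>\<phi> holo_germ_comp[OF g \<psi>] this]
    have "(\<lambda>z. h (tuple p \<psi> (tuple p \<phi> z))) \<in> jac_ideal p (\<lambda>z. g (tuple p \<psi> (tuple p \<phi> z)))" .
    moreover have "jac_ideal p (\<lambda>z. g (tuple p \<psi> (tuple p \<phi> z))) = jac_ideal p g"
      by (rule jac_ideal_cong) (use \<psi>\<phi> in eventually_elim, simp)
    ultimately have "(\<lambda>z. h (tuple p \<psi> (tuple p \<phi> z))) \<in> jac_ideal p g" by simp
    then show "h \<in> jac_ideal p g"
      by (rule germ_ideal_cong[OF germ_ideal_jac_ideal]) (use \<psi>\<phi> in eventually_elim, simp)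
  qed
qed (auto intro: germ_ideal_jac_ideal holo_germ_comp[OF _ \<psi>])

section \<open>Ideals with two generators in two variables\<close>


text \<open>Off the hyperplane one divides by \<open>z i\<close>; on it, the value of
  \<open>k\<close> is the limit of zeros along the slice in direction \<open>i\<close>.\<close>

lemma coord_cancel:
  assumes k: "holo_germ n k" and i: "i < n" and eq: "\<forall>\<^sub>F z in near_origin n. z i * k z = 0"
  shows "\<forall>\<^sub>F z in near_origin n. k z = 0"
proof -
  obtain r1 where r1: "r1 > 0" "holo_on n k (polydisc n r1)"
    using k by (auto simp: holo_germ_polydisc)
  obtain r2 where r2: "r2 > 0" "\<forall>z\<in>polydisc n r2. z i * k z = 0"
    using eq by (auto simp: eventually_near_origin)
  define r where "r = min r1 r2"
  have r: "r > 0" "holo_on n k (polydisc n r)" "\<And>z. z \<in> polydisc n r \<Longrightarrow> z i * k z = 0"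
    using r1 r2 polydisc_min[of n r1 r2] by (auto simp: r_def intro: holo_on_subset)
  have "k z = 0" if z: "z \<in> polydisc n r" for z
  proof (cases "z i = 0")
    case True
    have "(\<lambda>w. k (z(i := w))) holomorphic_on ball 0 r" by (rule holo_on_slice[OF r(2) z i])
    then have "continuous_on (ball 0 r) (\<lambda>w. k (z(i := w)))" by (rule holomorphic_on_imp_continuous_on)
    then have "isCont (\<lambda>w. k (z(i := w))) 0"
      using r(1) continuous_on_interior[of "ball 0 r" _ 0] by simp
    then have "(\<lambda>w. k (z(i := w))) \<midarrow>0\<rightarrow> k (z(i := 0))" by (simp only: isCont_def)
    moreover have "\<forall>\<^sub>F w in at 0. w \<in> ball 0 r"
      using r(1) by (intro eventually_at_in_open') auto
    then have "\<forall>\<^sub>F w in at 0. k (z(i := w)) = 0"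
      using eventually_neq_at_within[of 0 0 UNIV]
    proof eventually_elim
      fix w :: complex assume w: "w \<in> ball 0 r" "w \<noteq> 0"
      then show "k (z(i := w)) = 0"
        using r(3)[OF polydisc_upd[OF z i, of w]] by simp
    qed
    ultimately have "((\<lambda>_. 0) \<longlongrightarrow> k (z(i := 0))) (at (0::complex))"
      by (rule Lim_transform_eventually)
    then have "k (z(i := 0)) = 0" by (simp add: tendsto_const_iff)
    moreover have "z(i := 0) = z" using True by auto
    ultimately show ?thesis by simp
  qed (use r(3)[OF z] in simp)
  then show ?thesis using r(1) by (auto simp: eventually_near_origin)
qed

lemma coord_power_cancel:
  assumes k: "holo_germ n k" and i: "i < n" and eq: "\<forall>\<^sub>F z in near_origin n. z i ^ m * k z = 0"
  shows "\<forall>\<^sub>F z in near_origin n. k z = 0"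
  using eq
proof (induction m)
  case (Suc m)
  have "\<forall>\<^sub>F z in near_origin n. z i ^ m * k z = 0"
    using Suc.prems
    by (intro coord_cancel[OF holo_germ_mult[OF holo_germ_power[OF holo_germ_coord] k] i])
      (simp only: power_Suc mult.assoc)
  then show ?case by (rule Suc.IH)
qed simp

definition ideal2 :: "nat \<Rightarrow> ((nat \<Rightarrow> complex) \<Rightarrow> complex) \<Rightarrow> ((nat \<Rightarrow> complex) \<Rightarrow> complex) \<Rightarrow> ((nat \<Rightarrow> complex) \<Rightarrow> complex) set" where
  "ideal2 n a b = {h. holo_germ n h \<and> (\<exists>\<alpha> \<beta>. holo_germ n \<alpha> \<and> holo_germ n \<beta> \<and>
     (\<forall>\<^sub>F z in near_origin n. h z = \<alpha> z * a z + \<beta> z * b z))}"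

lemma ideal2I:
  "holo_germ n h \<Longrightarrow> holo_germ n \<alpha> \<Longrightarrow> holo_germ n \<beta> \<Longrightarrow>
    \<forall>\<^sub>F z in near_origin n. h z = \<alpha> z * a z + \<beta> z * b z \<Longrightarrow> h \<in> ideal2 n a b"
  unfolding ideal2_def by blast

lemma ideal2E:
  assumes "h \<in> ideal2 n a b"
  obtains \<alpha> \<beta> where "holo_germ n h" "holo_germ n \<alpha>" "holo_germ n \<beta>"
    "\<forall>\<^sub>F z in near_origin n. h z = \<alpha> z * a z + \<beta> z * b z"
  using assms unfolding ideal2_def by blast

lemma germ_ideal_ideal2: "germ_ideal n (ideal2 n a b)"
  unfolding germ_ideal_def
proof (intro conjI ballI allI impI)
  fix h :: "(nat \<Rightarrow> complex) \<Rightarrow> complex" assume h: "\<forall>\<^sub>F z in near_origin n. h z = 0"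
  then have "\<forall>\<^sub>F z in near_origin n. 0 = h z" by eventually_elim simp
  then have "holo_germ n h" using holo_germ_cong[of n "\<lambda>_. 0" h] by simp
  then show "h \<in> ideal2 n a b"
    by (rule ideal2I[of _ _ "\<lambda>_. 0" "\<lambda>_. 0"]) (use h in auto)
next
  fix h k assume h: "h \<in> ideal2 n a b" and k: "k \<in> ideal2 n a b"
  from h obtain \<alpha> \<beta> where 1: "holo_germ n h" "holo_germ n \<alpha>" "holo_germ n \<beta>"
    "\<forall>\<^sub>F z in near_origin n. h z = \<alpha> z * a z + \<beta> z * b z" by (rule ideal2E)
  from k obtain \<alpha>' \<beta>' where 2: "holo_germ n k" "holo_germ n \<alpha>'" "holo_germ n \<beta>'"
    "\<forall>\<^sub>F z in near_origin n. k z = \<alpha>' z * a z + \<beta>' z * b z" by (rule ideal2E)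
  show "(\<lambda>z. h z + k z) \<in> ideal2 n a b"
    by (rule ideal2I[OF holo_germ_add[OF 1(1) 2(1)] holo_germ_add[OF 1(2) 2(2)] holo_germ_add[OF 1(3) 2(3)]])
      (use 1(4) 2(4) in eventually_elim, simp add: algebra_simps)
next
  fix c h assume c: "holo_germ n c" and h: "h \<in> ideal2 n a b"
  from h obtain \<alpha> \<beta> where 1: "holo_germ n h" "holo_germ n \<alpha>" "holo_germ n \<beta>"
    "\<forall>\<^sub>F z in near_origin n. h z = \<alpha> z * a z + \<beta> z * b z" by (rule ideal2E)
  show "(\<lambda>z. c z * h z) \<in> ideal2 n a b"
    by (rule ideal2I[OF holo_germ_mult[OF c 1(1)] holo_germ_mult[OF c 1(2)] holo_germ_mult[OF c 1(3)]])
      (use 1(4) in eventually_elim, simp add: algebra_simps)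
qed (auto simp: ideal2_def)

lemma ideal2_subset:
  assumes J: "germ_ideal n J" and "a \<in> J" "b \<in> J"
  shows "ideal2 n a b \<subseteq> J"
proof
  fix h assume "h \<in> ideal2 n a b"
  then obtain \<alpha> \<beta> where 1: "holo_germ n \<alpha>" "holo_germ n \<beta>"
    "\<forall>\<^sub>F z in near_origin n. h z = \<alpha> z * a z + \<beta> z * b z" by (rule ideal2E)
  have "(\<lambda>z. \<alpha> z * a z + \<beta> z * b z) \<in> J"
    by (intro germ_idealD[OF J] 1 assms)
  then show "h \<in> J"
    by (rule germ_ideal_cong[OF J]) (use 1(3) in eventually_elim, simp)
qed

lemma ideal2_eqI:
  assumes "a \<in> ideal2 n a' b'" "b \<in> ideal2 n a' b'" "a' \<in> ideal2 n a b" "b' \<in> ideal2 n a b"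
  shows "ideal2 n a b = ideal2 n a' b'"
  by (intro equalityI ideal2_subset germ_ideal_ideal2 assms)

lemma ideal2_gen:
  assumes "holo_germ n a" "holo_germ n b"
  shows "a \<in> ideal2 n a b" "b \<in> ideal2 n a b"
  by (rule ideal2I[of _ _ "\<lambda>_. 1" "\<lambda>_. 0"], use assms in auto)
    (rule ideal2I[of _ _ "\<lambda>_. 0" "\<lambda>_. 1"], use assms in auto)

lemma ideal2_commute:
  assumes "holo_germ n a" "holo_germ n b"
  shows "ideal2 n a b = ideal2 n b a"
  by (intro ideal2_eqI ideal2_gen assms)

lemma jac_ideal_2: "jac_ideal 2 g = ideal2 2 (partial_deriv 0 g) (partial_deriv 1 g)"
proof (intro equalityI subsetI)
  fix h assume "h \<in> jac_ideal 2 g"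
  then obtain a where a: "holo_germ 2 h" "\<And>i. i < 2 \<Longrightarrow> holo_germ 2 (a i)"
    "\<forall>\<^sub>F z in near_origin 2. h z = (\<Sum>i<2. a i z * partial_deriv i g z)"
    unfolding jac_ideal_def by blast
  show "h \<in> ideal2 2 (partial_deriv 0 g) (partial_deriv 1 g)"
    by (rule ideal2I[OF a(1) a(2)[of 0] a(2)[of 1]]) (use a(3) in \<open>simp_all add: numeral_2_eq_2\<close>)
next
  fix h assume "h \<in> ideal2 2 (partial_deriv 0 g) (partial_deriv 1 g)"
  then obtain \<alpha> \<beta> where 1: "holo_germ 2 h" "holo_germ 2 \<alpha>" "holo_germ 2 \<beta>"
    "\<forall>\<^sub>F z in near_origin 2. h z = \<alpha> z * partial_deriv 0 g z + \<beta> z * partial_deriv 1 g z" by (rule ideal2E)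
  show "h \<in> jac_ideal 2 g"
    by (rule jac_idealI[of _ _ "\<lambda>i. if i = 0 then \<alpha> else \<beta>"]) (use 1 in \<open>auto simp: numeral_2_eq_2\<close>)
qed

text \<open>The exact sequence \<open>0 \<rightarrow> O/(a, b) \<rightarrow> O/(a, c b) \<rightarrow> O/(a, c) \<rightarrow> 0\<close>.\<close>

lemma qdim_ideal2_mult:
  assumes a: "holo_germ n a" and b: "holo_germ n b" and c: "holo_germ n c"
    and nzd: "\<And>h q. holo_germ n h \<Longrightarrow> holo_germ n q \<Longrightarrow> \<forall>\<^sub>F z in near_origin n. c z * h z = a z * q z \<Longrightarrow>
      \<exists>q'. holo_germ n q' \<and> (\<forall>\<^sub>F z in near_origin n. h z = a z * q' z)"
    and 1: "qdim n (ideal2 n a b) d1" and 2: "qdim n (ideal2 n a c) d2"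
  shows "qdim n (ideal2 n a (\<lambda>z. c z * b z)) (d2 + d1)"
proof -
  let ?J = "ideal2 n a (\<lambda>z. c z * b z)"
  obtain e where "qbasis n (ideal2 n a b) d1 e" using 1 unfolding qdim_def ..
  note e = qbasisD[OF this]
  obtain f where "qbasis n (ideal2 n a c) d2 f" using 2 unfolding qdim_def ..
  note f = qbasisD[OF this]
  \<comment> \<open>Lifts of a basis of the quotient O/(a, c), followed by \<open>c\<close> times a
    basis of O/(a, b), the subspace in the sequence.\<close>
  define B where "B i = (if i < d2 then f i else (\<lambda>z. c z * e (i - d2) z))" for i
  have sumB: "(\<Sum>i<d2+d1. \<gamma> i * B i z) = (\<Sum>i<d2. \<gamma> i * f i z) + c z * (\<Sum>i<d1. \<gamma> (d2 + i) * e i z)"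
    for \<gamma> :: "nat \<Rightarrow> complex" and z
  proof -
    have "(\<Sum>i<d2+d1. \<gamma> i * B i z) = (\<Sum>i<d2. \<gamma> i * B i z) + (\<Sum>i<d1. \<gamma> (d2 + i) * B (d2 + i) z)"
      by (induction d1) (auto simp: algebra_simps)
    also have "\<dots> = (\<Sum>i<d2. \<gamma> i * f i z) + c z * (\<Sum>i<d1. \<gamma> (d2 + i) * e i z)"
      by (simp add: B_def sum_distrib_left algebra_simps)
    finally show ?thesis .
  qed
  have ge: "holo_germ n (\<lambda>z. \<Sum>i<d1. \<gamma> i * e i z)" for \<gamma> :: "nat \<Rightarrow> complex"
    by (intro holo_germ_sum holo_germ_mult) (auto intro: e(1))
  have gf: "holo_germ n (\<lambda>z. \<Sum>i<d2. \<gamma> i * f i z)" for \<gamma> :: "nat \<Rightarrow> complex"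
    by (intro holo_germ_sum holo_germ_mult) (auto intro: f(1))
  show ?thesis
  proof (rule qdimI[of _ _ B])
    fix i assume "i < d2 + d1"
    then show "holo_germ n (B i)"
      using f(1) e(1)[of "i - d2"] c by (auto simp: B_def intro: holo_germ_mult)
  next
    fix h assume h: "holo_germ n h"
    obtain \<gamma> :: "nat \<Rightarrow> complex" where \<gamma>: "(\<lambda>z. h z - (\<Sum>i<d2. \<gamma> i * f i z)) \<in> ideal2 n a c" using f(2)[OF h] ..
    from \<gamma> obtain \<alpha> \<beta> where \<alpha>\<beta>: "holo_germ n \<alpha>" "holo_germ n \<beta>"
      "\<forall>\<^sub>F z in near_origin n. h z - (\<Sum>i<d2. \<gamma> i * f i z) = \<alpha> z * a z + \<beta> z * c z" by (rule ideal2E)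
    obtain \<delta> :: "nat \<Rightarrow> complex" where \<delta>: "(\<lambda>z. \<beta> z - (\<Sum>i<d1. \<delta> i * e i z)) \<in> ideal2 n a b" using e(2)[OF \<alpha>\<beta>(2)] ..
    from \<delta> obtain \<alpha>' \<beta>' where \<alpha>\<beta>': "holo_germ n \<alpha>'" "holo_germ n \<beta>'"
      "\<forall>\<^sub>F z in near_origin n. \<beta> z - (\<Sum>i<d1. \<delta> i * e i z) = \<alpha>' z * a z + \<beta>' z * b z" by (rule ideal2E)
    define \<eta> where "\<eta> i = (if i < d2 then \<gamma> i else \<delta> (i - d2))" for i
    have \<eta>: "(\<Sum>i<d2+d1. \<eta> i * B i z) = (\<Sum>i<d2. \<gamma> i * f i z) + c z * (\<Sum>i<d1. \<delta> i * e i z)" for z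
      unfolding sumB by (simp add: \<eta>_def)
    have "(\<lambda>z. h z - (\<Sum>i<d2+d1. \<eta> i * B i z)) \<in> ?J"
    proof (rule ideal2I[of _ _ "\<lambda>z. \<alpha> z + \<alpha>' z * c z" \<beta>'])
      show "holo_germ n (\<lambda>z. h z - (\<Sum>i<d2+d1. \<eta> i * B i z))"
        unfolding \<eta> by (intro holo_germ_diff holo_germ_add holo_germ_mult h c ge gf)
      show "\<forall>\<^sub>F z in near_origin n. h z - (\<Sum>i<d2+d1. \<eta> i * B i z) = (\<alpha> z + \<alpha>' z * c z) * a z + \<beta>' z * (c z * b z)"
        using \<alpha>\<beta>(3) \<alpha>\<beta>'(3) unfolding \<eta>
      proof eventually_elim
        fix z
        assume x: "h z - (\<Sum>i<d2. \<gamma> i * f i z) = \<alpha> z * a z + \<beta> z * c z"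
          and y: "\<beta> z - (\<Sum>i<d1. \<delta> i * e i z) = \<alpha>' z * a z + \<beta>' z * b z"
        show "h z - ((\<Sum>i<d2. \<gamma> i * f i z) + c z * (\<Sum>i<d1. \<delta> i * e i z)) =
          (\<alpha> z + \<alpha>' z * c z) * a z + \<beta>' z * (c z * b z)"
        proof -
          have "h z - ((\<Sum>i<d2. \<gamma> i * f i z) + c z * (\<Sum>i<d1. \<delta> i * e i z)) =
              (h z - (\<Sum>i<d2. \<gamma> i * f i z)) - c z * (\<Sum>i<d1. \<delta> i * e i z)" by simp
          also have "\<dots> = \<alpha> z * a z + c z * (\<beta> z - (\<Sum>i<d1. \<delta> i * e i z))"
            unfolding x by (simp add: algebra_simps)
          also have "\<dots> = (\<alpha> z + \<alpha>' z * c z) * a z + \<beta>' z * (c z * b z)"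
            unfolding y by (simp add: algebra_simps)
          finally show ?thesis .
        qed
      qed
    qed (intro holo_germ_add holo_germ_mult \<alpha>\<beta> \<alpha>\<beta>' c)+
    then show "\<exists>\<eta>::nat \<Rightarrow> complex. (\<lambda>z. h z - (\<Sum>i<d2+d1. \<eta> i * B i z)) \<in> ?J"
      by (rule exI[of _ \<eta>])
  next
    fix \<gamma> :: "nat \<Rightarrow> complex" assume "(\<lambda>z. \<Sum>i<d2+d1. \<gamma> i * B i z) \<in> ?J"
    then obtain \<alpha> \<beta> where \<alpha>\<beta>: "holo_germ n \<alpha>" "holo_germ n \<beta>"
      "\<forall>\<^sub>F z in near_origin n. (\<Sum>i<d2+d1. \<gamma> i * B i z) = \<alpha> z * a z + \<beta> z * (c z * b z)"
      by (rule ideal2E)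
    let ?e = "\<lambda>z. \<Sum>i<d1. \<gamma> (d2 + i) * e i z"
    have "(\<lambda>z. \<Sum>i<d2. \<gamma> i * f i z) \<in> ideal2 n a c"
      by (rule ideal2I[OF gf \<alpha>\<beta>(1), of "\<lambda>z. \<beta> z * b z - ?e z"])
        (intro holo_germ_diff holo_germ_mult \<alpha>\<beta> b ge, use \<alpha>\<beta>(3)[unfolded sumB] in \<open>eventually_elim, simp add: algebra_simps\<close>)
    then have f0: "\<forall>i<d2. \<gamma> i = 0" by (rule f(3))
    then have s0: "(\<Sum>i<d2+d1. \<gamma> i * B i z) = c z * ?e z" for z by (simp add: sumB)
    \<comment> \<open>Injectivity of multiplication by \<open>c\<close>: with the first block of
      coefficients gone, the relation is a multiple of \<open>c\<close> modulo \<open>a\<close>, and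
      \<open>nzd\<close> cancels \<open>c\<close>.\<close>
    have "\<exists>q'. holo_germ n q' \<and> (\<forall>\<^sub>F z in near_origin n. ?e z - \<beta> z * b z = a z * q' z)"
    proof (rule nzd[of _ \<alpha>])
      show "\<forall>\<^sub>F z in near_origin n. c z * (?e z - \<beta> z * b z) = a z * \<alpha> z"
        using \<alpha>\<beta>(3) unfolding s0 by eventually_elim (simp add: algebra_simps)
    qed (intro holo_germ_diff holo_germ_mult \<alpha>\<beta> b ge)+
    then obtain q where q: "holo_germ n q" "\<forall>\<^sub>F z in near_origin n. ?e z - \<beta> z * b z = a z * q z" by blast
    have "(\<lambda>z. ?e z) \<in> ideal2 n a b"
      by (rule ideal2I[OF ge q(1) \<alpha>\<beta>(2)]) (use q(2) in eventually_elim, simp add: algebra_simps)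
    then have "\<forall>i<d1. \<gamma> (d2 + i) = 0" by (rule e(3))
    note e0 = this
    have "\<gamma> i = 0" if "i < d2 + d1" for i
      using f0 e0[rule_format, of "i - d2"] that by (cases "i < d2") auto
    then show "\<forall>i<d2+d1. \<gamma> i = 0" by blast
  qed
qed

text \<open>Agrees with \<open>z(i := 0)\<close> on \<open>cspace n\<close>. It is written as a
  \<open>tuple\<close> so that composition of germs and transport of eventual statements apply to
  it.\<close>

definition kill :: "nat \<Rightarrow> nat \<Rightarrow> (nat \<Rightarrow> complex) \<Rightarrow> nat \<Rightarrow> complex" where
  "kill n i z = tuple n (\<lambda>j z. if j = i then 0 else z j) z"

lemma map_germ_kill: "map_germ n n (\<lambda>j z. if j = i then 0 else z j)"
  by (simp add: map_germ_def)

lemma kill_eq: "z \<in> cspace n \<Longrightarrow> kill n i z = z(i := 0)"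
  by (auto simp: kill_def tuple_def cspace_def fun_eq_iff)

lemma kill_apply: "kill n i z j = (if j < n \<and> j \<noteq> i then z j else 0)"
  by (auto simp: kill_def tuple_def)

lemma coord_division:
  assumes f: "holo_germ n f" and i: "i < n"
  obtains Q where "holo_germ n Q" "\<forall>\<^sub>F z in near_origin n. f z = f (kill n i z) + z i * Q z"
proof -
  obtain Q where Q: "holo_germ n Q"
    "\<forall>\<^sub>F z in near_origin n. f (z(i := z i)) - f (z(i := 0)) = (z i - 0) * Q z"
    by (rule holo_germ_diff_quotient[OF f i, of "\<lambda>z. z i" "\<lambda>_. 0"]) auto
  have "\<forall>\<^sub>F z in near_origin n. f z = f (kill n i z) + z i * Q z"
    using Q(2) eventually_in_cspace by eventually_elim (simp add: kill_eq algebra_simps)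
  with Q(1) show ?thesis by (rule that)
qed

text \<open>On the hyperplane \<open>z i = 0\<close> the equation says that a unit times a power of
  \<open>z j\<close> annihilates \<open>q\<close>. So \<open>q\<close> vanishes there, is divisible
  by \<open>z i\<close>, and cancelling \<open>z i\<close> leaves the claim: \<open>z i\<close> is a
  nonzerodivisor modulo \<open>a\<close>.\<close>

lemma coord_nzd:
  assumes a: "holo_germ n a" and u: "holo_germ n u" "u origin \<noteq> 0" and i: "i < n" and j: "j < n"
    and ak: "\<forall>\<^sub>F z in near_origin n. a (kill n i z) = z j ^ m * u z"
    and h: "holo_germ n h" and q: "holo_germ n q" and eq: "\<forall>\<^sub>F z in near_origin n. z i * h z = a z * q z"
  shows "\<exists>q'. holo_germ n q' \<and> (\<forall>\<^sub>F z in near_origin n. h z = a z * q' z)"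
proof -
  have "\<forall>\<^sub>F z in near_origin n. z j ^ m * q (kill n i z) = 0"
    using eventually_tuple[OF map_germ_kill eq, of i, folded kill_def] ak holo_germ_eventually_nonzero[OF u]
    by eventually_elim (simp add: kill_apply)
  with holo_germ_comp[OF q map_germ_kill, folded kill_def] j
  have q0: "\<forall>\<^sub>F z in near_origin n. q (kill n i z) = 0"
    by (rule coord_power_cancel)
  obtain Q where Q: "holo_germ n Q" "\<forall>\<^sub>F z in near_origin n. q z = q (kill n i z) + z i * Q z"
    by (rule coord_division[OF q i])
  have "\<forall>\<^sub>F z in near_origin n. z i * (h z - a z * Q z) = 0"
    using q0 Q(2) eq by eventually_elim (simp add: algebra_simps)
  then have "\<forall>\<^sub>F z in near_origin n. h z - a z * Q z = 0"
    by (rule coord_cancel[OF holo_germ_diff[OF h holo_germ_mult[OF a Q(1)]] i])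
  then have "\<forall>\<^sub>F z in near_origin n. h z = a z * Q z" by eventually_elim simp
  with Q(1) show ?thesis by blast
qed

lemma qdim_unit_ideal: "qdim n (ideal2 n a (\<lambda>_. 1)) 0"
  by (rule qdimI[of _ _ "\<lambda>_ _. 0"])
    (auto intro!: ideal2I[of _ _ "\<lambda>_. 0"])

lemma origin_2I: "z \<in> cspace 2 \<Longrightarrow> {i, j} = {0, Suc 0} \<Longrightarrow> kill 2 i (kill 2 j z) = origin"
  by (auto simp: kill_apply fun_eq_iff less_2_cases_iff doubleton_eq_iff)

text \<open>Dividing by one coordinate and then by the other leaves only the constant
  \<open>h origin\<close>. The hypothesis on \<open>{i, j}\<close> admits both orders of the
  coordinates.\<close>

lemma qdim_maximal_ideal:
  assumes ij: "{i, j} = {0, Suc 0}"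
  shows "qdim 2 (ideal2 2 (\<lambda>z. z i) (\<lambda>z. z j)) 1"
proof (rule qdimI[of _ _ "\<lambda>_ _. 1"])
  have i2: "i < 2" "j < 2" using ij by (auto simp: doubleton_eq_iff)
  fix h assume h: "holo_germ 2 h"
  obtain Q where Q: "holo_germ 2 Q" "\<forall>\<^sub>F z in near_origin 2. h z = h (kill 2 i z) + z i * Q z"
    by (rule coord_division[OF h i2(1)])
  have hk: "holo_germ 2 (\<lambda>z. h (kill 2 i z))"
    unfolding kill_def by (rule holo_germ_comp[OF h map_germ_kill])
  obtain R where R: "holo_germ 2 R" "\<forall>\<^sub>F z in near_origin 2. h (kill 2 i z) = h (kill 2 i (kill 2 j z)) + z j * R z"
    by (rule coord_division[OF hk i2(2)])
  have "(\<lambda>z. h z - h origin) \<in> ideal2 2 (\<lambda>z. z i) (\<lambda>z. z j)"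
    by (rule ideal2I[OF _ Q(1) R(1)], intro holo_germ_diff h holo_germ_const,
        use Q(2) R(2) eventually_in_cspace in eventually_elim, simp add: origin_2I[OF _ ij])
  then show "\<exists>c::nat \<Rightarrow> complex. (\<lambda>z. h z - (\<Sum>i<1. c i * 1)) \<in> ideal2 2 (\<lambda>z. z i) (\<lambda>z. z j)"
    by (intro exI[of _ "\<lambda>_. h origin"]) simp
next
  fix c :: "nat \<Rightarrow> complex" assume "(\<lambda>z. \<Sum>i<1. c i * 1) \<in> ideal2 2 (\<lambda>z. z i) (\<lambda>z. z j)"
  then obtain \<alpha> \<beta> where "\<forall>\<^sub>F z in near_origin 2. c 0 = \<alpha> z * z i + \<beta> z * z j"
    by (elim ideal2E) auto
  from eventually_near_originD[OF this] show "\<forall>i<1. c i = 0" by simp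
qed auto

lemma qdim_coord_power:
  assumes ij: "{i, j} = {0, Suc 0}"
  shows "qdim 2 (ideal2 2 (\<lambda>z. z i) (\<lambda>z. z j ^ m)) m"
proof (induction m)
  case (Suc m)
  have i2: "i < 2" "j < 2" "i \<noteq> j" using ij by (auto simp: doubleton_eq_iff)
  have "qdim 2 (ideal2 2 (\<lambda>z. z i) (\<lambda>z. z j * z j ^ m)) (1 + m)"
  proof (rule qdim_ideal2_mult[OF _ _ _ _ Suc.IH qdim_maximal_ideal[OF ij]])
    fix h q :: "(nat \<Rightarrow> complex) \<Rightarrow> complex"
    assume *: "holo_germ 2 h" "holo_germ 2 q" "\<forall>\<^sub>F z in near_origin 2. z j * h z = z i * q z"
    show "\<exists>q'. holo_germ 2 q' \<and> (\<forall>\<^sub>F z in near_origin 2. h z = z i * q' z)"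
      by (rule coord_nzd[OF _ _ _ i2(2,1) _ *, of "\<lambda>_. 1" 1])
        (use i2 in \<open>auto simp: kill_apply\<close>)
  qed (auto intro: holo_germ_power)
  then show ?case by simp
qed (use qdim_unit_ideal in simp)

text \<open>The number \<open>m\<close> is the intersection multiplicity of \<open>a\<close> with
  the line \<open>z i = 0\<close>: since \<open>a\<close> restricts there to a unit times
  \<open>z j ^ m\<close>, the ideal of \<open>a\<close> and \<open>z i\<close> is that of
  \<open>z i\<close> and \<open>z j ^ m\<close>. Both Milnor numbers below are counted by peeling
  off coordinate factors with this rule.\<close>

lemma qdim_mult_coord:
  assumes ij: "{i, j} = {0, Suc 0}" and a: "holo_germ 2 a" and b: "holo_germ 2 b"
    and u: "holo_germ 2 u" "u origin \<noteq> 0"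
    and ak: "\<forall>\<^sub>F z in near_origin 2. a (kill 2 i z) = z j ^ m * u z"
    and 1: "qdim 2 (ideal2 2 a b) d"
  shows "qdim 2 (ideal2 2 a (\<lambda>z. z i * b z)) (m + d)"
proof (rule qdim_ideal2_mult[OF a b holo_germ_coord _ 1])
  have i2: "i < 2" "j < 2" using ij by (auto simp: doubleton_eq_iff)
  show "\<exists>q'. holo_germ 2 q' \<and> (\<forall>\<^sub>F z in near_origin 2. h z = a z * q' z)"
    if "holo_germ 2 h" "holo_germ 2 q" "\<forall>\<^sub>F z in near_origin 2. z i * h z = a z * q z" for h q
    by (rule coord_nzd[OF a u i2 ak that])
  obtain Q where Q: "holo_germ 2 Q" "\<forall>\<^sub>F z in near_origin 2. a z = a (kill 2 i z) + z i * Q z"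
    by (rule coord_division[OF a i2(1)])
  have "ideal2 2 a (\<lambda>z. z i) = ideal2 2 (\<lambda>z. z i) (\<lambda>z. z j ^ m)"
  proof (rule ideal2_eqI)
    show "a \<in> ideal2 2 (\<lambda>z. z i) (\<lambda>z. z j ^ m)"
      by (rule ideal2I[OF a Q(1) u(1)]) (use Q(2) ak in eventually_elim, simp add: algebra_simps)
    show "(\<lambda>z. z j ^ m) \<in> ideal2 2 a (\<lambda>z. z i)"
    proof (rule ideal2I[of _ _ "\<lambda>z. 1 / u z" "\<lambda>z. - Q z / u z"])
      show "\<forall>\<^sub>F z in near_origin 2. z j ^ m = 1 / u z * a z + - Q z / u z * z i"
        using Q(2) ak holo_germ_eventually_nonzero[OF u] by eventually_elim (simp add: field_simps)
    qed (auto intro!: holo_germ_power holo_germ_divide holo_germ_uminus u Q)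
  qed (rule ideal2_gen a holo_germ_coord holo_germ_power)+
  then show "qdim 2 (ideal2 2 a (\<lambda>z. z i)) m"
    using qdim_coord_power[OF ij] by simp
qed

section \<open>The deformation in two variables\<close>


lemmas holo_germ_intros = holo_germ_add holo_germ_diff holo_germ_mult holo_germ_uminus
  holo_germ_power holo_germ_coord holo_germ_const

text \<open>The deformation of the corollary in two variables. For \<open>s \<noteq> 0\<close>, in the coordinates
  \<open>u = y\<^sup>2 + s x\<close> and \<open>y\<close>, it has the leading part \<open>u\<^sup>3 + y\<^sup>8 / s\<^sup>4\<close> of the class \<open>E\<^sub>1\<^sub>4\<close>.\<close>

definition deform :: "complex \<Rightarrow> complex \<Rightarrow> (nat \<Rightarrow> complex) \<Rightarrow> complex" where
  "deform b s z = z 0 ^ 4 + ((z 1)\<^sup>2 + s * z 0) ^ 3 + b * (z 0)\<^sup>2 * ((z 1)\<^sup>2 + s * z 0)\<^sup>2"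

lemma partial_deriv_deform_0:
  "partial_deriv 0 (deform b s) z =
     4 * z 0 ^ 3 + 2 * b * z 0 * ((z 1)\<^sup>2 + s * z 0)\<^sup>2
     + s * (3 * ((z 1)\<^sup>2 + s * z 0)\<^sup>2 + 2 * b * (z 0)\<^sup>2 * ((z 1)\<^sup>2 + s * z 0))"
  unfolding partial_deriv_def deform_def
  by (rule DERIV_imp_deriv) (auto intro!: derivative_eq_intros simp: algebra_simps power2_eq_square power3_eq_cube)

lemma partial_deriv_deform_1:
  "partial_deriv 1 (deform b s) z =
     2 * z 1 * (3 * ((z 1)\<^sup>2 + s * z 0)\<^sup>2 + 2 * b * (z 0)\<^sup>2 * ((z 1)\<^sup>2 + s * z 0))"
  unfolding partial_deriv_def deform_def
  by (rule DERIV_imp_deriv) (auto intro!: derivative_eq_intros simp: algebra_simps power2_eq_square power3_eq_cube)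

text \<open>Up to constants the partial derivatives are x w and y^3 v. Each factor y costs 3, as x w
  is x^3 on y = 0; the factor x costs 2, as v is y^2 on x = 0; and (v, w) = (y^2, x^2) has
  codimension 4. In total 3 * 3 + 2 + 4 = 15.\<close>

lemma qdim_deform_0: "qdim 2 (jac_ideal 2 (deform b 0)) 15"
proof -
  define \<beta> c where "\<beta> = b / 2" and "c = 2 * b / 3"
  define v :: "(nat \<Rightarrow> complex) \<Rightarrow> complex" where "v = (\<lambda>z. (z 1)\<^sup>2 + c * (z 0)\<^sup>2)"
  define w :: "(nat \<Rightarrow> complex) \<Rightarrow> complex" where "w = (\<lambda>z. (z 0)\<^sup>2 + \<beta> * z 1 ^ 4)"
  have g: "holo_germ 2 v" "holo_germ 2 w" unfolding v_def w_def by (intro holo_germ_intros)+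
  \<comment> \<open>The square is nested and ends in 1, so that each factor x can be peeled off
    until the unit ideal, of codimension 0, remains.\<close>
  have x0: "qdim 2 (ideal2 2 (\<lambda>z. (z 1)\<^sup>2) (\<lambda>z. z 0 * (z 0 * 1))) (2 + (2 + 0))"
    by (intro qdim_mult_coord[of 0 1 _ _ "\<lambda>_. 1"] qdim_unit_ideal)
      (auto intro!: holo_germ_intros simp: kill_apply)
  have "ideal2 2 v w = ideal2 2 (\<lambda>z. (z 1)\<^sup>2) (\<lambda>z. z 0 * (z 0 * 1))"
  proof (rule ideal2_eqI)
    show "v \<in> ideal2 2 (\<lambda>z. (z 1)\<^sup>2) (\<lambda>z. z 0 * (z 0 * 1))"
      by (rule ideal2I[OF g(1), of "\<lambda>_. 1" "\<lambda>_. c"]) (auto simp: v_def power2_eq_square)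
    show "w \<in> ideal2 2 (\<lambda>z. (z 1)\<^sup>2) (\<lambda>z. z 0 * (z 0 * 1))"
      by (rule ideal2I[OF g(2), of "\<lambda>z. \<beta> * (z 1)\<^sup>2" "\<lambda>_. 1"])
        (auto simp: w_def power2_eq_square power4_eq_xxxx intro!: holo_germ_intros)
    \<comment> \<open>Modulo \<open>v\<close> one may replace y^2 by -c x^2, which turns
      \<open>w\<close> into x^2 times this unit.\<close>
    define U :: "(nat \<Rightarrow> complex) \<Rightarrow> complex" where "U = (\<lambda>z. 1 + \<beta> * c\<^sup>2 * (z 0)\<^sup>2)"
    have U: "holo_germ 2 U" "U origin \<noteq> 0" unfolding U_def by (intro holo_germ_intros) simp
    have x2: "\<forall>\<^sub>F z in near_origin 2. (z 0)\<^sup>2 = (- \<beta> * ((z 1)\<^sup>2 - c * (z 0)\<^sup>2) / U z) * v z + 1 / U z * w z"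
      using holo_germ_eventually_nonzero[OF U]
    proof eventually_elim
      fix z assume nz: "U z \<noteq> 0"
      have "(z 0)\<^sup>2 * U z = - \<beta> * ((z 1)\<^sup>2 - c * (z 0)\<^sup>2) * v z + w z"
        unfolding U_def v_def w_def by (simp add: algebra_simps power2_eq_square power4_eq_xxxx)
      then show "(z 0)\<^sup>2 = (- \<beta> * ((z 1)\<^sup>2 - c * (z 0)\<^sup>2) / U z) * v z + 1 / U z * w z"
        using nz by (simp add: field_simps)
    qed
    have g2: "holo_germ 2 (\<lambda>z. - \<beta> * ((z 1)\<^sup>2 - c * (z 0)\<^sup>2) / U z)" "holo_germ 2 (\<lambda>z. 1 / U z)"
      by (intro holo_germ_divide U holo_germ_intros)+
    have "(\<lambda>z. (z 0)\<^sup>2) \<in> ideal2 2 v w"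
      by (rule ideal2I[OF _ g2 x2]) (intro holo_germ_intros)
    note xin = this
    show "(\<lambda>z. z 0 * (z 0 * 1)) \<in> ideal2 2 v w"
      using xin by (simp add: power2_eq_square)
    have "(\<lambda>z. v z - c * (z 0)\<^sup>2) \<in> ideal2 2 v w"
      by (intro germ_ideal_diff[OF germ_ideal_ideal2] ideal2_gen g germ_idealD(4)[OF germ_ideal_ideal2] xin holo_germ_const)
    then show "(\<lambda>z. (z 1)\<^sup>2) \<in> ideal2 2 v w" by (simp add: v_def)
  qed
  with x0 have "qdim 2 (ideal2 2 v w) 4" by simp
  then have "qdim 2 (ideal2 2 v (\<lambda>z. z 0 * w z)) (2 + 4)"
    by (intro qdim_mult_coord[of 0 1 _ _ "\<lambda>_. 1"] g) (auto simp: kill_apply v_def)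
  \<comment> \<open>Swapped, so that x w becomes the fixed generator and factors y can be put onto
    \<open>v\<close>.\<close>
  then have "qdim 2 (ideal2 2 (\<lambda>z. z 0 * w z) v) 6"
    by (subst ideal2_commute) (auto intro!: g holo_germ_intros)
  then have x3: "qdim 2 (ideal2 2 (\<lambda>z. z 0 * w z) (\<lambda>z. z 1 * (z 1 * (z 1 * v z)))) (3 + (3 + (3 + 6)))"
    by (intro qdim_mult_coord[of 1 0 _ _ "\<lambda>_. 1"] holo_germ_intros g)
      (auto simp: kill_apply w_def power2_eq_square power3_eq_cube)
  have "jac_ideal 2 (deform b 0) = ideal2 2 (\<lambda>z. z 0 * w z) (\<lambda>z. z 1 * (z 1 * (z 1 * v z)))" (is "_ = ideal2 2 ?p ?q")
    unfolding jac_ideal_2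
  proof (rule ideal2_eqI)
    have p: "partial_deriv 0 (deform b 0) = (\<lambda>z. 4 * ?p z)"
      by (rule ext, subst partial_deriv_deform_0)
        (simp add: w_def \<beta>_def algebra_simps power2_eq_square power3_eq_cube power4_eq_xxxx)
    have q: "partial_deriv 1 (deform b 0) = (\<lambda>z. 6 * ?q z)"
      by (rule ext, subst partial_deriv_deform_1)
        (simp add: v_def c_def algebra_simps power2_eq_square power3_eq_cube power4_eq_xxxx)
    have gp: "holo_germ 2 ?p" "holo_germ 2 ?q" by (intro holo_germ_intros g)+
    show "partial_deriv 0 (deform b 0) \<in> ideal2 2 ?p ?q" "partial_deriv 1 (deform b 0) \<in> ideal2 2 ?p ?q"
      unfolding p q by (intro germ_idealD(4)[OF germ_ideal_ideal2] ideal2_gen gp holo_germ_const)+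
    have gp': "holo_germ 2 (\<lambda>z. 4 * ?p z)" "holo_germ 2 (\<lambda>z. 6 * ?q z)" by (intro holo_germ_intros g)+
    show "?p \<in> ideal2 2 (partial_deriv 0 (deform b 0)) (partial_deriv 1 (deform b 0))"
      unfolding p q
      using germ_idealD(4)[OF germ_ideal_ideal2 holo_germ_const[of _ "1/4"] ideal2_gen(1)[OF gp']] by simp
    show "?q \<in> ideal2 2 (partial_deriv 0 (deform b 0)) (partial_deriv 1 (deform b 0))"
      unfolding p q
      using germ_idealD(4)[OF germ_ideal_ideal2 holo_germ_const[of _ "1/6"] ideal2_gen(2)[OF gp']] by simp
  qed
  with x3 show ?thesis by simp
qed

text \<open>The ideal turns out to be (W, V) with V = y x^3. The factor y costs 2, the order of
  \<open>W\<close> on y = 0, and each factor x costs 4, the order of \<open>W\<close> on x = 0;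
  hence 2 + 3 * 4 = 14.\<close>

lemma qdim_deform_nonzero:
  assumes s: "s \<noteq> 0"
  shows "qdim 2 (jac_ideal 2 (deform b s)) 14"
proof -
  define T :: "(nat \<Rightarrow> complex) \<Rightarrow> complex" where "T = (\<lambda>z. (z 1)\<^sup>2 + s * z 0)"
  define P Q W where "P = (\<lambda>z. 4 * z 0 ^ 3 + 2 * b * z 0 * (T z)\<^sup>2)"
    and "Q = (\<lambda>z. 3 * (T z)\<^sup>2 + 2 * b * (z 0)\<^sup>2 * T z)" and "W = (\<lambda>z. P z + s * Q z)"
  define V where "V = (\<lambda>z::nat \<Rightarrow> complex. z 1 * (z 0 * (z 0 * (z 0 * 1))))"
  have gT: "holo_germ 2 T" unfolding T_def by (intro holo_germ_intros)
  have gPQ: "holo_germ 2 P" "holo_germ 2 Q" unfolding P_def Q_def by (intro holo_germ_intros gT)+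
  have gW: "holo_germ 2 W" unfolding W_def by (intro holo_germ_intros gPQ)
  have gV: "holo_germ 2 V" unfolding V_def by (intro holo_germ_intros)
  have W0: "\<forall>\<^sub>F z in near_origin 2. W (kill 2 0 z) = z 1 ^ 4 * (3 * s)"
    by (auto simp: W_def P_def Q_def T_def kill_apply power2_eq_square power4_eq_xxxx)
  have W1: "\<forall>\<^sub>F z in near_origin 2. W (kill 2 1 z) = z 0 ^ 2 * (3 * s ^ 3 + (4 + 4 * b * s\<^sup>2) * z 0)"
    by (auto simp: W_def P_def Q_def T_def kill_apply power2_eq_square power3_eq_cube algebra_simps)
  have "qdim 2 (ideal2 2 W (\<lambda>z. z 0 * (z 0 * (z 0 * 1)))) (4 + (4 + (4 + 0)))"
    by (intro qdim_mult_coord[OF _ gW _ _ _ W0] qdim_unit_ideal holo_germ_intros)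
      (use s in auto)
  then have "qdim 2 (ideal2 2 W V) (2 + (4 + (4 + (4 + 0))))"
    unfolding V_def
    by (intro qdim_mult_coord[OF _ gW _ _ _ W1] holo_germ_intros) (use s in auto)
  moreover have "jac_ideal 2 (deform b s) = ideal2 2 W V"
    unfolding jac_ideal_2
  proof (rule ideal2_eqI)
    have p: "partial_deriv 0 (deform b s) = W"
      by (rule ext, subst partial_deriv_deform_0) (simp add: W_def P_def Q_def T_def)
    have q: "partial_deriv 1 (deform b s) = (\<lambda>z. 2 * z 1 * Q z)"
      by (rule ext, subst partial_deriv_deform_1) (simp add: Q_def T_def)
    have gq: "holo_germ 2 (\<lambda>z. 2 * z 1 * Q z)" by (intro holo_germ_intros gPQ)
    \<comment> \<open>The combination 3 P - 2 b x Q eliminates T^2 and equals 4 x^3 (3 - b^2 T).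
      With s Q = W - P this becomes A P = 2 b x W + B x^3, where \<open>A\<close> and
      \<open>B\<close> are units because \<open>s\<close> is nonzero. Modulo \<open>W\<close> the
      generator y Q may therefore be traded for \<open>V\<close>.\<close>
    define A B :: "(nat \<Rightarrow> complex) \<Rightarrow> complex" where "A = (\<lambda>z. 3 * s + 2 * b * z 0)"
      and "B = (\<lambda>z. 4 * s * (3 - b\<^sup>2 * T z))"
    have gAB: "holo_germ 2 A" "holo_germ 2 B" unfolding A_def B_def by (intro holo_germ_intros gT)+
    have AB0: "A origin \<noteq> 0" "B origin \<noteq> 0" using s by (auto simp: A_def B_def T_def)
    have key: "A z * (z 1 * P z) = 2 * b * z 0 * z 1 * W z + B z * V z" for z
      unfolding A_def B_def W_def P_def Q_def V_def
      by (simp add: algebra_simps power2_eq_square power3_eq_cube)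
    show "partial_deriv 0 (deform b s) \<in> ideal2 2 W V"
      unfolding p by (rule ideal2_gen[OF gW gV])
    show "partial_deriv 1 (deform b s) \<in> ideal2 2 W V"
      unfolding q
    proof (rule ideal2I[OF gq])
      show "holo_germ 2 (\<lambda>z. 2 * z 1 / s * (1 - 2 * b * z 0 / A z))"
        by (intro holo_germ_intros holo_germ_divide gAB AB0) (use s in auto)
      show "holo_germ 2 (\<lambda>z. - 2 / s * B z / A z)"
        by (intro holo_germ_intros holo_germ_divide gAB AB0) (use s in auto)
      show "\<forall>\<^sub>F z in near_origin 2. 2 * z 1 * Q z = 2 * z 1 / s * (1 - 2 * b * z 0 / A z) * W z + - 2 / s * B z / A z * V z"
        using holo_germ_eventually_nonzero[OF gAB(1) AB0(1)]
      proof eventually_elim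
        fix z assume nz: "A z \<noteq> 0"
        have "s * A z * (2 * z 1 * Q z) = 2 * A z * z 1 * W z - 2 * (A z * (z 1 * P z))"
          unfolding W_def by (simp add: algebra_simps)
        also have "\<dots> = 2 * z 1 * (A z - 2 * b * z 0) * W z - 2 * B z * V z"
          unfolding key by (simp add: algebra_simps)
        finally have eq: "s * A z * (2 * z 1 * Q z) = 2 * z 1 * (A z - 2 * b * z 0) * W z - 2 * B z * V z" .
        have "2 * z 1 * Q z = (s * A z * (2 * z 1 * Q z)) / (s * A z)" using nz s by simp
        also have "\<dots> = 2 * z 1 / s * (1 - 2 * b * z 0 / A z) * W z + - 2 / s * B z / A z * V z"
          unfolding eq using nz s by (simp add: field_simps)
        finally show "2 * z 1 * Q z = 2 * z 1 / s * (1 - 2 * b * z 0 / A z) * W z + - 2 / s * B z / A z * V z" .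
      qed
    qed
    show "W \<in> ideal2 2 (partial_deriv 0 (deform b s)) (partial_deriv 1 (deform b s))"
      unfolding p q by (rule ideal2_gen[OF gW gq])
    show "V \<in> ideal2 2 (partial_deriv 0 (deform b s)) (partial_deriv 1 (deform b s))"
      unfolding p q
    proof (rule ideal2I[OF gV])
      show "holo_germ 2 (\<lambda>z. (A z * z 1 - 2 * b * z 0 * z 1) / B z)" "holo_germ 2 (\<lambda>z. - s * A z / 2 / B z)"
        by (intro holo_germ_divide holo_germ_intros gAB AB0; simp)+
      show "\<forall>\<^sub>F z in near_origin 2. V z = (A z * z 1 - 2 * b * z 0 * z 1) / B z * W z + - s * A z / 2 / B z * (2 * z 1 * Q z)"
        using holo_germ_eventually_nonzero[OF gAB(2) AB0(2)]
      proof eventually_elim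
        fix z assume nz: "B z \<noteq> 0"
        have "B z * V z = A z * (z 1 * P z) - 2 * b * z 0 * z 1 * W z"
          unfolding key by simp
        also have "A z * (z 1 * P z) = A z * z 1 * W z - s * A z * z 1 * Q z"
          unfolding W_def by (simp add: algebra_simps)
        finally have eq: "B z * V z = (A z * z 1 - 2 * b * z 0 * z 1) * W z - s * A z * z 1 * Q z"
          by (simp add: algebra_simps)
        have "V z = (B z * V z) / B z" using nz by simp
        also have "\<dots> = (A z * z 1 - 2 * b * z 0 * z 1) / B z * W z + - s * A z / 2 / B z * (2 * z 1 * Q z)"
          unfolding eq using nz by (simp add: field_simps)
        finally show "V z = (A z * z 1 - 2 * b * z 0 * z 1) / B z * W z + - s * A z / 2 / B z * (2 * z 1 * Q z)" .
      qed
    qed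
  qed
  ultimately show ?thesis by simp
qed

section \<open>Finite codimension forces an isolated critical point\<close>

lemma linear_dependence:
  fixes v :: "nat \<Rightarrow> nat \<Rightarrow> complex"
  shows "\<exists>a. (\<exists>j\<le>d. a j \<noteq> 0) \<and> (\<forall>l<d. (\<Sum>j\<le>d. a j * v j l) = 0)"
proof (induction d arbitrary: v)
  case 0
  show ?case by (rule exI[of _ "\<lambda>_. 1"]) simp
next
  case (Suc d)
  show ?case
  proof (cases "v (Suc d) d = 0")
    case True
    show ?thesis
    proof (cases "\<forall>j\<le>d. v j d = 0")
      case all: True
      obtain a where a: "\<exists>j\<le>d. a j \<noteq> 0" "\<forall>l<d. (\<Sum>j\<le>d. a j * v j l) = 0" using Suc.IH[of v] by blast
      have "\<forall>l<Suc d. (\<Sum>j\<le>Suc d. (a(Suc d := 0)) j * v j l) = 0"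
        using a(2) all by (auto simp: less_Suc_eq)
      moreover obtain j where "j \<le> d" "a j \<noteq> 0" using a(1) by blast
      then have "\<exists>j\<le>Suc d. (a(Suc d := 0)) j \<noteq> 0" by (intro exI[of _ j]) simp
      ultimately show ?thesis by blast
    next
      case False
      then obtain m where m: "m \<le> d" "v m d \<noteq> 0" by blast
      \<comment> \<open>Gaussian elimination of the last coordinate with pivot \<open>v m\<close>.
        The slot of the pivot is given to \<open>v (Suc d)\<close>, whose last coordinate is already
        0, so that \<open>d + 1\<close> vectors with \<open>d\<close> relevant coordinates
        remain.\<close>
      define v' where "v' j = (if j = m then v (Suc d) else (\<lambda>l. v j l - v j d / v m d * v m l))" for j
      obtain a where a: "\<exists>j\<le>d. a j \<noteq> 0" "\<forall>l<d. (\<Sum>j\<le>d. a j * v' j l) = 0" using Suc.IH[of v'] by blast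
      define a' where "a' j = (if j = Suc d then a m else if j = m then - (\<Sum>j\<in>{..d}-{m}. a j * (v j d / v m d)) else a j)" for j
      have sum: "(\<Sum>j\<le>Suc d. a' j * v j l) = (\<Sum>j\<in>{..d}-{m}. a j * (v j l - v j d / v m d * v m l)) + a m * v (Suc d) l" for l
      proof -
        have "(\<Sum>j\<le>Suc d. a' j * v j l) = a' (Suc d) * v (Suc d) l + (a' m * v m l + (\<Sum>j\<in>{..d}-{m}. a' j * v j l))"
          using m by (simp add: sum.remove[of "{..d}" m])
        also have "(\<Sum>j\<in>{..d}-{m}. a' j * v j l) = (\<Sum>j\<in>{..d}-{m}. a j * v j l)"
          by (intro sum.cong) (auto simp: a'_def)
        finally show ?thesis using m
          by (simp add: a'_def algebra_simps sum_subtractf sum_distrib_right sum_distrib_left)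
      qed
      have "(\<Sum>j\<le>Suc d. a' j * v j l) = 0" if "l < Suc d" for l
      proof (cases "l = d")
        case l: True
        show ?thesis unfolding sum l using m True by simp
      next
        case False
        then have "l < d" using that by simp
        then have "0 = (\<Sum>j\<le>d. a j * v' j l)" using a(2) by simp
        also have "\<dots> = a m * v (Suc d) l + (\<Sum>j\<in>{..d}-{m}. a j * v' j l)"
          using m by (simp add: sum.remove[of "{..d}" m] v'_def)
        also have "(\<Sum>j\<in>{..d}-{m}. a j * v' j l) = (\<Sum>j\<in>{..d}-{m}. a j * (v j l - v j d / v m d * v m l))"
          by (intro sum.cong) (auto simp: v'_def)
        finally show ?thesis unfolding sum by (simp only: add.commute)
      qed
      moreover have "\<exists>j\<le>Suc d. a' j \<noteq> 0"
      proof -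
        obtain j where j: "j \<le> d" "a j \<noteq> 0" using a(1) by blast
        show ?thesis
        proof (cases "j = m")
          case True then show ?thesis using j by (intro exI[of _ "Suc d"]) (auto simp: a'_def)
        next
          case False then show ?thesis using j by (intro exI[of _ j]) (auto simp: a'_def)
        qed
      qed
      ultimately show ?thesis by blast
    qed
  next
    case False
    define v' where "v' j l = v j l - v j d / v (Suc d) d * v (Suc d) l" for j l
    obtain a where a: "\<exists>j\<le>d. a j \<noteq> 0" "\<forall>l<d. (\<Sum>j\<le>d. a j * v' j l) = 0" using Suc.IH[of v'] by blast
    define a' where "a' = a(Suc d := - (\<Sum>j\<le>d. a j * (v j d / v (Suc d) d)))"
    have sum: "(\<Sum>j\<le>Suc d. a' j * v j l) = (\<Sum>j\<le>d. a j * v' j l)" for l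
      by (simp add: a'_def v'_def algebra_simps sum_subtractf sum_distrib_right sum_distrib_left)
    have "(\<Sum>j\<le>Suc d. a' j * v j l) = 0" if "l < Suc d" for l
    proof (cases "l = d")
      case True
      show ?thesis unfolding sum True using False by (simp add: v'_def)
    next
      case False
      then show ?thesis unfolding sum using a(2) that by simp
    qed
    moreover obtain j where "j \<le> d" "a j \<noteq> 0" using a(1) by blast
    then have "\<exists>j\<le>Suc d. a' j \<noteq> 0" by (intro exI[of _ j]) (simp add: a'_def)
    ultimately show ?thesis by blast
  qed
qed

text \<open>Finitely many powers of a coordinate are linearly dependent modulo the ideal, so critical
  points have coordinates among the roots of a nonzero polynomial.\<close>

lemma qdim_imp_isolated:
  assumes "qdim n (jac_ideal n g) d"
  shows "\<forall>\<^sub>F z in at origin within cspace n. \<not> grad_zero n g z"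
proof -
  obtain e where "qbasis n (jac_ideal n g) d e" using assms unfolding qdim_def ..
  note e = qbasisD[OF this]
  have coord: "\<forall>\<^sub>F z in near_origin n. grad_zero n g z \<longrightarrow> z i = 0" if i: "i < n" for i
  proof -
    have "\<forall>j. \<exists>c. (\<lambda>z. z i ^ j - (\<Sum>l<d. c l * e l z)) \<in> jac_ideal n g"
      by (intro allI e(2) holo_germ_power holo_germ_coord)
    from choice[OF this] obtain v where "\<forall>j. (\<lambda>z. z i ^ j - (\<Sum>l<d. v j l * e l z)) \<in> jac_ideal n g" ..
    note v = this[rule_format]
    obtain a where a: "\<exists>j\<le>d. a j \<noteq> 0" "\<forall>l<d. (\<Sum>j\<le>d. a j * v j l) = 0"
      using linear_dependence[of d v] by blast
    have "(\<lambda>z. \<Sum>j\<le>d. a j * (z i ^ j - (\<Sum>l<d. v j l * e l z))) \<in> jac_ideal n g"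
      by (intro germ_ideal_sum[OF germ_ideal_jac_ideal] germ_idealD(4)[OF germ_ideal_jac_ideal] v holo_germ_const)
    moreover have "(\<Sum>j\<le>d. a j * (z i ^ j - (\<Sum>l<d. v j l * e l z))) = (\<Sum>j\<le>d. a j * z i ^ j)" for z
    proof -
      have "(\<Sum>j\<le>d. a j * (\<Sum>l<d. v j l * e l z)) = (\<Sum>l<d. (\<Sum>j\<le>d. a j * v j l) * e l z)"
        unfolding sum_distrib_left sum_distrib_right by (subst sum.swap) (simp add: mult.assoc)
      also have "\<dots> = 0" using a(2) by simp
      finally show ?thesis by (simp add: right_diff_distrib sum_subtractf)
    qed
    ultimately have "(\<lambda>z. \<Sum>j\<le>d. a j * z i ^ j) \<in> jac_ideal n g" by simp
    then obtain \<alpha> where \<alpha>: "\<forall>\<^sub>F z in near_origin n. (\<Sum>j\<le>d. a j * z i ^ j) = (\<Sum>l<n. \<alpha> l z * partial_deriv l g z)"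
      unfolding jac_ideal_def by blast
    have "finite {x. (\<Sum>j\<le>d. a j * x ^ j) = 0}"
      using a(1) polyfun_rootbound[where c = a and n = d] by blast
    \<comment> \<open>Zero may itself be a root, so only the other roots are kept away; being
      finitely many, they lie outside a disc about 0.\<close>
    then have "closed ({x. (\<Sum>j\<le>d. a j * x ^ j) = 0} - {0})"
      by (intro finite_imp_closed) simp
    then have "\<forall>\<^sub>F x in nhds 0. x \<in> - ({x. (\<Sum>j\<le>d. a j * x ^ j) = 0} - {0})"
      by (intro eventually_nhds_in_open open_Compl) simp_all
    then obtain \<epsilon> where \<epsilon>: "\<epsilon> > 0" "\<And>x. norm x < \<epsilon> \<Longrightarrow> (\<Sum>j\<le>d. a j * x ^ j) = 0 \<Longrightarrow> x = 0"
      by (auto simp: eventually_nhds_metric)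
    show ?thesis
      using \<alpha> polydisc_eventually[OF \<epsilon>(1)]
    proof eventually_elim
      fix z assume "(\<Sum>j\<le>d. a j * z i ^ j) = (\<Sum>l<n. \<alpha> l z * partial_deriv l g z)" "z \<in> polydisc n \<epsilon>"
      then show "grad_zero n g z \<longrightarrow> z i = 0"
        using \<epsilon>(2)[of "z i"] i by (auto simp: grad_zero_def polydisc_def)
    qed
  qed
  have "\<forall>\<^sub>F z in near_origin n. \<forall>i\<in>{..<n}. grad_zero n g z \<longrightarrow> z i = 0"
    by (intro eventually_ball_finite ballI coord) auto
  then have "\<forall>\<^sub>F z in near_origin n. z \<noteq> origin \<longrightarrow> \<not> grad_zero n g z"
    using eventually_in_cspace
  proof eventually_elim
    fix z assume *: "\<forall>i\<in>{..<n}. grad_zero n g z \<longrightarrow> z i = 0" "z \<in> cspace n"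
    have "z i = 0" if "grad_zero n g z" for i
      using * that by (cases "i < n") (auto simp: cspace_def)
    then show "z \<noteq> origin \<longrightarrow> \<not> grad_zero n g z" by (auto simp: fun_eq_iff)
  qed
  then show ?thesis
    unfolding near_origin_def eventually_inf_principal eventually_at_filter
    by eventually_elim auto
qed

section \<open>The Milnor number as a ring-theoretic dimension\<close>


lemma holo_ring_simps [simp]:
  "carrier (holo_ring n) = Collect (holo_germ n)" "mult (holo_ring n) f g = (\<lambda>z. f z * g z)"
  "one (holo_ring n) = (\<lambda>_. 1)" "zero (holo_ring n) = (\<lambda>_. 0)" "add (holo_ring n) f g = (\<lambda>z. f z + g z)"
  by (simp_all add: holo_ring_def)

lemma cring_holo_ring: "cring (holo_ring n)"
proof (rule cringI)
  show "abelian_group (holo_ring n)"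
  proof (rule abelian_groupI)
    fix f assume f: "f \<in> carrier (holo_ring n)"
    then show "\<exists>g\<in>carrier (holo_ring n). g \<oplus>\<^bsub>holo_ring n\<^esub> f = \<zero>\<^bsub>holo_ring n\<^esub>"
      by (intro bexI[of _ "\<lambda>z. - f z"]) (auto intro: holo_germ_uminus)
  qed (auto intro: holo_germ_add simp: algebra_simps)
  show "comm_monoid (holo_ring n)"
    by (rule comm_monoidI) (auto intro: holo_germ_mult simp: algebra_simps)
qed (auto simp: algebra_simps)

lemma holo_ring_a_inv:
  assumes "holo_germ n f"
  shows "\<ominus>\<^bsub>holo_ring n\<^esub> f = (\<lambda>z. - f z)"
proof -
  interpret cring "holo_ring n" by (rule cring_holo_ring)
  show ?thesis by (rule minus_equality) (use assms holo_germ_uminus in auto)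
qed

lemma germ_ideal_imp_ideal:
  assumes J: "germ_ideal n J"
  shows "ideal J (holo_ring n)"
proof -
  interpret cring "holo_ring n" by (rule cring_holo_ring)
  show ?thesis
  proof (rule idealI[OF ring_axioms])
    show "subgroup J (add_monoid (holo_ring n))"
    proof (rule add.subgroupI)
      show "J \<subseteq> carrier (holo_ring n)" using germ_idealD(1)[OF J] by auto
      show "J \<noteq> {}" using germ_idealD(2)[OF J, of "\<lambda>_. 0"] by auto
      fix f assume f: "f \<in> J"
      have "(\<lambda>z. -1 * f z) \<in> J" by (rule germ_idealD(4)[OF J holo_germ_const f])
      then show "\<ominus>\<^bsub>holo_ring n\<^esub> f \<in> J" using holo_ring_a_inv[OF germ_idealD(1)[OF J f]] by simp
    qed (use germ_idealD(3)[OF J] in auto)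
  next
    fix a x assume "a \<in> J" "x \<in> carrier (holo_ring n)"
    then have *: "(\<lambda>z. x z * a z) \<in> J" using germ_idealD(4)[OF J] by auto
    then show "x \<otimes>\<^bsub>holo_ring n\<^esub> a \<in> J" by simp
    show "a \<otimes>\<^bsub>holo_ring n\<^esub> x \<in> J" using * by (simp add: mult.commute)
  qed
qed

lemma germ_ideal_null_germs: "germ_ideal n (null_germs n)"
  unfolding germ_ideal_def null_germs_def
proof (intro conjI ballI allI impI CollectI)
  fix h :: "(nat \<Rightarrow> complex) \<Rightarrow> complex" assume h: "\<forall>\<^sub>F z in near_origin n. h z = 0"
  then have "\<forall>\<^sub>F z in near_origin n. 0 = h z" by eventually_elim simp
  then show "holo_germ n h" using holo_germ_cong[of n "\<lambda>_. 0" h] by simp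
next
  fix h k assume "h \<in> {f. holo_germ n f \<and> (\<forall>\<^sub>F z in near_origin n. f z = 0)}" "k \<in> {f. holo_germ n f \<and> (\<forall>\<^sub>F z in near_origin n. f z = 0)}"
  then have "\<forall>\<^sub>F z in near_origin n. h z = 0" "\<forall>\<^sub>F z in near_origin n. k z = 0" by auto
  then show "\<forall>\<^sub>F z in near_origin n. h z + k z = 0" by eventually_elim simp
next
  fix a h assume "h \<in> {f. holo_germ n f \<and> (\<forall>\<^sub>F z in near_origin n. f z = 0)}"
  then have "\<forall>\<^sub>F z in near_origin n. h z = 0" by auto
  then show "\<forall>\<^sub>F z in near_origin n. a z * h z = 0" by eventually_elim simp
qed (auto intro: holo_germ_add holo_germ_mult)

text \<open>Applied to the class map onto the germ ring: the image of \<open>jac_ideal\<close> is an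
  ideal and so contains the ideal generated by the gradient.\<close>

lemma surj_hom_image_ideal:
  assumes h: "ring_hom_ring R S h" and surj: "h ` carrier R = carrier S" and J: "ideal J R"
  shows "ideal (h ` J) S"
proof -
  interpret ring_hom_ring R S h by (rule h)
  interpret J: ideal J R by (rule J)
  show ?thesis
  proof (rule idealI[OF S.ring_axioms])
    show "subgroup (h ` J) (add_monoid S)"
    proof (rule S.add.subgroupI)
      show "h ` J \<subseteq> carrier S" using J.a_subset by auto
      show "h ` J \<noteq> {}" using J.zero_closed by blast
      fix x assume "x \<in> h ` J"
      then obtain a where a: "a \<in> J" "x = h a" by auto
      then have "\<ominus>\<^bsub>S\<^esub> x = h (\<ominus>\<^bsub>R\<^esub> a)" using J.a_subset by auto
      then show "\<ominus>\<^bsub>S\<^esub> x \<in> h ` J" using imageI[OF J.a_inv_closed[OF a(1)], of h] by (simp only:)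
    next
      fix x y assume "x \<in> h ` J" "y \<in> h ` J"
      then obtain a b where a: "a \<in> J" "x = h a" "b \<in> J" "y = h b" by auto
      then have "x \<oplus>\<^bsub>S\<^esub> y = h (a \<oplus>\<^bsub>R\<^esub> b)" using J.a_subset by auto
      then show "x \<oplus>\<^bsub>S\<^esub> y \<in> h ` J" using imageI[OF J.a_closed[OF a(1,3)], of h] by (simp only:)
    qed
  next
    fix x s assume "x \<in> h ` J" and s: "s \<in> carrier S"
    then obtain a where a: "a \<in> J" "x = h a" by auto
    obtain r where r: "r \<in> carrier R" "s = h r" using s surj by auto
    have "s \<otimes>\<^bsub>S\<^esub> x = h (r \<otimes>\<^bsub>R\<^esub> a)" using a r J.a_subset by auto
    then show "s \<otimes>\<^bsub>S\<^esub> x \<in> h ` J" using imageI[OF J.I_l_closed[OF a(1) r(1)], of h] by (simp only:)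
    have "x \<otimes>\<^bsub>S\<^esub> s = h (a \<otimes>\<^bsub>R\<^esub> r)" using a r J.a_subset by auto
    then show "x \<otimes>\<^bsub>S\<^esub> s \<in> h ` J" using imageI[OF J.I_r_closed[OF a(1) r(1)], of h] by (simp only:)
  qed
qed

text \<open>The abstract dimension is taken over a subfield; the image of this one in the Milnor
  algebra is \<open>milnor_constants\<close>.\<close>

lemma subfield_constants: "subfield (range (\<lambda>a _. a)) (holo_ring n)"
proof -
  interpret cring "holo_ring n" by (rule cring_holo_ring)
  let ?K = "range (\<lambda>(a::complex) (_::nat \<Rightarrow> complex). a)"
  show ?thesis
  proof (rule subfieldI)
    show "subcring ?K (holo_ring n)"
      by (rule subcringI', rule subringI) (auto simp: holo_ring_a_inv)
    have "x \<in> Units (holo_ring n \<lparr>carrier := ?K\<rparr>) \<longleftrightarrow> x \<in> ?K - {\<zero>\<^bsub>holo_ring n\<^esub>}" for x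
    proof
      assume "x \<in> Units (holo_ring n \<lparr>carrier := ?K\<rparr>)"
      then obtain y where "x \<in> ?K" "(\<lambda>z. y z * x z) = (\<lambda>_. 1)" by (auto simp: Units_def)
      then show "x \<in> ?K - {\<zero>\<^bsub>holo_ring n\<^esub>}" by (auto simp: fun_eq_iff)
    next
      assume "x \<in> ?K - {\<zero>\<^bsub>holo_ring n\<^esub>}"
      then obtain a where "x = (\<lambda>_. a)" "a \<noteq> 0" by auto
      then show "x \<in> Units (holo_ring n \<lparr>carrier := ?K\<rparr>)"
        unfolding Units_def by (auto intro!: exI[of _ "inverse a"] bexI[of _ "\<lambda>_. inverse a"])
    qed
    then show "Units (holo_ring n \<lparr>carrier := ?K\<rparr>) = ?K - {\<zero>\<^bsub>holo_ring n\<^esub>}" by blast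
  qed
qed

text \<open>The abstract dimension grows by line extensions, so the span of the first
  \<open>j\<close> basis elements is shown to have dimension \<open>j\<close>; independence modulo
  \<open>J\<close> puts \<open>e j\<close> outside the preceding span. Positivity of
  \<open>d\<close> excludes the zero ring, in which the constants do not form a field.\<close>

lemma dimension_of_quotient:
  assumes hom: "ring_hom_ring (holo_ring n) M c" and surj: "c ` Collect (holo_germ n) = carrier M"
    and ker: "\<And>h. holo_germ n h \<Longrightarrow> c h = \<zero>\<^bsub>M\<^esub> \<longleftrightarrow> h \<in> J"
    and J: "germ_ideal n J" and dim: "qdim n J d" and d: "d > 0"
  shows "ring.dimension M d' (range (\<lambda>a. c (\<lambda>_. a))) (carrier M) \<longleftrightarrow> d' = d"
proof -
  interpret ring_hom_ring "holo_ring n" M c by (rule hom)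
  obtain e where "qbasis n J d e" using dim unfolding qdim_def ..
  note e = qbasisD[OF this]
  let ?K = "range (\<lambda>a. c (\<lambda>_. a))"
  let ?s = "\<lambda>j \<gamma> z. \<Sum>i<j. \<gamma> i * e i z"
  have gs: "holo_germ n (?s j \<gamma>)" if "j \<le> d" for j and \<gamma> :: "nat \<Rightarrow> complex"
    by (intro holo_germ_sum holo_germ_mult) (use that in \<open>auto intro: e(1)\<close>)
  have add: "c (\<lambda>z. h z + k z) = c h \<oplus>\<^bsub>M\<^esub> c k" if "holo_germ n h" "holo_germ n k" for h k
    using hom_add[of h k] that by simp
  have mult: "c (\<lambda>z. h z * k z) = c h \<otimes>\<^bsub>M\<^esub> c k" if "holo_germ n h" "holo_germ n k" for h k
    using hom_mult[of h k] that by simp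
  have cl: "c h \<in> carrier M" if "holo_germ n h" for h using hom_closed[of h] that by simp
  have eq: "c h = c k \<longleftrightarrow> (\<lambda>z. h z - k z) \<in> J" if h: "holo_germ n h" and k: "holo_germ n k" for h k
  proof -
    have hk: "holo_germ n (\<lambda>z. h z - k z)" by (rule holo_germ_diff[OF h k])
    have "c h = c (\<lambda>z. h z - k z) \<oplus>\<^bsub>M\<^esub> c k" using add[OF hk k] by simp
    then have "c h = c k \<longleftrightarrow> c (\<lambda>z. h z - k z) = \<zero>\<^bsub>M\<^esub>"
      using cl[OF hk] cl[OF k] S.add.r_cancel_one by auto
    then show ?thesis using ker[OF hk] by simp
  qed
  \<comment> \<open>If 1 were in \<open>J\<close>, so would be the sum of all basis elements, a
    relation with nonzero coefficients because \<open>d > 0\<close>.\<close>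
  have one: "\<one>\<^bsub>M\<^esub> \<noteq> \<zero>\<^bsub>M\<^esub>"
  proof
    assume "\<one>\<^bsub>M\<^esub> = \<zero>\<^bsub>M\<^esub>"
    then have "c (\<lambda>_. 1) = \<zero>\<^bsub>M\<^esub>" using hom_one by simp
    then have "(\<lambda>_. 1) \<in> J" using ker by simp
    from germ_idealD(4)[OF J gs[OF order_refl, of "\<lambda>_. 1"] this]
    have "(\<lambda>z. ?s d (\<lambda>_. 1) z) \<in> J" by simp
    from e(3)[OF this] show False using d by simp
  qed
  have "subfield (c ` range (\<lambda>a _. a)) M" by (rule img_is_subfield(2)[OF subfield_constants one])
  moreover have "c ` range (\<lambda>a _. a) = ?K" by auto
  ultimately have K: "subfield ?K M" by simp
  have dimj: "S.dimension j ?K (range (\<lambda>\<gamma>. c (?s j \<gamma>)))" if "j \<le> d" for j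
    using that
  proof (induction j)
    case 0
    have "c (\<lambda>_. 0) = \<zero>\<^bsub>M\<^esub>" using hom_zero by simp
    then have "range (\<lambda>\<gamma>. c (?s 0 \<gamma>)) = {\<zero>\<^bsub>M\<^esub>}" by auto
    then show ?case using S.dimension.zero_dim by simp
  next
    case (Suc j)
    then have j: "j < d" and IH: "S.dimension j ?K (range (\<lambda>\<gamma>. c (?s j \<gamma>)))" by auto
    have gj: "holo_germ n (e j)" by (rule e(1)[OF j])
    have sj: "holo_germ n (?s j \<gamma>)" for \<gamma> :: "nat \<Rightarrow> complex" using gs[of j \<gamma>] j by simp
    have notin: "c (e j) \<notin> range (\<lambda>\<gamma>. c (?s j \<gamma>))"
    proof
      assume "c (e j) \<in> range (\<lambda>\<gamma>. c (?s j \<gamma>))"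
      then obtain \<gamma> :: "nat \<Rightarrow> complex" where "c (e j) = c (?s j \<gamma>)" by auto
      then have "(\<lambda>z. e j z - ?s j \<gamma> z) \<in> J" using eq[OF gj sj] by simp
      moreover have "e j z - ?s j \<gamma> z = ?s d (\<lambda>i. if i < j then - \<gamma> i else if i = j then 1 else 0) z" for z
      proof -
        let ?\<delta> = "\<lambda>i. if i < j then - \<gamma> i else if i = j then 1 else 0"
        have "?s d ?\<delta> z = ?s (Suc j) ?\<delta> z"
          by (rule sum.mono_neutral_right) (use j in auto)
        also have "\<dots> = e j z + (\<Sum>i<j. - (\<gamma> i * e i z))" by simp
        finally show ?thesis by (simp add: sum_negf)
      qed
      ultimately have "(\<lambda>z. ?s d (\<lambda>i. if i < j then - \<gamma> i else if i = j then 1 else 0) z) \<in> J" by simp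
      from e(3)[OF this] j show False by auto
    qed
    have step: "c (?s (Suc j) \<gamma>) = c (\<lambda>_. \<gamma> j) \<otimes>\<^bsub>M\<^esub> c (e j) \<oplus>\<^bsub>M\<^esub> c (?s j \<gamma>)" for \<gamma> :: "nat \<Rightarrow> complex"
    proof -
      have "c (\<lambda>z. \<gamma> j * e j z + ?s j \<gamma> z) = c (\<lambda>_. \<gamma> j) \<otimes>\<^bsub>M\<^esub> c (e j) \<oplus>\<^bsub>M\<^esub> c (?s j \<gamma>)"
        using add[OF holo_germ_mult[OF holo_germ_const gj] sj] mult[OF holo_germ_const gj] by simp
      then show ?thesis by (simp add: add.commute)
    qed
    have "S.line_extension ?K (c (e j)) (range (\<lambda>\<gamma>. c (?s j \<gamma>))) = range (\<lambda>\<gamma>. c (?s (Suc j) \<gamma>))"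
    proof (intro equalityI subsetI)
      fix u assume "u \<in> S.line_extension ?K (c (e j)) (range (\<lambda>\<gamma>. c (?s j \<gamma>)))"
      then obtain a \<gamma> where u: "u = c (\<lambda>_. a) \<otimes>\<^bsub>M\<^esub> c (e j) \<oplus>\<^bsub>M\<^esub> c (?s j \<gamma>)"
        unfolding S.line_extension_mem_iff by auto
      have "?s j (\<gamma>(j := a)) = ?s j \<gamma>" by (intro ext sum.cong) auto
      then have "u = c (?s (Suc j) (\<gamma>(j := a)))" unfolding step u by simp
      then show "u \<in> range (\<lambda>\<gamma>. c (?s (Suc j) \<gamma>))" by blast
    next
      fix u assume "u \<in> range (\<lambda>\<gamma>. c (?s (Suc j) \<gamma>))"
      then obtain \<gamma> where "u = c (\<lambda>_. \<gamma> j) \<otimes>\<^bsub>M\<^esub> c (e j) \<oplus>\<^bsub>M\<^esub> c (?s j \<gamma>)" unfolding step by auto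
      then show "u \<in> S.line_extension ?K (c (e j)) (range (\<lambda>\<gamma>. c (?s j \<gamma>)))"
        unfolding S.line_extension_mem_iff by blast
    qed
    with S.dimension.Suc_dim[OF cl[OF gj] notin IH] show ?case by simp
  qed
  have "range (\<lambda>\<gamma>. c (?s d \<gamma>)) = carrier M"
  proof (intro equalityI subsetI)
    fix u assume "u \<in> range (\<lambda>\<gamma>. c (?s d \<gamma>))"
    then show "u \<in> carrier M" using cl[OF gs[OF order_refl]] by auto
  next
    fix u assume "u \<in> carrier M"
    then obtain h where h: "holo_germ n h" "u = c h" using surj by auto
    obtain \<gamma> :: "nat \<Rightarrow> complex" where "(\<lambda>z. h z - ?s d \<gamma> z) \<in> J" using e(2)[OF h(1)] ..
    then have "u = c (?s d \<gamma>)" using eq[OF h(1) gs[OF order_refl]] h(2) by simp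
    then show "u \<in> range (\<lambda>\<gamma>. c (?s d \<gamma>))" by blast
  qed
  with dimj[OF order_refl] have D: "S.dimension d ?K (carrier M)" by simp
  then show ?thesis using S.dimension_is_inj[OF K] by blast
qed

lemma zero_FactRing: "\<zero>\<^bsub>R Quot I\<^esub> = I"
  by (simp add: FactRing_def)

lemma carrier_FactRing: "carrier (R Quot I) = (+>\<^bsub>R\<^esub>) I ` carrier R"
  by (auto simp: FactRing_def A_RCOSETS_def')

text \<open>The two successive quotients, by the null germs and by the gradient ideal, combine to
  one surjective homomorphism on representatives with kernel \<open>jac_ideal\<close>, to which
  \<open>dimension_of_quotient\<close> applies.\<close>

lemma milnor_number_eq:
  assumes g: "holo_germ n g" and dim: "qdim n (jac_ideal n g) d" and d: "d > 0"
  shows "milnor_number n g = enat d"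
proof -
  let ?R = "holo_ring n" and ?N = "null_germs n" and ?Q = "germ_ring n"
  let ?I = "gradient_ideal n g" and ?M = "milnor_algebra n g"
  interpret R: cring ?R by (rule cring_holo_ring)
  interpret N: ideal ?N ?R by (rule germ_ideal_imp_ideal[OF germ_ideal_null_germs])
  have homQ: "ring_hom_ring ?R ?Q (germ n)"
    using N.rcos_ring_hom_ring unfolding germ_ring_def germ_def[abs_def] .
  interpret Q: ring_hom_ring ?R ?Q "germ n" by (rule homQ)
  have surjQ: "germ n ` carrier ?R = carrier ?Q"
    unfolding germ_ring_def germ_def[abs_def] by (rule carrier_FactRing[symmetric])
  have pg: "holo_germ n (partial_deriv i g)" if "i < n" for i by (rule holo_germ_partial_deriv[OF g that])
  let ?gens = "(\<lambda>i. germ n (partial_deriv i g)) ` {..<n}"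
  have gens: "?gens \<subseteq> carrier ?Q" using pg Q.hom_closed by auto
  have idI: "ideal ?I ?Q" unfolding gradient_ideal_def by (rule Q.S.genideal_ideal[OF gens])
  interpret I: ideal ?I ?Q by (rule idI)
  have germ_eq: "germ n h = germ n k" if "holo_germ n h" "holo_germ n k" "\<forall>\<^sub>F z in near_origin n. h z = k z" for h k
  proof -
    have "h \<ominus>\<^bsub>?R\<^esub> k = (\<lambda>z. h z - k z)" using that by (simp add: a_minus_def holo_ring_a_inv)
    moreover have "\<forall>\<^sub>F z in near_origin n. h z - k z = 0" using that(3) by eventually_elim simp
    then have "(\<lambda>z. h z - k z) \<in> ?N" using that by (auto simp: null_germs_def intro: holo_germ_diff)
    ultimately show ?thesis
      unfolding germ_def using R.quotient_eq_iff_same_a_r_cos[OF N.is_ideal, of h k] that by simp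
  qed
  \<comment> \<open>Partial sums are followed by induction, because the homomorphism and ideal laws
    speak of binary sums.\<close>
  have sub1: "germ n ` jac_ideal n g \<subseteq> ?I"
  proof
    fix X assume "X \<in> germ n ` jac_ideal n g"
    then obtain h a where h: "X = germ n h" "holo_germ n h" "\<And>i. i < n \<Longrightarrow> holo_germ n (a i)"
      "\<forall>\<^sub>F z in near_origin n. h z = (\<Sum>i<n. a i z * partial_deriv i g z)"
      unfolding jac_ideal_def by blast
    have gs: "holo_germ n (\<lambda>z. \<Sum>i<k. a i z * partial_deriv i g z)" if "k \<le> n" for k
      by (intro holo_germ_sum holo_germ_mult) (use that h(3) pg in auto)
    have "germ n (\<lambda>z. \<Sum>i<k. a i z * partial_deriv i g z) \<in> ?I" if "k \<le> n" for k
      using that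
    proof (induction k)
      case 0
      have "germ n (\<lambda>_. 0) = \<zero>\<^bsub>?Q\<^esub>" using Q.hom_zero by simp
      then show ?case using I.zero_closed by simp
    next
      case (Suc k)
      have "germ n (partial_deriv k g) \<in> ?I"
        using Q.S.genideal_self[OF gens] Suc.prems unfolding gradient_ideal_def by auto
      then have "germ n (a k) \<otimes>\<^bsub>?Q\<^esub> germ n (partial_deriv k g) \<in> ?I"
        using I.I_l_closed Q.hom_closed h(3)[of k] Suc.prems by simp
      then have "germ n (\<lambda>z. a k z * partial_deriv k g z) \<in> ?I"
        using Q.hom_mult[of "a k" "partial_deriv k g"] h(3)[of k] pg[of k] Suc.prems by simp
      then have "germ n (\<lambda>z. \<Sum>i<k. a i z * partial_deriv i g z) \<oplus>\<^bsub>?Q\<^esub> germ n (\<lambda>z. a k z * partial_deriv k g z) \<in> ?I"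
        using I.a_closed Suc by simp
      then show ?case
        using Q.hom_add[of "\<lambda>z. \<Sum>i<k. a i z * partial_deriv i g z" "\<lambda>z. a k z * partial_deriv k g z"]
          gs[of k] holo_germ_mult[OF h(3)[of k] pg[of k]] Suc.prems by simp
    qed
    from this[of n] germ_eq[OF h(2) gs[of n] h(4)] show "X \<in> ?I" using h(1) by simp
  qed
  have "ideal (germ n ` jac_ideal n g) ?Q"
    by (rule surj_hom_image_ideal[OF homQ surjQ germ_ideal_imp_ideal[OF germ_ideal_jac_ideal]])
  moreover have "?gens \<subseteq> germ n ` jac_ideal n g"
  proof -
    have "partial_deriv i g \<in> jac_ideal n g" if "i < n" for i
      by (rule jac_idealI[of _ _ "\<lambda>j _. if j = i then 1 else 0"])
        (use that pg in \<open>auto intro!: always_eventually simp: if_distrib[of "\<lambda>x. x * _"] cong: if_cong\<close>)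
    then show ?thesis by auto
  qed
  ultimately have "?I \<subseteq> germ n ` jac_ideal n g"
    unfolding gradient_ideal_def by (rule Q.S.genideal_minimal)
  with sub1 have I_eq: "?I = germ n ` jac_ideal n g" by blast
  \<comment> \<open>Changing a representative by a null germ does not leave
    \<open>jac_ideal\<close>, so membership can be tested before passing to germs.\<close>
  have memI: "germ n h \<in> ?I \<longleftrightarrow> h \<in> jac_ideal n g" if h: "holo_germ n h" for h
  proof
    assume "germ n h \<in> ?I"
    then obtain k where k: "k \<in> jac_ideal n g" "germ n h = germ n k" unfolding I_eq by auto
    have gk: "holo_germ n k" using k(1) germ_idealD(1)[OF germ_ideal_jac_ideal] by blast
    have "h \<ominus>\<^bsub>?R\<^esub> k = (\<lambda>z. h z - k z)" using h gk by (simp add: a_minus_def holo_ring_a_inv)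
    then have "(\<lambda>z. h z - k z) \<in> ?N"
      using R.quotient_eq_iff_same_a_r_cos[OF N.is_ideal, of h k] h gk k(2) unfolding germ_def by simp
    then have "\<forall>\<^sub>F z in near_origin n. h z - k z = 0" by (simp add: null_germs_def)
    then have "\<forall>\<^sub>F z in near_origin n. k z = h z" by eventually_elim simp
    then show "h \<in> jac_ideal n g" by (rule germ_ideal_cong[OF germ_ideal_jac_ideal k(1)])
  qed (use I_eq in blast)
  let ?c = "\<lambda>h. ?I +>\<^bsub>?Q\<^esub> germ n h"
  have hom2: "ring_hom_ring ?Q ?M ((+>\<^bsub>?Q\<^esub>) ?I)"
    unfolding milnor_algebra_def by (rule I.rcos_ring_hom_ring)
  interpret M: ring_hom_ring ?Q ?M "(+>\<^bsub>?Q\<^esub>) ?I" by (rule hom2)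
  have hom: "ring_hom_ring ?R ?M ?c"
  proof (rule ring_hom_ringI2)
    show "?c \<in> ring_hom ?R ?M"
      using ring_hom_trans[OF Q.homh M.homh] by (simp add: comp_def)
  qed (rule R.ring_axioms M.S.ring_axioms)+
  have surj: "?c ` Collect (holo_germ n) = carrier ?M"
  proof -
    have "(+>\<^bsub>?Q\<^esub>) ?I ` carrier ?Q = carrier ?M"
      unfolding milnor_algebra_def by (rule carrier_FactRing[symmetric])
    then show ?thesis unfolding surjQ[symmetric] by (auto simp: image_image)
  qed
  have ker: "?c h = \<zero>\<^bsub>?M\<^esub> \<longleftrightarrow> h \<in> jac_ideal n g" if h: "holo_germ n h" for h
  proof -
    have "\<zero>\<^bsub>?M\<^esub> = ?I" unfolding milnor_algebra_def by (rule zero_FactRing)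
    moreover have "germ n h \<in> carrier ?Q" using Q.hom_closed h by simp
    ultimately have "?c h = \<zero>\<^bsub>?M\<^esub> \<longleftrightarrow> germ n h \<in> ?I"
      using I.a_rcos_const I.rcos_const_imp_mem by auto
    then show ?thesis using memI[OF h] by simp
  qed
  have "ring.dimension ?M d' (milnor_constants n g) (carrier ?M) \<longleftrightarrow> d' = d" for d'
    unfolding milnor_constants_def
    by (rule dimension_of_quotient[OF hom surj ker germ_ideal_jac_ideal dim d])
  then have "{enat d' |d'. ring.dimension ?M d' (milnor_constants n g) (carrier ?M)} = {enat d}" by auto
  then show ?thesis unfolding milnor_number_def by simp
qed

section \<open>Elimination of variables from a deformation\<close>


text \<open>A partial derivative that is nonzero at the origin is a unit, so the ideal is everything
  and leaves no room for independent elements. In a family this keeps the origin critical for all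
  small parameters.\<close>

lemma qdim_pos_imp_critical:
  assumes g: "holo_germ n g" and dim: "qdim n (jac_ideal n g) d" and d: "d > 0" and i: "i < n"
  shows "partial_deriv i g origin = 0"
proof (rule ccontr)
  assume nz: "partial_deriv i g origin \<noteq> 0"
  obtain e where "qbasis n (jac_ideal n g) d e" using dim unfolding qdim_def ..
  note e = qbasisD[OF this]
  have pg: "holo_germ n (partial_deriv i g)" by (rule holo_germ_partial_deriv[OF g i])
  let ?h = "\<lambda>z. \<Sum>l<d. 1 * e l z"
  have h: "holo_germ n ?h" by (intro holo_germ_sum holo_germ_mult holo_germ_const) (auto intro: e(1))
  have "?h \<in> jac_ideal n g"
  proof (rule jac_idealI[OF h, of "\<lambda>j z. if j = i then ?h z / partial_deriv i g z else 0"])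
    show "holo_germ n (\<lambda>z. if j = i then ?h z / partial_deriv i g z else 0)" for j
      using holo_germ_divide[OF h pg nz] by (cases "j = i") auto
    show "\<forall>\<^sub>F z in near_origin n. ?h z = (\<Sum>j<n. (if j = i then ?h z / partial_deriv i g z else 0) * partial_deriv j g z)"
      using holo_germ_eventually_nonzero[OF pg nz]
    proof eventually_elim
      fix z assume nz: "partial_deriv i g z \<noteq> 0"
      have "(\<Sum>j<n. (if j = i then ?h z / partial_deriv i g z else 0) * partial_deriv j g z) =
          (\<Sum>j<n. if j = i then ?h z else 0)"
        by (intro sum.cong) (use nz in auto)
      then show "?h z = (\<Sum>j<n. (if j = i then ?h z / partial_deriv i g z else 0) * partial_deriv j g z)"
        using i by simp
    qed
  qed
  from e(3)[OF this] show False using d by simp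
qed

lemma stabilization_eq_trunc: "stabilization n p f z = f (trunc n z) + (\<Sum>i=n..<p. (z i)\<^sup>2)"
  by (simp add: stabilization_def tuple_def)

lemma holo_germ_stabilization: "holo_germ n f \<Longrightarrow> holo_germ p (stabilization n p f)"
  unfolding stabilization_eq_trunc[abs_def]
  by (intro holo_germ_add holo_germ_comp[OF _ map_germ_trunc] holo_germ_sum holo_germ_power holo_germ_coord)

lemma stabilization_self: "z \<in> cspace n \<Longrightarrow> stabilization n n f z = f z"
  by (simp add: stabilization_eq_trunc trunc_ident)

lemma stabilization_Suc: "n \<le> p \<Longrightarrow> stabilization n (Suc p) f z = stabilization n p f z + (z p)\<^sup>2"
  by (simp add: stabilization_eq_trunc)

lemma partial_deriv_stabilization:
  assumes "n \<le> p"
  shows "partial_deriv p (stabilization n (Suc p) f) z = 2 * z p"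
proof -
  have "stabilization n (Suc p) f (z(p := w)) = stabilization n p f z + w\<^sup>2" for w
  proof -
    have "trunc n (z(p := w)) = trunc n z" using assms by (auto simp: tuple_def fun_eq_iff)
    moreover have "(\<Sum>i=n..<p. ((z(p := w)) i)\<^sup>2) = (\<Sum>i=n..<p. (z i)\<^sup>2)" by (intro sum.cong) auto
    ultimately show ?thesis using assms by (simp add: stabilization_eq_trunc)
  qed
  then show ?thesis
    unfolding partial_deriv_def by (auto intro!: DERIV_imp_deriv derivative_eq_intros)
qed

text \<open>Each added square is removed by \<open>qdim_graph\<close> with
  \<open>\<omega> = 0\<close> and the unit 2, the graph being the smaller space itself.\<close>

lemma qdim_stabilization:
  assumes g: "holo_germ n g" and dim: "qdim n (jac_ideal n g) d" and np: "n \<le> p"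
  shows "qdim p (jac_ideal p (stabilization n p g)) d"
  using np
proof (induction p rule: dec_induct)
  case base
  have "jac_ideal n (stabilization n n g) = jac_ideal n g"
    by (rule jac_ideal_cong) (use eventually_in_cspace in eventually_elim, simp add: stabilization_self)
  then show ?case using dim by simp
next
  case (step p)
  let ?\<phi> = "\<lambda>j z. if j < p then z j else 0 :: complex"
  let ?F = "\<lambda>z. stabilization n (Suc p) g (tuple (Suc p) ?\<phi> z)"
  have "jac_ideal p ?F = jac_ideal p (stabilization n p g)"
  proof (rule jac_ideal_cong)
    show "\<forall>\<^sub>F z in near_origin p. ?F z = stabilization n p g z"
      using eventually_in_cspace
    proof eventually_elim
      fix z assume z: "z \<in> cspace p"
      then have "tuple (Suc p) ?\<phi> z = z" by (auto simp: tuple_def cspace_def fun_eq_iff)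
      moreover have "z p = 0" using z by (simp add: cspace_def)
      ultimately show "?F z = stabilization n p g z" using step(1) by (simp add: stabilization_Suc)
    qed
  qed
  moreover have "qdim (Suc p) (jac_ideal (Suc p) (stabilization n (Suc p) g)) d \<longleftrightarrow> qdim p (jac_ideal p ?F) d"
    by (rule qdim_graph[where E = "\<lambda>_. 2" and \<omega> = "\<lambda>_. 0"])
      (use holo_germ_stabilization[OF g] partial_deriv_stabilization[OF step(1)] in auto)
  ultimately show ?case using step.IH by simp
qed

text \<open>The invariant carried from \<open>p\<close> variables down to \<open>n\<close>. At
  \<open>s = 0\<close> it fixes the germ itself and not only its equivalence class, so that for
  \<open>k = n\<close> a deformation of \<open>f0\<close> is obtained. The numbers are those of the
  two-variable model.\<close>

definition jump_one_family ::
  "nat \<Rightarrow> nat \<Rightarrow> ((nat \<Rightarrow> complex) \<Rightarrow> complex) \<Rightarrow> (complex \<Rightarrow> (nat \<Rightarrow> complex) \<Rightarrow> complex) \<Rightarrow> bool" where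
  "jump_one_family n k f0 G \<longleftrightarrow>
     holo_germ (Suc k) (uncurry_param G) \<and>
     (\<forall>\<^sub>F z in near_origin k. G 0 z = stabilization n k f0 z) \<and>
     (\<forall>\<^sub>F s in nhds 0. G s origin = 0) \<and>
     (\<forall>\<^sub>F s in nhds 0. qdim k (jac_ideal k (G s)) (if s = 0 then 15 else 14))"

text \<open>The last variable \<open>w\<close> is replaced by the solution of \<open>\<partial>G/\<partial>w = 0\<close>; at \<open>s = 0\<close> that
  solution vanishes, because there \<open>w\<close> only occurs as \<open>w\<^sup>2\<close>.\<close>

lemma jump_one_family_descend:
  assumes fam: "jump_one_family n (Suc k) f0 G" and nk: "n \<le> k"
  obtains G' where "jump_one_family n k f0 G'"
proof -
  have G: "holo_germ (Suc (Suc k)) (uncurry_param G)"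
    and G0: "\<forall>\<^sub>F z in near_origin (Suc k). G 0 z = stabilization n (Suc k) f0 z"
    and Gs0: "\<forall>\<^sub>F s in nhds 0. G s origin = 0"
    and dim: "\<forall>\<^sub>F s in nhds 0. qdim (Suc k) (jac_ideal (Suc k) (G s)) (if s = 0 then 15 else 14)"
    using fam by (auto simp: jump_one_family_def)
  define h where "h = partial_deriv (Suc k) (uncurry_param G)"
  have hs: "h (case_nat s z) = partial_deriv k (G s) z" for s z
    by (simp add: h_def partial_deriv_slice)
  have gh: "holo_germ (Suc (Suc k)) h"
    unfolding h_def by (rule holo_germ_partial_deriv[OF G]) simp
  have origin_case: "origin = case_nat 0 origin" by (auto simp: fun_eq_iff split: nat.splits)
  have Gg: "\<forall>\<^sub>F s in nhds 0. holo_germ (Suc k) (G s)"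
    using holo_germ_slice[OF G] by simp
  have crit: "\<forall>\<^sub>F s in nhds 0. partial_deriv k (G s) origin = 0"
    using Gg dim by eventually_elim (erule (1) qdim_pos_imp_critical, auto)
  have h0: "h origin = 0"
    using eventually_nhds_x_imp_x[OF crit] origin_case hs by metis
  have d2: "\<forall>\<^sub>F z in near_origin (Suc k). partial_deriv k (G 0) z = 2 * z k"
    using partial_deriv_cong_ev[OF G0, of k] partial_deriv_stabilization[OF nk] by simp
  \<comment> \<open>The second derivative of \<open>G 0\<close> in the last variable is 2, because
    that variable enters \<open>G 0\<close> only as a square. This is the nondegeneracy that the
    implicit function theorem asks for.\<close>
  have "partial_deriv (Suc k) h origin = partial_deriv k (\<lambda>z. h (case_nat 0 z)) origin"
    by (subst origin_case) (rule partial_deriv_slice)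
  also have "\<dots> = partial_deriv k (\<lambda>z. 2 * z k) origin"
    using eventually_near_originD[OF partial_deriv_cong_ev[OF d2, of k]] by (simp add: hs)
  also have "\<dots> = 2"
    unfolding partial_deriv_def by (auto intro!: DERIV_imp_deriv derivative_eq_intros)
  finally have dh: "partial_deriv (Suc k) h origin \<noteq> 0" by simp
  obtain \<omega> E where \<omega>: "holo_germ (Suc k) \<omega>" "\<omega> origin = 0"
    and E: "holo_germ (Suc (Suc k)) E" "E origin \<noteq> 0"
    and hE: "\<forall>\<^sub>F w in near_origin (Suc (Suc k)). h w = (w (Suc k) - \<omega> (trunc (Suc k) w)) * E w"
    using implicit_function[OF gh h0 dh] .
  define \<phi> where "\<phi> s j z = (if j < k then z j else \<omega> (case_nat s z))" for s :: complex and j and z :: "nat \<Rightarrow> complex"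
  define G' where "G' s z = G s (tuple (Suc k) (\<phi> s) z)" for s z
  \<comment> \<open>With the parameter as variable 0 the substitution is again a composition with a
    map germ, which gives joint holomorphy in \<open>(s, z)\<close>.\<close>
  have "uncurry_param G' = (\<lambda>w. uncurry_param G (tuple (Suc (Suc k)) (\<lambda>j w. if j < Suc k then w j else \<omega> w) w))"
  proof
    fix w :: "nat \<Rightarrow> complex"
    let ?s = "w 0" and ?z = "\<lambda>i. w (Suc i)"
    have w: "case_nat ?s ?z = w" by (auto simp: fun_eq_iff split: nat.splits)
    have "tuple (Suc (Suc k)) (\<lambda>j w. if j < Suc k then w j else \<omega> w) w = case_nat ?s (tuple (Suc k) (\<phi> ?s) ?z)"
      by (auto simp: tuple_def \<phi>_def w fun_eq_iff split: nat.splits)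
    then show "uncurry_param G' w = uncurry_param G (tuple (Suc (Suc k)) (\<lambda>j w. if j < Suc k then w j else \<omega> w) w)"
      by (simp add: uncurry_param_def[of G'] G'_def)
  qed
  then have 1: "holo_germ (Suc k) (uncurry_param G')"
    using \<omega> by (auto intro!: holo_germ_comp[OF G] simp: map_germ_def)
  have \<omega>s: "\<forall>\<^sub>F s in nhds 0. holo_germ k (\<lambda>z. \<omega> (case_nat s z))" by (rule holo_germ_slice[OF \<omega>(1)])
  have Es: "\<forall>\<^sub>F s in nhds 0. holo_germ (Suc k) (\<lambda>z. E (case_nat s z))" by (rule holo_germ_slice[OF E(1)])
  have E0: "\<forall>\<^sub>F s in nhds 0. E (case_nat s origin) \<noteq> 0"
    using eventually_slice[OF holo_germ_eventually_nonzero[OF E]]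
    by eventually_elim (rule eventually_near_originD)
  have trunc_case: "trunc (Suc k) (case_nat s z) = case_nat s (trunc k z)" for s z
    by (auto simp: tuple_def fun_eq_iff split: nat.splits)
  have dE: "\<forall>\<^sub>F s in nhds 0. \<forall>\<^sub>F z in near_origin (Suc k).
      partial_deriv k (G s) z = (z k - \<omega> (case_nat s (trunc k z))) * E (case_nat s z)"
    using eventually_slice[OF hE] by (simp add: hs trunc_case)
  \<comment> \<open>The origin is critical for every nearby member by \<open>crit\<close>, so the
    solution passes through the origin for all small \<open>s\<close> and the new family still
    vanishes there.\<close>
  have \<omega>0: "\<forall>\<^sub>F s in nhds 0. \<omega> (case_nat s origin) = 0"
    using dE E0 crit
  proof eventually_elim
    fix s assume "\<forall>\<^sub>F z in near_origin (Suc k).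
        partial_deriv k (G s) z = (z k - \<omega> (case_nat s (trunc k z))) * E (case_nat s z)"
      and "E (case_nat s origin) \<noteq> 0" "partial_deriv k (G s) origin = 0"
    then show "\<omega> (case_nat s origin) = 0"
      using eventually_near_originD tuple_origin[OF map_germ_trunc, of k] by fastforce
  qed
  have 3: "\<forall>\<^sub>F s in nhds 0. G' s origin = 0"
    using Gs0 \<omega>0
  proof eventually_elim
    fix s assume *: "G s origin = 0" "\<omega> (case_nat s origin) = 0"
    have "tuple (Suc k) (\<phi> s) origin = origin" using *(2) by (auto simp: tuple_def \<phi>_def fun_eq_iff)
    then show "G' s origin = 0" using *(1) by (simp add: G'_def)
  qed
  have 4: "\<forall>\<^sub>F s in nhds 0. qdim k (jac_ideal k (G' s)) (if s = 0 then 15 else 14)"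
    using Gg \<omega>s \<omega>0 Es E0 dE dim
  proof eventually_elim
    fix s :: complex
    assume *: "holo_germ (Suc k) (G s)" "holo_germ k (\<lambda>z. \<omega> (case_nat s z))" "\<omega> (case_nat s origin) = 0"
      "holo_germ (Suc k) (\<lambda>z. E (case_nat s z))" "E (case_nat s origin) \<noteq> 0"
      "\<forall>\<^sub>F z in near_origin (Suc k). partial_deriv k (G s) z = (z k - \<omega> (case_nat s (trunc k z))) * E (case_nat s z)"
      and d: "qdim (Suc k) (jac_ideal (Suc k) (G s)) (if s = 0 then 15 else 14)"
    show "qdim k (jac_ideal k (G' s)) (if s = 0 then 15 else 14)"
      using qdim_graph[OF *] d unfolding G'_def \<phi>_def by simp
  qed
  \<comment> \<open>On the graph at \<open>s = 0\<close> the derivative is zero by the factorization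
    and twice the last coordinate by \<open>d2\<close>. Hence the last coordinate, which is the
    value of \<open>\<omega>\<close>, vanishes.\<close>
  have 2: "\<forall>\<^sub>F z in near_origin k. G' 0 z = stabilization n k f0 z"
  proof -
    have "\<phi> 0 j = (if j < k then (\<lambda>z. z j) else (\<lambda>z. \<omega> (case_nat 0 z)))" for j
      by (auto simp: \<phi>_def)
    then have mg: "map_germ k (Suc k) (\<phi> 0)"
      using eventually_nhds_x_imp_x[OF \<omega>s] eventually_nhds_x_imp_x[OF \<omega>0] by (simp add: map_germ_def)
    show ?thesis
      using eventually_tuple[OF mg eventually_nhds_x_imp_x[OF dE]] eventually_tuple[OF mg d2]
        eventually_tuple[OF mg G0] eventually_in_cspace
    proof eventually_elim
      fix z let ?t = "tuple (Suc k) (\<phi> 0) z"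
      assume a: "partial_deriv k (G 0) ?t = (?t k - \<omega> (case_nat 0 (trunc k ?t))) * E (case_nat 0 ?t)"
        and b: "partial_deriv k (G 0) ?t = 2 * ?t k" and c: "G 0 ?t = stabilization n (Suc k) f0 ?t"
        and z: "z \<in> cspace k"
      have tk: "?t k = \<omega> (case_nat 0 z)" by (simp add: tuple_def \<phi>_def)
      have "trunc k ?t = z" using z by (auto simp: tuple_def \<phi>_def cspace_def fun_eq_iff)
      then have t0: "?t k = 0" using a b tk by simp
      then have "?t = z" using z tk by (auto simp: tuple_def \<phi>_def cspace_def fun_eq_iff)
      then show "G' 0 z = stabilization n k f0 z" using c t0 nk by (simp add: G'_def stabilization_Suc)
    qed
  qed
  show ?thesis by (rule that[of G']) (use 1 2 3 4 in \<open>simp add: jump_one_family_def\<close>)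
qed

lemma holo_germ_shift:
  assumes "holo_germ n f"
  shows "holo_germ (Suc n) (\<lambda>w. f (\<lambda>i. w (Suc i)))"
proof (rule holo_germ_cong)
  show "holo_germ (Suc n) (\<lambda>w. f (tuple n (\<lambda>i w. w (Suc i)) w))"
    by (rule holo_germ_comp[OF assms]) (simp add: map_germ_def)
  show "\<forall>\<^sub>F w in near_origin (Suc n). f (tuple n (\<lambda>i w. w (Suc i)) w) = f (\<lambda>i. w (Suc i))"
    using eventually_in_cspace
  proof eventually_elim
    fix w assume "w \<in> cspace (Suc n)"
    then have "tuple n (\<lambda>i w. w (Suc i)) w = (\<lambda>i. w (Suc i))" by (auto simp: tuple_def cspace_def fun_eq_iff)
    then show "f (tuple n (\<lambda>i w. w (Suc i)) w) = f (\<lambda>i. w (Suc i))" by simp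
  qed
qed

lemma holo_germ_deform: "holo_germ 2 (deform b s)"
  unfolding deform_def[abs_def] by (intro holo_germ_intros)

lemma eventually_in_open:
  assumes "open_in_cspace n U" "origin \<in> U"
  shows "\<forall>\<^sub>F z in near_origin n. z \<in> U"
proof -
  obtain r where "r > 0" "polydisc n r \<subseteq> U" using polydisc_subset_openin[OF assms] .
  then show ?thesis unfolding eventually_near_origin by (intro exI[of _ r]) auto
qed

text \<open>\<open>\<Phi>\<close> and its inverse are controlled only on \<open>U\<close> and
  \<open>V\<close>. The component families agree with them near the origin and have values in
  \<open>cspace p\<close> everywhere, as composition requires.\<close>

lemma biholo_germ_map_germs:
  assumes "biholo_germ p \<Phi>"
  obtains \<phi> \<psi> where "map_germ p p \<phi>" "map_germ p p \<psi>"
    "\<forall>\<^sub>F z in near_origin p. \<Phi> z = tuple p \<phi> z"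
    "\<forall>\<^sub>F z in near_origin p. tuple p \<psi> (tuple p \<phi> z) = z"
    "\<forall>\<^sub>F z in near_origin p. tuple p \<phi> (tuple p \<psi> z) = z"
proof -
  obtain U V where U: "open_in_cspace p U" "origin \<in> U" and V: "open_in_cspace p V" and \<Phi>0: "\<Phi> origin = origin"
    and bij: "bij_betw \<Phi> U V" and hol: "\<And>i. i < p \<Longrightarrow> holo_on p (\<lambda>z. \<Phi> z i) U"
    "\<And>i. i < p \<Longrightarrow> holo_on p (\<lambda>w. inv_into U \<Phi> w i) V"
    using assms unfolding biholo_germ_def by blast
  have inj: "inj_on \<Phi> U" and im: "\<Phi> ` U = V" using bij by (auto simp: bij_betw_def)
  have V0: "origin \<in> V" using im U(2) \<Phi>0 by (metis imageI)
  have sub: "U \<subseteq> cspace p" "V \<subseteq> cspace p"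
    using U(1) V by (auto simp: open_in_cspace_def dest: openin_imp_subset)
  let ?\<phi> = "\<lambda>i z. \<Phi> z i" and ?\<psi> = "\<lambda>i w. inv_into U \<Phi> w i"
  have t\<phi>: "tuple p ?\<phi> z = \<Phi> z" if "z \<in> U" for z
  proof -
    have "\<Phi> z \<in> cspace p" using that im sub by blast
    then show ?thesis by (auto simp: tuple_def cspace_def fun_eq_iff)
  qed
  have inv_in: "inv_into U \<Phi> w \<in> U" if "w \<in> V" for w using that im by (simp add: inv_into_into)
  have t\<psi>: "tuple p ?\<psi> w = inv_into U \<Phi> w" if "w \<in> V" for w
  proof -
    have "inv_into U \<Phi> w \<in> cspace p" using inv_in[OF that] sub by blast
    then show ?thesis by (auto simp: tuple_def cspace_def fun_eq_iff)
  qed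
  have inv0: "inv_into U \<Phi> origin = origin" using inv_into_f_f[OF inj U(2)] \<Phi>0 by simp
  show ?thesis
  proof
    show "map_germ p p ?\<phi>" "map_germ p p ?\<psi>"
      using hol U V V0 \<Phi>0 inv0 by (auto simp: map_germ_def holo_germ_def)
    show "\<forall>\<^sub>F z in near_origin p. \<Phi> z = tuple p ?\<phi> z"
      using eventually_in_open[OF U] by eventually_elim (simp add: t\<phi>)
    show "\<forall>\<^sub>F z in near_origin p. tuple p ?\<psi> (tuple p ?\<phi> z) = z"
      using eventually_in_open[OF U] by eventually_elim (use im inj in \<open>auto simp: t\<phi> t\<psi>\<close>)
    show "\<forall>\<^sub>F z in near_origin p. tuple p ?\<phi> (tuple p ?\<psi> z) = z"
      using eventually_in_open[OF V V0]
      by eventually_elim (use im inv_in in \<open>auto simp: t\<phi> t\<psi> f_inv_into_f\<close>)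
  qed
qed

text \<open>The family is the stabilized \<open>deform b s\<close> composed with the local inverse
  \<open>\<psi>\<close> of \<open>\<Phi>\<close>. Since composing the stabilization of
  \<open>f0\<close> with \<open>\<Phi>\<close> gives that of the normal form, the member at
  \<open>s = 0\<close> is the stabilization of \<open>f0\<close>.\<close>

lemma jump_one_family_initial:
  assumes p: "2 \<le> p" and \<Phi>: "biholo_germ p \<Phi>"
    and eq: "\<forall>\<^sub>F z in near_origin p. stabilization n p f0 (\<Phi> z) = stabilization 2 p (deform b 0) z"
  obtains G where "jump_one_family n p f0 G"
proof -
  obtain \<phi> \<psi> where \<phi>: "map_germ p p \<phi>" and \<psi>: "map_germ p p \<psi>"
    and \<Phi>\<phi>: "\<forall>\<^sub>F z in near_origin p. \<Phi> z = tuple p \<phi> z"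
    and \<psi>\<phi>: "\<forall>\<^sub>F z in near_origin p. tuple p \<psi> (tuple p \<phi> z) = z"
    and \<phi>\<psi>: "\<forall>\<^sub>F z in near_origin p. tuple p \<phi> (tuple p \<psi> z) = z"
    by (rule biholo_germ_map_germs[OF \<Phi>])
  define G where "G s z = stabilization 2 p (deform b s) (tuple p \<psi> z)" for s z
  have sh: "holo_germ (Suc p) (\<lambda>w. \<psi> i (\<lambda>j. w (Suc j)))" if "i < p" for i
    by (rule holo_germ_shift) (use \<psi> that in \<open>simp add: map_germ_def\<close>)
  \<comment> \<open>With \<open>s\<close> written as variable 0 the family is a polynomial in
    \<open>s\<close> and the components of \<open>\<psi>\<close>, so joint holomorphy is visible
    term by term.\<close>
  have uG: "uncurry_param G = (\<lambda>w. deform b (w 0) (tuple p \<psi> (\<lambda>j. w (Suc j))) + (\<Sum>i=2..<p. (\<psi> i (\<lambda>j. w (Suc j)))\<^sup>2))"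
    using p by (auto simp: uncurry_param_def G_def stabilization_eq_trunc deform_def tuple_def fun_eq_iff intro!: sum.cong)
  have 1: "holo_germ (Suc p) (uncurry_param G)"
  proof -
    have "holo_germ (Suc p) (\<lambda>w. tuple p \<psi> (\<lambda>j. w (Suc j)) i)" if "i < p" for i
      using sh[OF that] that by (simp add: tuple_def)
    from this[of 0] this[of 1] p
    have t: "holo_germ (Suc p) (\<lambda>w. tuple p \<psi> (\<lambda>j. w (Suc j)) 0)" "holo_germ (Suc p) (\<lambda>w. tuple p \<psi> (\<lambda>j. w (Suc j)) 1)"
      by auto
    show ?thesis unfolding uG deform_def
      by (intro holo_germ_add holo_germ_mult holo_germ_power holo_germ_sum holo_germ_const holo_germ_coord t sh) simp
  qed
  have 2: "\<forall>\<^sub>F z in near_origin p. G 0 z = stabilization n p f0 z"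
    using eventually_tuple[OF \<psi> eq] eventually_tuple[OF \<psi> \<Phi>\<phi>] \<phi>\<psi>
    by eventually_elim (simp add: G_def)
  have 3: "G s origin = 0" for s
    using tuple_origin[OF \<psi>] tuple_origin[OF map_germ_trunc, of 2]
    by (simp add: G_def stabilization_eq_trunc deform_def)
  have 4: "qdim p (jac_ideal p (G s)) (if s = 0 then 15 else 14)" for s
  proof -
    have "qdim 2 (jac_ideal 2 (deform b s)) (if s = 0 then 15 else 14)"
      using qdim_deform_0 qdim_deform_nonzero by simp
    from qdim_stabilization[OF holo_germ_deform this p]
    show ?thesis
      unfolding G_def[abs_def]
      by (rule qdim_biholo[OF \<phi> \<psi> \<psi>\<phi> \<phi>\<psi> holo_germ_stabilization[OF holo_germ_deform], THEN iffD1])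
  qed
  show ?thesis by (rule that[of G]) (use 1 2 3 4 in \<open>simp add: jump_one_family_def\<close>)
qed

theorem corollary1:
  fixes n :: nat and f0 :: "(nat \<Rightarrow> complex) \<Rightarrow> complex" and b :: complex
  assumes "isolated_singularity n f0"
    and "stably_equivalent n f0 2 (\<lambda>z. (z 0) ^ 4 + (z 1) ^ 6 + b * (z 0)\<^sup>2 * (z 1) ^ 4)"
  shows "jump_of_milnor_number n f0 = 1"
proof -
  have deform: "(\<lambda>z. (z 0) ^ 4 + (z 1) ^ 6 + b * (z 0)\<^sup>2 * (z 1) ^ 4) = deform b 0"
    by (auto simp: deform_def fun_eq_iff simp flip: power_mult)
  obtain p \<Phi> where p: "2 \<le> p" "n \<le> p" and \<Phi>: "biholo_germ p \<Phi>"
    "\<forall>\<^sub>F z in near_origin p. stabilization n p f0 (\<Phi> z) = stabilization 2 p (deform b 0) z"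
    using assms(2) unfolding stably_equivalent_def deform by auto
  obtain G where "jump_one_family n p f0 G"
    by (rule jump_one_family_initial[OF p(1) \<Phi>])
  then have "\<exists>G. jump_one_family n p f0 G" by (rule exI[of _ G])
  with p(2) have "\<exists>G. jump_one_family n n f0 G"
  proof (induction p rule: dec_induct)
    case (step p)
    then obtain G where "jump_one_family n (Suc p) f0 G" by blast
    then obtain G' where "jump_one_family n p f0 G'" using jump_one_family_descend step(1) by blast
    then show ?case using step.IH by blast
  qed
  then obtain G where G: "holo_germ (Suc n) (uncurry_param G)"
    and G0: "\<forall>\<^sub>F z in near_origin n. G 0 z = stabilization n n f0 z"
    and Gs0: "\<forall>\<^sub>F s in nhds 0. G s origin = 0"
    and dim: "\<forall>\<^sub>F s in nhds 0. qdim n (jac_ideal n (G s)) (if s = 0 then 15 else 14)"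
    unfolding jump_one_family_def by blast
  have G0: "\<forall>\<^sub>F z in near_origin n. G 0 z = f0 z"
    using G0 eventually_in_cspace by eventually_elim (simp add: stabilization_self)
  have "deformation n f0 G"
    unfolding deformation_def
  proof (intro conjI G0 Gs0)
    show "holo_germ (Suc n) (\<lambda>w. G (w 0) (\<lambda>i. w (Suc i)))"
      using G by (simp add: uncurry_param_def[abs_def])
    show "\<forall>\<^sub>F s in nhds 0. \<forall>\<^sub>F z in at origin within cspace n. \<not> grad_zero n (G s) z"
      using dim by eventually_elim (rule qdim_imp_isolated)
  qed
  moreover have "has_jump n f0 G 1"
  proof -
    have "holo_germ n f0"
      using assms(1) by (auto simp: isolated_singularity_def holo_germ_def)
    \<comment> \<open>The value at \<open>s = 0\<close> of a statement that holds eventually in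
      \<open>nhds 0\<close>, a filter that includes the point 0.\<close>
    moreover have "qdim n (jac_ideal n f0) 15"
      using eventually_nhds_x_imp_x[OF dim] jac_ideal_cong[OF G0] by simp
    ultimately have 15: "milnor_number n f0 = enat 15" by (simp add: milnor_number_eq)
    have "\<forall>\<^sub>F s in nhds 0. holo_germ n (G s)"
      using holo_germ_slice[OF G] by simp
    then have "\<forall>\<^sub>F s in nhds 0. s \<noteq> 0 \<longrightarrow> milnor_number n (G s) = enat 14"
      using dim by eventually_elim (auto intro: milnor_number_eq)
    then show ?thesis
      unfolding has_jump_def eventually_at_filter by eventually_elim (simp add: 15)
  qed
  ultimately have "enat 1 \<in> {enat d | d. d \<noteq> 0 \<and> (\<exists>f. deformation n f0 f \<and> has_jump n f0 f d)}"
    by blast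
  then have "jump_of_milnor_number n f0 \<le> 1"
    unfolding jump_of_milnor_number_def one_enat_def by (rule Inf_lower)
  moreover have "1 \<le> jump_of_milnor_number n f0"
    unfolding jump_of_milnor_number_def
    by (rule Inf_greatest) (auto simp: one_enat_def)
  ultimately show ?thesis by (rule antisym)
qed

end
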